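(* Let $(M^{2n},g,J)$ be a Hermitian locally symmetric manifold, let $\delta$ be a real constant, and let $T_1M$ be its Berger tangent sphere bundle with bundle projection $\pi:T_1M\to M$. Let $\Gamma$ be a geodesic of $T_1M$ and let $\gamma=\pi\circ\Gamma$ be its projection to $M$. Then all geodesic curvatures of $\gamma$ are constant.
   Context: Hermitian locally symmetric manifold: a Hermitian manifold $(M^{2n},g,J)$ (real dimension $2n$, $g$ a Riemannian metric, $J$ a complex structure orthogonal with respect to $g$) that is locally symmetric in the Hermitian sense; such an $M$ is necessarily Kähler ($\nabla J=0$) and locally symmetric as a Riemannian manifold ($\nabla R=0$), where $\nabla$ is the Levi-Civita connection of $g$ and $R$ its curvature tensor. Write $\langle\cdot,\cdot\rangle=g$. Lifts: in the natural local coordinates $(x^i;\xi^i)$ on $TM$, with $\partial_i=\partial/\partial x^i$, $\partial_{2n+i}=\partial/\partial\xi^i$ and $\Gamma^i_{jk}$ the Christoffel symbols of $g$, the horizontal and vertical lifts at $Q=(q,\xi)\in TM$ of $X=X^i\partial_i\in T_qM$ are $X^h=X^i\partial_i-\Gamma^i_{jk}\xi^jX^k\partial_{2n+i}$ and $X^v=X^i\partial_{2n+i}$. Berger tangent bundle: $TM$ with the Riemannian metric $\langle\langle\cdot,\cdot\rangle\rangle$ defined at $(q,\xi)$ by $\langle\langle X^h,Y^h\rangle\rangle=\langle X,Y\rangle$, $\langle\langle X^h,Y^v\rangle\rangle=0$, $\langle\langle X^v,Y^v\rangle\rangle=\langle X,Y\rangle+\delta^2\langle X,J\xi\rangle\langle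 Y,J\xi\rangle$, where $\delta$ is a constant. The Berger tangent sphere bundle is $T_1M=\{(q,\xi)\in TM:|\xi|=1\}$ with the induced metric. Geodesic curvatures: for a (non-constant, regular) curve $\gamma$ in $M$ parametrized by arc length $s$, the Frenet frame $\nu_1=\gamma'_s,\nu_2,\dots$ and the geodesic curvatures $k_1,\dots,k_{2n-1}$ are those of the usual Frenet formulas $\nabla_{\nu_1}\nu_1=k_1\nu_2$, $\nabla_{\nu_1}\nu_i=-k_{i-1}\nu_{i-1}+k_i\nu_{i+1}$; if some $k_i$ vanishes identically, the subsequent ones are taken to be zero. *)

theory Defs
  imports "HOL-Analysis.Analysis"
begin

section \<open>Smooth maps between Euclidean spaces\<close>

primrec Ck_on :: "nat \<Rightarrow> 'x::real_normed_vector set \<Rightarrow> ('x \<Rightarrow> 'y::real_normed_vector) \<Rightarrow> bool" where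
  "Ck_on 0 S f \<longleftrightarrow> continuous_on S f"
| "Ck_on (Suc k) S f \<longleftrightarrow> (\<forall>x\<in>S. f differentiable (at x)) \<and>
     (\<forall>v. Ck_on k S (\<lambda>x. frechet_derivative f (at x) v))"

text \<open>Only used for open \<^term>\<open>S\<close>.\<close>
definition smooth_on :: "'x::real_normed_vector set \<Rightarrow> ('x \<Rightarrow> 'y::real_normed_vector) \<Rightarrow> bool" where
  "smooth_on S f \<longleftrightarrow> (\<forall>k. Ck_on k S f)"


section \<open>Manifolds\<close>

text \<open>The value of \<open>cmap c\<close> outside of \<open>cdom c\<close> is irrelevant.\<close>
datatype ('a, 'e) chart = Chart (cdom: "'a set") (cmap: "'a \<Rightarrow> 'e")

definition cimage :: "('a, 'e) chart \<Rightarrow> 'e set" where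
  "cimage c = cmap c ` cdom c"

definition cinv :: "('a, 'e) chart \<Rightarrow> 'e \<Rightarrow> 'a" where
  "cinv c = inv_into (cdom c) (cmap c)"

definition is_chart :: "('a, 'e::euclidean_space) chart \<Rightarrow> bool" where
  "is_chart c \<longleftrightarrow> inj_on (cmap c) (cdom c) \<and> open (cimage c)"

definition smooth_transition ::
  "('a, 'e::euclidean_space) chart \<Rightarrow> ('a, 'e) chart \<Rightarrow> bool" where
  "smooth_transition c d \<longleftrightarrow>
     open (cmap c ` (cdom c \<inter> cdom d)) \<and>
     smooth_on (cmap c ` (cdom c \<inter> cdom d)) (cmap d \<circ> cinv c)"

definition compatible :: "('a, 'e::euclidean_space) chart \<Rightarrow> ('a, 'e) chart \<Rightarrow> bool" where
  "compatible c d \<longleftrightarrow> smooth_transition c d \<and> smooth_transition d c"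

text \<open>The underlying point set and topology of the manifold given by a set of charts.\<close>

definition mcarrier :: "('a, 'e) chart set \<Rightarrow> 'a set" where
  "mcarrier A = \<Union> (cdom ` A)"

definition mtop :: "('a, 'e::euclidean_space) chart set \<Rightarrow> 'a topology" where
  "mtop A = topology_generated_by {cdom c \<inter> cmap c -` W | c W. c \<in> A \<and> open W}"

text \<open>A smooth manifold modelled on \<^typ>\<open>'e\<close> is given by its maximal atlas.\<close>
definition smooth_manifold :: "('a, 'e::euclidean_space) chart set \<Rightarrow> bool" where
  "smooth_manifold A \<longleftrightarrow>
     (\<forall>c\<in>A. is_chart c) \<and>
     (\<forall>c\<in>A. \<forall>d\<in>A. compatible c d) \<and>
     (\<forall>c. is_chart c \<and> cdom c \<subseteq> mcarrier A \<and> (\<forall>d\<in>A. compatible c d) \<longrightarrow> c \<in> A) \<and>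
     Hausdorff_space (mtop A) \<and> second_countable (mtop A)"

definition smooth_map ::
  "('a, 'e::euclidean_space) chart set \<Rightarrow> ('b, 'f::euclidean_space) chart set \<Rightarrow>
   'a set \<Rightarrow> ('a \<Rightarrow> 'b) \<Rightarrow> bool" where
  "smooth_map A B U f \<longleftrightarrow> f ` U \<subseteq> mcarrier B \<and>
     (\<forall>c\<in>A. \<forall>d\<in>B. let W = cmap c ` (U \<inter> cdom c \<inter> f -` cdom d) in
        open W \<and> smooth_on W (cmap d \<circ> f \<circ> cinv c))"

definition smooth_curve ::
  "('a, 'e::euclidean_space) chart set \<Rightarrow> real set \<Rightarrow> (real \<Rightarrow> 'a) \<Rightarrow> bool" where
  "smooth_curve A I \<gamma> \<longleftrightarrow> \<gamma> ` I \<subseteq> mcarrier A \<and>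
     (\<forall>c\<in>A. let W = I \<inter> \<gamma> -` cdom c in open W \<and> smooth_on W (cmap c \<circ> \<gamma>))"


section \<open>Tangent vectors\<close>

text \<open>A tangent vector at \<open>q\<close> assigns to every chart around \<open>q\<close> a component vector, the
  components being related by the Jacobians of the coordinate changes; it is \<open>0\<close> on all other charts.\<close>

type_synonym ('a, 'e) tangent = "('a, 'e) chart \<Rightarrow> 'e"

definition tangent_space ::
  "('a, 'e::euclidean_space) chart set \<Rightarrow> 'a \<Rightarrow> ('a, 'e) tangent set" where
  "tangent_space A q = {v.
     (\<forall>c\<in>A. \<forall>d\<in>A. q \<in> cdom c \<and> q \<in> cdom d \<longrightarrow>
        v d = frechet_derivative (cmap d \<circ> cinv c) (at (cmap c q)) (v c)) \<and>
     (\<forall>c. \<not> (c \<in> A \<and> q \<in> cdom c) \<longrightarrow> v c = 0)}"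

text \<open>The tangent vector at \<open>q\<close> with components \<open>a\<close> in the chart \<open>c\<close>.\<close>
definition tvec ::
  "('a, 'e::euclidean_space) chart set \<Rightarrow> ('a, 'e) chart \<Rightarrow> 'a \<Rightarrow> 'e \<Rightarrow> ('a, 'e) tangent" where
  "tvec A c q a = (\<lambda>d. if d \<in> A \<and> q \<in> cdom d
     then frechet_derivative (cmap d \<circ> cinv c) (at (cmap c q)) a else 0)"

text \<open>The differential at \<open>q\<close> of a smooth map; the choice of the chart \<open>c\<close> is immaterial.\<close>
definition differential ::
  "('a, 'e::euclidean_space) chart set \<Rightarrow> ('b, 'f::euclidean_space) chart set \<Rightarrow>
   ('a \<Rightarrow> 'b) \<Rightarrow> 'a \<Rightarrow> ('a, 'e) tangent \<Rightarrow> ('b, 'f) tangent" where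
  "differential A B f q v = (let c = (SOME c. c \<in> A \<and> q \<in> cdom c) in
     (\<lambda>d. if d \<in> B \<and> f q \<in> cdom d
       then frechet_derivative (cmap d \<circ> f \<circ> cinv c) (at (cmap c q)) (v c) else 0))"

definition velocity ::
  "('a, 'e::euclidean_space) chart set \<Rightarrow> (real \<Rightarrow> 'a) \<Rightarrow> real \<Rightarrow> ('a, 'e) tangent" where
  "velocity A \<gamma> t = (\<lambda>c. if c \<in> A \<and> \<gamma> t \<in> cdom c
     then vector_derivative (cmap c \<circ> \<gamma>) (at t) else 0)"

definition regular_curve ::
  "('a, 'e::euclidean_space) chart set \<Rightarrow> real set \<Rightarrow> (real \<Rightarrow> 'a) \<Rightarrow> bool" where
  "regular_curve A I \<gamma> \<longleftrightarrow> smooth_curve A I \<gamma> \<and> (\<forall>t\<in>I. velocity A \<gamma> t \<noteq> (\<lambda>c. 0))"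


section \<open>Riemannian metrics, Levi-Civita connection, geodesics\<close>

type_synonym ('a, 'e) metric_field = "'a \<Rightarrow> ('a, 'e) tangent \<Rightarrow> ('a, 'e) tangent \<Rightarrow> real"

text \<open>The coordinate expression of a metric in the chart \<open>c\<close>.\<close>
definition metric_loc ::
  "('a, 'e::euclidean_space) chart set \<Rightarrow> ('a, 'e) metric_field \<Rightarrow> ('a, 'e) chart \<Rightarrow>
   'e \<Rightarrow> 'e \<Rightarrow> 'e \<Rightarrow> real" where
  "metric_loc A g c x a b =
     g (cinv c x) (tvec A c (cinv c x) a) (tvec A c (cinv c x) b)"

definition riemannian_metric ::
  "('a, 'e::euclidean_space) chart set \<Rightarrow> ('a, 'e) metric_field \<Rightarrow> bool" where
  "riemannian_metric A g \<longleftrightarrow> (\<forall>c\<in>A.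
     (\<forall>x\<in>cimage c. bilinear (metric_loc A g c x) \<and>
        (\<forall>a b. metric_loc A g c x a b = metric_loc A g c x b a) \<and>
        (\<forall>a. a \<noteq> 0 \<longrightarrow> metric_loc A g c x a a > 0)) \<and>
     (\<forall>a b. smooth_on (cimage c) (\<lambda>x. metric_loc A g c x a b)))"

definition metric_norm :: "('a, 'e) metric_field \<Rightarrow> 'a \<Rightarrow> ('a, 'e) tangent \<Rightarrow> real" where
  "metric_norm g q v = sqrt (g q v v)"

text \<open>\<open>christoffel m x a b\<close> is the vector with components
  \<open>\<Gamma>\<^sup>i\<^sub>j\<^sub>k a\<^sup>j b\<^sup>k\<close>, where \<open>\<Gamma>\<close> are the Christoffel symbols of the metric
  \<open>m\<close> on an open subset of \<^typ>\<open>'e\<close>: raising the index in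
  \<open>\<Gamma>\<^sub>l\<^sub>,\<^sub>j\<^sub>k = (\<partial>\<^sub>j m\<^sub>k\<^sub>l + \<partial>\<^sub>k m\<^sub>j\<^sub>l - \<partial>\<^sub>l m\<^sub>j\<^sub>k) / 2\<close> means solving for the vector \<open>u\<close>.\<close>
definition christoffel ::
  "('e::euclidean_space \<Rightarrow> 'e \<Rightarrow> 'e \<Rightarrow> real) \<Rightarrow> 'e \<Rightarrow> 'e \<Rightarrow> 'e \<Rightarrow> 'e" where
  "christoffel m x a b = (THE u. \<forall>w. m x u w =
     (frechet_derivative (\<lambda>y. m y b w) (at x) a
    + frechet_derivative (\<lambda>y. m y a w) (at x) b
    - frechet_derivative (\<lambda>y. m y a b) (at x) w) / 2)"

text \<open>The Levi-Civita covariant derivative \<open>\<nabla>V/dt\<close> of a vector field \<open>V\<close> along \<open>\<gamma>\<close>.\<close>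
definition cov_deriv ::
  "('a, 'e::euclidean_space) chart set \<Rightarrow> ('a, 'e) metric_field \<Rightarrow> (real \<Rightarrow> 'a) \<Rightarrow>
   (real \<Rightarrow> ('a, 'e) tangent) \<Rightarrow> real \<Rightarrow> ('a, 'e) tangent" where
  "cov_deriv A g \<gamma> V t = (\<lambda>c. if c \<in> A \<and> \<gamma> t \<in> cdom c
     then vector_derivative (\<lambda>\<tau>. V \<tau> c) (at t)
        + christoffel (metric_loc A g c) (cmap c (\<gamma> t)) (velocity A \<gamma> t c) (V t c)
     else 0)"

definition geodesic ::
  "('a, 'e::euclidean_space) chart set \<Rightarrow> ('a, 'e) metric_field \<Rightarrow> real set \<Rightarrow>
   (real \<Rightarrow> 'a) \<Rightarrow> bool" where
  "geodesic A g I \<gamma> \<longleftrightarrow> smooth_curve A I \<gamma> \<and>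
     (\<forall>t\<in>I. cov_deriv A g \<gamma> (velocity A \<gamma>) t = (\<lambda>c. 0))"


section \<open>Frenet frame and geodesic curvatures\<close>

text \<open>\<open>\<nabla>\<close> in the direction of \<open>\<nu>\<^sub>1 = \<gamma>'\<^sub>s\<close>, i.e. covariant differentiation with respect to arc length.\<close>
definition arc_cov_deriv ::
  "('a, 'e::euclidean_space) chart set \<Rightarrow> ('a, 'e) metric_field \<Rightarrow> (real \<Rightarrow> 'a) \<Rightarrow>
   (real \<Rightarrow> ('a, 'e) tangent) \<Rightarrow> real \<Rightarrow> ('a, 'e) tangent" where
  "arc_cov_deriv A g \<gamma> V t =
     (\<lambda>c. cov_deriv A g \<gamma> V t c /\<^sub>R metric_norm g (\<gamma> t) (velocity A \<gamma> t))"

definition unit_velocity ::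
  "('a, 'e::euclidean_space) chart set \<Rightarrow> ('a, 'e) metric_field \<Rightarrow> (real \<Rightarrow> 'a) \<Rightarrow>
   real \<Rightarrow> ('a, 'e) tangent" where
  "unit_velocity A g \<gamma> t =
     (\<lambda>c. velocity A \<gamma> t c /\<^sub>R metric_norm g (\<gamma> t) (velocity A \<gamma> t))"

text \<open>\<open>frenet A g \<gamma> i\<close> is the triple \<open>(\<nu>\<^sub>i, \<nu>\<^sub>i\<^sub>+\<^sub>1, k\<^sub>i)\<close> with the conventions \<open>\<nu>\<^sub>0 = 0\<close>, \<open>k\<^sub>0 = 0\<close>.
  The Frenet formula, solved for its last term \<open>w = k\<^sub>i \<nu>\<^sub>i\<^sub>+\<^sub>1 = \<nabla>\<^bsub>\<nu>\<^sub>1\<^esub> \<nu>\<^sub>i + k\<^sub>i\<^sub>-\<^sub>1 \<nu>\<^sub>i\<^sub>-\<^sub>1\<close>,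
  determines \<open>k\<^sub>i = |w|\<close> and \<open>\<nu>\<^sub>i\<^sub>+\<^sub>1 = w / |w|\<close>. Since division by \<open>0\<close> yields \<open>0\<close>, identical
  vanishing of \<open>k\<^sub>i\<close> makes \<open>\<nu>\<^sub>i\<^sub>+\<^sub>1\<close> and all later curvatures vanish.\<close>
primrec frenet ::
  "('a, 'e::euclidean_space) chart set \<Rightarrow> ('a, 'e) metric_field \<Rightarrow> (real \<Rightarrow> 'a) \<Rightarrow> nat \<Rightarrow>
   (real \<Rightarrow> ('a, 'e) tangent) \<times> (real \<Rightarrow> ('a, 'e) tangent) \<times> (real \<Rightarrow> real)" where
  "frenet A g \<gamma> 0 = ((\<lambda>t c. 0), unit_velocity A g \<gamma>, (\<lambda>t. 0))"
| "frenet A g \<gamma> (Suc i) = (case frenet A g \<gamma> i of (\<nu>, \<nu>', k) \<Rightarrow>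
     let w = (\<lambda>t c. arc_cov_deriv A g \<gamma> \<nu>' t c + k t *\<^sub>R \<nu> t c);
         k' = (\<lambda>t. metric_norm g (\<gamma> t) (w t))
     in (\<nu>', (\<lambda>t c. w t c /\<^sub>R k' t), k'))"

definition geodesic_curvature ::
  "('a, 'e::euclidean_space) chart set \<Rightarrow> ('a, 'e) metric_field \<Rightarrow> (real \<Rightarrow> 'a) \<Rightarrow> nat \<Rightarrow>
   real \<Rightarrow> real" where
  "geodesic_curvature A g \<gamma> i = snd (snd (frenet A g \<gamma> i))"


section \<open>Hermitian locally symmetric manifolds\<close>

type_synonym ('a, 'e) endo_field = "'a \<Rightarrow> ('a, 'e) tangent \<Rightarrow> ('a, 'e) tangent"

definition endo_loc ::
  "('a, 'e::euclidean_space) chart set \<Rightarrow> ('a, 'e) endo_field \<Rightarrow> ('a, 'e) chart \<Rightarrow>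
   'e \<Rightarrow> 'e \<Rightarrow> 'e" where
  "endo_loc A J c x a = J (cinv c x) (tvec A c (cinv c x) a) c"

definition almost_complex_structure ::
  "('a, 'e::euclidean_space) chart set \<Rightarrow> ('a, 'e) endo_field \<Rightarrow> bool" where
  "almost_complex_structure A J \<longleftrightarrow>
     (\<forall>q\<in>mcarrier A. \<forall>v\<in>tangent_space A q.
        J q v \<in> tangent_space A q \<and> J q (J q v) = (\<lambda>c. - v c)) \<and>
     (\<forall>c\<in>A. (\<forall>x\<in>cimage c. linear (endo_loc A J c x)) \<and>
        (\<forall>a. smooth_on (cimage c) (\<lambda>x. endo_loc A J c x a)))"

text \<open>A complex structure comes from an atlas of holomorphic coordinates, i.e. of charts in which
  \<open>J\<close> is a constant endomorphism of the model space. Recall that \<open>A\<close> is a maximal atlas.\<close>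
definition complex_structure ::
  "('a, 'e::euclidean_space) chart set \<Rightarrow> ('a, 'e) endo_field \<Rightarrow> bool" where
  "complex_structure A J \<longleftrightarrow> almost_complex_structure A J \<and>
     (\<forall>q\<in>mcarrier A. \<exists>c\<in>A. q \<in> cdom c \<and> (\<exists>L. \<forall>x\<in>cimage c. endo_loc A J c x = L))"

definition hermitian_manifold ::
  "('a, 'e::euclidean_space) chart set \<Rightarrow> ('a, 'e) metric_field \<Rightarrow> ('a, 'e) endo_field \<Rightarrow> bool" where
  "hermitian_manifold A g J \<longleftrightarrow> smooth_manifold A \<and> riemannian_metric A g \<and>
     complex_structure A J \<and>
     (\<forall>q\<in>mcarrier A. \<forall>v\<in>tangent_space A q. \<forall>w\<in>tangent_space A q.
        g q (J q v) (J q w) = g q v w)"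

text \<open>Around every point \<open>p\<close> there is a local symmetry \<open>s\<close> with \<open>s p = p\<close> and \<open>ds\<^sub>p = - id\<close> that is
  isometric and holomorphic.\<close>
definition hermitian_locally_symmetric ::
  "('a, 'e::euclidean_space) chart set \<Rightarrow> ('a, 'e) metric_field \<Rightarrow> ('a, 'e) endo_field \<Rightarrow> bool" where
  "hermitian_locally_symmetric A g J \<longleftrightarrow> hermitian_manifold A g J \<and>
     (\<forall>p\<in>mcarrier A. \<exists>U s. openin (mtop A) U \<and> p \<in> U \<and> smooth_map A A U s \<and> s p = p \<and>
        (\<forall>v\<in>tangent_space A p. differential A A s p v = (\<lambda>c. - v c)) \<and>
        (\<forall>q\<in>U. \<forall>v\<in>tangent_space A q.
           differential A A s q (J q v) = J (s q) (differential A A s q v) \<and>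
           (\<forall>w\<in>tangent_space A q.
              g (s q) (differential A A s q v) (differential A A s q w) = g q v w)))"


section \<open>The tangent bundle with its Berger metric\<close>

definition tangent_bundle ::
  "('a, 'e::euclidean_space) chart set \<Rightarrow> ('a \<times> ('a, 'e) tangent) set" where
  "tangent_bundle A = Sigma (mcarrier A) (tangent_space A)"

text \<open>The natural coordinates \<open>(x; \<xi>)\<close> on the tangent bundle.\<close>
definition natural_chart ::
  "('a, 'e::euclidean_space) chart set \<Rightarrow> ('a, 'e) chart \<Rightarrow>
   ('a \<times> ('a, 'e) tangent, 'e \<times> 'e) chart" where
  "natural_chart A c =
     Chart (Sigma (cdom c) (tangent_space A)) (\<lambda>(q, \<xi>). (cmap c q, \<xi> c))"

definition tangent_atlas ::
  "('a, 'e::euclidean_space) chart set \<Rightarrow> ('a \<times> ('a, 'e) tangent, 'e \<times> 'e) chart set" where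
  "tangent_atlas A = natural_chart A ` A"

text \<open>The lifts of \<open>X \<in> T\<^sub>qM\<close> to \<open>Q = (q, \<xi>)\<close>, written in the natural coordinates of \<open>c\<close>.\<close>

definition hlift ::
  "('a, 'e::euclidean_space) chart set \<Rightarrow> ('a, 'e) metric_field \<Rightarrow> ('a, 'e) chart \<Rightarrow>
   'a \<times> ('a, 'e) tangent \<Rightarrow> ('a, 'e) tangent \<Rightarrow>
   ('a \<times> ('a, 'e) tangent, 'e \<times> 'e) tangent" where
  "hlift A g c Q X = tvec (tangent_atlas A) (natural_chart A c) Q
     (X c, - christoffel (metric_loc A g c) (cmap c (fst Q)) (snd Q c) (X c))"

definition vlift ::
  "('a, 'e::euclidean_space) chart set \<Rightarrow> ('a, 'e) chart \<Rightarrow>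
   'a \<times> ('a, 'e) tangent \<Rightarrow> ('a, 'e) tangent \<Rightarrow>
   ('a \<times> ('a, 'e) tangent, 'e \<times> 'e) tangent" where
  "vlift A c Q X = tvec (tangent_atlas A) (natural_chart A c) Q (0, X c)"

definition berger_metric ::
  "('a, 'e::euclidean_space) chart set \<Rightarrow> ('a, 'e) metric_field \<Rightarrow> ('a, 'e) endo_field \<Rightarrow> real \<Rightarrow>
   ('a \<times> ('a, 'e) tangent, 'e \<times> 'e) metric_field \<Rightarrow> bool" where
  "berger_metric A g J \<delta> G \<longleftrightarrow> riemannian_metric (tangent_atlas A) G \<and>
     (\<forall>c\<in>A. \<forall>q\<in>cdom c. \<forall>\<xi>\<in>tangent_space A q. \<forall>X\<in>tangent_space A q. \<forall>Y\<in>tangent_space A q.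
        G (q, \<xi>) (hlift A g c (q, \<xi>) X) (hlift A g c (q, \<xi>) Y) = g q X Y \<and>
        G (q, \<xi>) (hlift A g c (q, \<xi>) X) (vlift A c (q, \<xi>) Y) = 0 \<and>
        G (q, \<xi>) (vlift A c (q, \<xi>) X) (vlift A c (q, \<xi>) Y) =
          g q X Y + \<delta>\<^sup>2 * g q X (J q \<xi>) * g q Y (J q \<xi>))"


section \<open>Submanifolds and the unit tangent bundle\<close>

text \<open>The charts of an embedded submanifold \<open>N\<close> of the manifold with atlas \<open>T\<close>, modelled on
  \<^typ>\<open>'f\<close>: their inverses are the smooth immersions onto relatively open subsets of \<open>N\<close> that are
  homeomorphisms onto their images (the continuity of \<open>cinv c\<close> follows from its smoothness, its
  openness is the last clause).\<close>
definition submanifold_atlas ::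
  "('b, 'e::euclidean_space) chart set \<Rightarrow> 'b set \<Rightarrow> ('b, 'f::euclidean_space) chart set" where
  "submanifold_atlas T N = {c. is_chart c \<and> cdom c \<subseteq> N \<and>
     (\<forall>d\<in>T. let W = cmap c ` (cdom c \<inter> cdom d) in
        open W \<and> smooth_on W (cmap d \<circ> cinv c) \<and>
        (\<forall>x\<in>W. inj (frechet_derivative (cmap d \<circ> cinv c) (at x)))) \<and>
     (\<forall>W. open W \<and> W \<subseteq> cimage c \<longrightarrow> openin (subtopology (mtop T) N) (cinv c ` W))}"

definition unit_tangent_bundle ::
  "('a, 'e::euclidean_space) chart set \<Rightarrow> ('a, 'e) metric_field \<Rightarrow>
   ('a \<times> ('a, 'e) tangent) set" where
  "unit_tangent_bundle A g = {(q, \<xi>) \<in> tangent_bundle A. metric_norm g q \<xi> = 1}"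

text \<open>The metric induced on a submanifold with atlas \<open>B\<close> of the manifold with atlas \<open>T\<close>, i.e. the
  pullback under the inclusion.\<close>
definition induced_metric ::
  "('b, 'f::euclidean_space) chart set \<Rightarrow> ('b, 'e::euclidean_space) chart set \<Rightarrow>
   ('b, 'e) metric_field \<Rightarrow> ('b, 'f) metric_field" where
  "induced_metric B T G P v w =
     G P (differential B T (\<lambda>P. P) P v) (differential B T (\<lambda>P. P) P w)"

end

(* Let x be the projection of a geodesic of the Berger sphere bundle and xi its direction, V the
   covariant derivative of xi, mu = <V, J xi> and U = V + delta^2 mu J xi. Local symmetries make odd
   order tensors vanish, hence nabla J = 0 and nabla R = 0. The Euler-Lagrange equations of the
   energy |x'|^2 + |V|^2 + delta^2 mu^2 on the unit sphere bundle then read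
     nabla x' = - R(xi, U) x'   and   nabla U = lambda xi - delta^2 mu J V,
   and together with R(J a, b) = - R(a, J b) the second one says that the skew operator R(xi, U) is
   parallel along x. So all covariant derivatives of x' have constant mutual inner products, and the
   Frenet frame consists of their linear combinations with constant coefficients. *)
theory Submission
  imports Defs
begin

subsection \<open>Calculus of smooth maps\<close>

text \<open>Why the second equation makes R(xi, U) parallel: U is the momentum conjugate to xi, that
  is, <U, .> is the vertical Berger product with V. Its derivative consists of lambda xi, killed by
  R(xi, xi) = 0, and of a term in J V that cancels what delta^2 mu J xi contributes to R(V, U). So
  neither lambda nor mu has to be computed, and mu may vary. The obstacle is that geodesics of the
  sphere bundle are defined through charts of a submanifold atlas, whose Christoffel symbols are out
  of reach. They are avoided by testing the geodesic equation against tangent vectors: it then says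
  that the first variation of the energy in natural coordinates of TM vanishes, and a dimension
  count tells which test vectors are admissible. The fields whose covariant derivative is given by
  the parallel skew operator form a real vector space, stable under covariant differentiation and
  made of fields of constant norm. The Frenet recursion stays in it because it divides by constants
  only.\<close>

abbreviation dd :: "('x::real_normed_vector \<Rightarrow> 'y::real_normed_vector) \<Rightarrow> 'x \<Rightarrow> 'x \<Rightarrow> 'y" where
  "dd f x v \<equiv> frechet_derivative f (at x) v"

lemma dd_eqI: "(f has_derivative f') (at x) \<Longrightarrow> dd f x v = f' v"
  using frechet_derivative_at by metis

lemma differentiable_cong_open:
  assumes "open S" "x \<in> S" "\<And>y. y \<in> S \<Longrightarrow> f y = g y"
  shows "f differentiable (at x) \<longleftrightarrow> g differentiable (at x)"
  using has_derivative_transform_within_open[of f _ x UNIV S g]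
    has_derivative_transform_within_open[of g _ x UNIV S f] assms
  unfolding differentiable_def by auto

lemma dd_cong_open:
  assumes "open S" "x \<in> S" "\<And>y. y \<in> S \<Longrightarrow> f y = g y"
  shows "frechet_derivative f (at x) = frechet_derivative g (at x)"
proof -
  have "(f has_derivative D) (at x) \<longleftrightarrow> (g has_derivative D) (at x)" for D
    using has_derivative_transform_within_open[of f D x UNIV S g]
      has_derivative_transform_within_open[of g D x UNIV S f] assms by auto
  then show ?thesis by (simp add: frechet_derivative_def)
qed

lemma Ck_on_cong:
  assumes "open S" "\<And>x. x \<in> S \<Longrightarrow> f x = g x"
  shows "Ck_on k S f \<longleftrightarrow> Ck_on k S g"
  using assms(2)
proof (induction k arbitrary: f g)
  case 0
  then show ?case by (auto intro: continuous_on_cong)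
next
  case (Suc k)
  have 1: "\<forall>x\<in>S. f differentiable (at x) \<longleftrightarrow> g differentiable (at x)"
    using differentiable_cong_open[OF assms(1)] Suc.prems by blast
  have 2: "Ck_on k S (\<lambda>x. dd f x v) \<longleftrightarrow> Ck_on k S (\<lambda>x. dd g x v)" for v
    by (rule Suc.IH) (use dd_cong_open[OF assms(1)] Suc.prems in metis)
  show ?case using 1 2 by simp
qed

lemma Ck_on_subset: "Ck_on k S f \<Longrightarrow> T \<subseteq> S \<Longrightarrow> Ck_on k T f"
  by (induction k arbitrary: f) (auto intro: continuous_on_subset)

text \<open>Derivatives at a point depend on a neighbourhood only. This later glues the smoothness
  of the geodesic, which is known chart by chart.\<close>

lemma Ck_on_local:
  assumes "\<And>x. x \<in> S \<Longrightarrow> \<exists>N. open N \<and> x \<in> N \<and> Ck_on k N f"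
  shows "Ck_on k S f"
  using assms
proof (induction k arbitrary: f)
  case 0
  then show ?case
    by simp (metis continuous_at_imp_continuous_on continuous_on_eq_continuous_at)
next
  case (Suc k)
  have "f differentiable (at x)" if "x \<in> S" for x
    using Suc.prems[OF that] by auto
  moreover have "Ck_on k S (\<lambda>x. dd f x v)" for v
    by (rule Suc.IH) (use Suc.prems in \<open>force\<close>)
  ultimately show ?case by simp
qed

lemma Ck_on_SucD: "Ck_on (Suc k) S f \<Longrightarrow> Ck_on k S f"
proof (induction k arbitrary: f)
  case 0
  then show ?case
    by (auto intro!: continuous_at_imp_continuous_on differentiable_imp_continuous_within)
next
  case (Suc k)
  then show ?case by (metis Ck_on.simps(2))
qed

lemma Ck_on_const [simp]: "Ck_on k S (\<lambda>x. c)"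
  by (induction k arbitrary: c) auto

lemma Ck_on_bounded_linear:
  assumes "open S" "bounded_linear L" "Ck_on k S f"
  shows "Ck_on k S (\<lambda>x. L (f x))"
  using assms(3)
proof (induction k arbitrary: f)
  case 0
  then show ?case using bounded_linear.continuous_on[OF assms(2)] by auto
next
  case (Suc k)
  have d: "((\<lambda>x. L (f x)) has_derivative (\<lambda>v. L (dd f x v))) (at x)" if "x \<in> S" for x
    using Suc.prems that
    by (intro bounded_linear.has_derivative[OF assms(2)]) (auto simp flip: frechet_derivative_works)
  have "Ck_on k S (\<lambda>x. dd (\<lambda>x. L (f x)) x v)" for v
    using Ck_on_cong[OF assms(1), of "\<lambda>x. dd (\<lambda>x. L (f x)) x v" "\<lambda>x. L (dd f x v)"]
      dd_eqI[OF d] Suc by auto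
  then show ?case using d by (auto simp: differentiable_def)
qed

lemma Ck_on_add:
  assumes "open S" "Ck_on k S f" "Ck_on k S g"
  shows "Ck_on k S (\<lambda>x. f x + g x)"
  using assms(2,3)
proof (induction k arbitrary: f g)
  case 0
  then show ?case by (auto intro: continuous_intros)
next
  case (Suc k)
  have d: "((\<lambda>x. f x + g x) has_derivative (\<lambda>v. dd f x v + dd g x v)) (at x)" if "x \<in> S" for x
    using Suc.prems that frechet_derivative_works by (auto intro!: derivative_eq_intros)
  have "Ck_on k S (\<lambda>x. dd (\<lambda>x. f x + g x) x v)" for v
    using Ck_on_cong[OF assms(1), of "\<lambda>x. dd (\<lambda>x. f x + g x) x v" "\<lambda>x. dd f x v + dd g x v"]
      dd_eqI[OF d] Suc by auto
  then show ?case using d by (auto simp: differentiable_def)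
qed

lemma Ck_on_sum:
  assumes "open S" "\<And>i. i \<in> T \<Longrightarrow> Ck_on k S (f i)"
  shows "Ck_on k S (\<lambda>x. \<Sum>i\<in>T. f i x)"
  using assms(2)
  by (induction T rule: infinite_finite_induct) (auto intro!: Ck_on_add assms(1))

lemma Ck_on_bounded_bilinear:
  assumes "open S" "bounded_bilinear B" "Ck_on k S f" "Ck_on k S g"
  shows "Ck_on k S (\<lambda>x. B (f x) (g x))"
  using assms(3,4)
proof (induction k arbitrary: f g)
  case 0
  then show ?case using bounded_bilinear.continuous_on[OF assms(2)] by auto
next
  case (Suc k)
  have d: "((\<lambda>x. B (f x) (g x)) has_derivative (\<lambda>v. B (f x) (dd g x v) + B (dd f x v) (g x))) (at x)"
    if "x \<in> S" for x
    using Suc.prems that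
    by (intro bounded_bilinear.FDERIV[OF assms(2)]) (auto simp flip: frechet_derivative_works)
  have fg: "Ck_on k S f" "Ck_on k S g" using Suc.prems Ck_on_SucD by blast+
  have "Ck_on k S (\<lambda>x. B (f x) (dd g x v) + B (dd f x v) (g x))" for v
    using Suc.prems fg by (intro Ck_on_add assms(1) Suc.IH) auto
  then have "Ck_on k S (\<lambda>x. dd (\<lambda>x. B (f x) (g x)) x v)" for v
    using Ck_on_cong[OF assms(1), of "\<lambda>x. dd (\<lambda>x. B (f x) (g x)) x v"
        "\<lambda>x. B (f x) (dd g x v) + B (dd f x v) (g x)"]
      dd_eqI[OF d] by simp
  then show ?case using d by (auto simp: differentiable_def)
qed

lemma linear_basis_sum:
  fixes L :: "'e::euclidean_space \<Rightarrow> 'b::real_vector"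
  assumes "linear L"
  shows "L a = (\<Sum>i\<in>Basis. (a \<bullet> i) *\<^sub>R L i)"
  using linear_sum[OF assms, of "\<lambda>i. (a \<bullet> i) *\<^sub>R i" Basis]
  by (simp add: euclidean_representation linear_scale[OF assms])

text \<open>\<open>Ck_on\<close> speaks of derivatives in fixed directions, but the chain rule
  differentiates \<open>g\<close> in the moving direction \<open>dd f x v\<close>. A basis of the
  intermediate space, which is therefore Euclidean, reduces this to fixed directions with varying
  coefficients.\<close>

lemma Ck_on_compose:
  fixes f :: "'x::real_normed_vector \<Rightarrow> 'e::euclidean_space"
  assumes "open S" "open T" "f ` S \<subseteq> T" "Ck_on k S f" "Ck_on k T g"
  shows "Ck_on k S (\<lambda>x. g (f x))"
  using assms(4,5)
proof (induction k arbitrary: g)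
  case 0
  then show ?case
    using continuous_on_compose2[of T g S f] assms(3) by simp
next
  case (Suc k)
  have d: "((\<lambda>x. g (f x)) has_derivative (\<lambda>v. dd g (f x) (dd f x v))) (at x)" if "x \<in> S" for x
    using Suc.prems that assms(3)
    by (intro has_derivative_compose[where g=g and f=f]) (auto simp flip: frechet_derivative_works)
  have l: "linear (frechet_derivative g (at (f x)))" if "x \<in> S" for x
    using Suc.prems that assms(3) by (intro linear_frechet_derivative) auto
  have f: "Ck_on k S f" using Suc.prems Ck_on_SucD by blast
  have "Ck_on k S (\<lambda>x. dd (\<lambda>x. g (f x)) x v)" for v
  proof -
    have "Ck_on k S (\<lambda>x. dd (\<lambda>x. g (f x)) x v) \<longleftrightarrow>
      Ck_on k S (\<lambda>x. \<Sum>i\<in>Basis. (dd f x v \<bullet> i) *\<^sub>R dd g (f x) i)"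
      by (rule Ck_on_cong[OF assms(1)]) (simp add: dd_eqI[OF d] flip: linear_basis_sum[OF l])
    moreover have "Ck_on k S (\<lambda>x. \<Sum>i\<in>Basis. (dd f x v \<bullet> i) *\<^sub>R dd g (f x) i)"
      using Suc.prems f
      by (intro Ck_on_sum Ck_on_bounded_bilinear[where B=scaleR] assms(1) bounded_bilinear_scaleR Suc.IH
          Ck_on_bounded_linear[OF assms(1) bounded_linear_inner_left]) auto
    ultimately show ?thesis by blast
  qed
  then show ?case using d by (auto simp: differentiable_def)
qed

lemma smooth_on_imp_differentiable: "smooth_on S f \<Longrightarrow> x \<in> S \<Longrightarrow> f differentiable (at x)"
  unfolding smooth_on_def by (metis Ck_on.simps(2))

lemma smooth_on_has_derivative:
  "smooth_on S f \<Longrightarrow> x \<in> S \<Longrightarrow> (f has_derivative frechet_derivative f (at x)) (at x)"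
  using frechet_derivative_works smooth_on_imp_differentiable by blast

lemma smooth_on_continuous: "smooth_on S f \<Longrightarrow> continuous_on S f"
  unfolding smooth_on_def by (metis Ck_on.simps(1))

lemma smooth_on_dd: "smooth_on S f \<Longrightarrow> smooth_on S (\<lambda>x. dd f x v)"
  unfolding smooth_on_def by (metis Ck_on.simps(2))

lemma smooth_on_cong:
  "open S \<Longrightarrow> (\<And>x. x \<in> S \<Longrightarrow> f x = g x) \<Longrightarrow> smooth_on S f \<longleftrightarrow> smooth_on S g"
  unfolding smooth_on_def by (intro all_cong1 Ck_on_cong)

lemma smooth_on_subset: "smooth_on S f \<Longrightarrow> T \<subseteq> S \<Longrightarrow> smooth_on T f"
  unfolding smooth_on_def using Ck_on_subset by blast

lemma smooth_on_local:
  assumes "\<And>x. x \<in> S \<Longrightarrow> \<exists>N. open N \<and> x \<in> N \<and> smooth_on N f"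
  shows "smooth_on S f"
  unfolding smooth_on_def
proof (intro allI Ck_on_local)
  fix k x assume "x \<in> S"
  then show "\<exists>N. open N \<and> x \<in> N \<and> Ck_on k N f"
    using assms unfolding smooth_on_def by meson
qed

lemma smooth_on_const [simp]: "smooth_on S (\<lambda>x. c)"
  by (simp add: smooth_on_def)

lemma smooth_on_bounded_linear:
  "open S \<Longrightarrow> bounded_linear L \<Longrightarrow> smooth_on S f \<Longrightarrow> smooth_on S (\<lambda>x. L (f x))"
  unfolding smooth_on_def using Ck_on_bounded_linear by blast

lemma smooth_on_add:
  "open S \<Longrightarrow> smooth_on S f \<Longrightarrow> smooth_on S g \<Longrightarrow> smooth_on S (\<lambda>x. f x + g x)"
  unfolding smooth_on_def using Ck_on_add by blast

lemma smooth_on_sum: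
  "open S \<Longrightarrow> (\<And>i. i \<in> T \<Longrightarrow> smooth_on S (f i)) \<Longrightarrow> smooth_on S (\<lambda>x. \<Sum>i\<in>T. f i x)"
  by (simp add: smooth_on_def Ck_on_sum)

lemma smooth_on_scaleR:
  "open S \<Longrightarrow> smooth_on S f \<Longrightarrow> smooth_on S g \<Longrightarrow> smooth_on S (\<lambda>x. f x *\<^sub>R g x)"
  unfolding smooth_on_def using Ck_on_bounded_bilinear bounded_bilinear_scaleR by blast

lemma smooth_on_minus: "open S \<Longrightarrow> smooth_on S f \<Longrightarrow> smooth_on S (\<lambda>x. - f x)"
  by (rule smooth_on_bounded_linear[OF _ bounded_linear_minus[OF bounded_linear_ident]])

lemma smooth_on_diff:
  "open S \<Longrightarrow> smooth_on S f \<Longrightarrow> smooth_on S g \<Longrightarrow> smooth_on S (\<lambda>x. f x - g x)"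
  using smooth_on_add[of S f "\<lambda>x. - g x"] smooth_on_minus[of S g] by simp

lemma smooth_on_ident: "open S \<Longrightarrow> smooth_on S (\<lambda>x. x)"
proof -
  have "Ck_on k S (\<lambda>x. x)" for k by (cases k) auto
  then show ?thesis by (simp add: smooth_on_def)
qed

lemma smooth_on_compose:
  fixes f :: "'x::real_normed_vector \<Rightarrow> 'e::euclidean_space"
  shows "open S \<Longrightarrow> open T \<Longrightarrow> f ` S \<subseteq> T \<Longrightarrow> smooth_on S f \<Longrightarrow> smooth_on T g \<Longrightarrow>
    smooth_on S (\<lambda>x. g (f x))"
  unfolding smooth_on_def using Ck_on_compose by blast

lemma dd_linear: "smooth_on S f \<Longrightarrow> x \<in> S \<Longrightarrow> linear (frechet_derivative f (at x))"
  by (simp add: linear_frechet_derivative smooth_on_imp_differentiable)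


subsection \<open>Symmetry of second derivatives\<close>

lemma has_real_derivative_along:
  assumes "f differentiable (at (x + t *\<^sub>R v))"
  shows "((\<lambda>t. f (x + t *\<^sub>R v)) has_vector_derivative dd f (x + t *\<^sub>R v) v) (at t)"
proof -
  have "((\<lambda>t. f (x + t *\<^sub>R v)) has_derivative (\<lambda>h. dd f (x + t *\<^sub>R v) (h *\<^sub>R v))) (at t)"
    by (rule has_derivative_compose[where g=f and f="\<lambda>t. x + t *\<^sub>R v"])
      (use assms frechet_derivative_works in \<open>auto intro!: derivative_eq_intros\<close>)
  then show ?thesis
    using linear_frechet_derivative[OF assms]
    by (simp add: has_vector_derivative_def linear_scale)
qed

text \<open>Two applications of the mean value theorem: along \<open>a\<close> to the difference of
  \<open>f\<close> on two parallel segments, then along \<open>b\<close> to \<open>dd f y a\<close>.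
  The second difference is symmetric in \<open>a\<close> and \<open>b\<close>, so the same lemma
  also expresses it by the other mixed derivative.\<close>

lemma second_difference:
  fixes f :: "'x::real_normed_vector \<Rightarrow> real"
  assumes "h > 0"
    and "\<And>s t. 0 \<le> s \<Longrightarrow> s \<le> h \<Longrightarrow> 0 \<le> t \<Longrightarrow> t \<le> h \<Longrightarrow> x + s *\<^sub>R a + t *\<^sub>R b \<in> S"
    and "smooth_on S f"
  obtains s t where "0 \<le> s" "s \<le> h" "0 \<le> t" "t \<le> h"
    "f (x + h *\<^sub>R a + h *\<^sub>R b) - f (x + h *\<^sub>R a) - f (x + h *\<^sub>R b) + f x
      = h * h * dd (\<lambda>y. dd f y a) (x + s *\<^sub>R a + t *\<^sub>R b) b"
proof -
  have D: "f differentiable (at y)" if "y \<in> S" for y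
    using assms(3) that smooth_on_imp_differentiable by blast
  have D2: "(\<lambda>y. dd f y a) differentiable (at y)" if "y \<in> S" for y
    using smooth_on_dd[OF assms(3)] that smooth_on_imp_differentiable by blast
  define \<phi> where "\<phi> = (\<lambda>s. f ((x + h *\<^sub>R b) + s *\<^sub>R a) - f (x + s *\<^sub>R a))"
  have \<phi>: "(\<phi> has_real_derivative (dd f ((x + h *\<^sub>R b) + s *\<^sub>R a) a - dd f (x + s *\<^sub>R a) a)) (at s)"
    if "0 \<le> s" "s \<le> h" for s
    unfolding \<phi>_def has_real_derivative_iff_has_vector_derivative
    using assms(1) assms(2)[of s h] assms(2)[of s 0] that
    by (intro has_vector_derivative_diff has_real_derivative_along D) (auto simp: algebra_simps)
  obtain s where s: "0 < s" "s < h"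
    "\<phi> h - \<phi> 0 = (h - 0) * (dd f ((x + h *\<^sub>R b) + s *\<^sub>R a) a - dd f (x + s *\<^sub>R a) a)"
    using MVT2[OF assms(1) \<phi>] by auto
  have \<psi>: "((\<lambda>t. dd f (x + s *\<^sub>R a + t *\<^sub>R b) a) has_real_derivative
      dd (\<lambda>y. dd f y a) (x + s *\<^sub>R a + t *\<^sub>R b) b) (at t)"
    if "0 \<le> t" "t \<le> h" for t
    unfolding has_real_derivative_iff_has_vector_derivative
    using has_real_derivative_along[OF D2] s that assms(2) by simp
  obtain t where t: "0 < t" "t < h"
    "dd f (x + s *\<^sub>R a + h *\<^sub>R b) a - dd f (x + s *\<^sub>R a + 0 *\<^sub>R b) a =
     (h - 0) * dd (\<lambda>y. dd f y a) (x + s *\<^sub>R a + t *\<^sub>R b) b"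
    using MVT2[OF assms(1) \<psi>] by auto
  have "\<phi> h - \<phi> 0 = h * h * dd (\<lambda>y. dd f y a) (x + s *\<^sub>R a + t *\<^sub>R b) b"
    using s(3) t(3) by (simp add: algebra_simps)
  then show thesis using that[of s t] s t by (auto simp: \<phi>_def algebra_simps)
qed

text \<open>The second difference over a small parallelogram is \<open>h * h\<close> times either
  mixed derivative at some nearby point. If these derivatives differed at \<open>x\<close>,
  continuity would keep them apart near \<open>x\<close>.\<close>

lemma dd_commute_real:
  fixes f :: "'x::real_normed_vector \<Rightarrow> real"
  assumes "open S" "x \<in> S" "smooth_on S f"
  shows "dd (\<lambda>y. dd f y a) x b = dd (\<lambda>y. dd f y b) x a"
proof (rule ccontr)
  define P where "P = (\<lambda>y. dd (\<lambda>y. dd f y a) y b)"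
  define Q where "Q = (\<lambda>y. dd (\<lambda>y. dd f y b) y a)"
  assume "\<not> ?thesis"
  then have ne: "P x \<noteq> Q x" by (simp add: P_def Q_def)
  have "continuous_on S P" "continuous_on S Q"
    unfolding P_def Q_def by (intro smooth_on_continuous smooth_on_dd assms(3))+
  then have cont: "isCont P x" "isCont Q x"
    using assms by (auto simp: continuous_on_eq_continuous_at)
  let ?e = "\<bar>P x - Q x\<bar> / 2"
  have e: "?e > 0" using ne by simp
  obtain d1 where d1: "d1 > 0" "\<And>y. dist y x < d1 \<Longrightarrow> dist (P y) (P x) < ?e"
    using cont(1) e unfolding continuous_at_eps_delta by blast
  obtain d2 where d2: "d2 > 0" "\<And>y. dist y x < d2 \<Longrightarrow> dist (Q y) (Q x) < ?e"
    using cont(2) e unfolding continuous_at_eps_delta by blast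
  obtain d3 where d3: "d3 > 0" "\<And>y. dist y x < d3 \<Longrightarrow> y \<in> S"
    using assms(1,2) by (metis open_dist)
  define d where "d = min d1 (min d2 d3)"
  \<comment> \<open>Chosen so that the whole parallelogram lies in the ball of radius
    \<open>d\<close>; the summand 1 covers the case \<open>a = b = 0\<close>.\<close>
  define h where "h = d / (2 * (norm a + norm b + 1))"
  have d: "d > 0" using d1 d2 d3 by (simp add: d_def)
  have h: "h > 0" using d by (simp add: h_def add_nonneg_pos)
  have hd: "h * (norm a + norm b) < d"
  proof -
    have "h * (norm a + norm b) \<le> h * (norm a + norm b + 1)" using h by simp
    also have "\<dots> = d / 2"
    proof -
      define c where "c = norm a + norm b + 1"
      have "c > 0" by (simp add: c_def add_nonneg_pos)
      then show ?thesis by (simp add: h_def flip: c_def)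
    qed
    finally show ?thesis using d by simp
  qed
  have near: "dist (x + s *\<^sub>R a + t *\<^sub>R b) x < d" if "0 \<le> s" "s \<le> h" "0 \<le> t" "t \<le> h" for s t
  proof -
    have "dist (x + s *\<^sub>R a + t *\<^sub>R b) x \<le> s * norm a + t * norm b"
      using that norm_triangle_ineq[of "s *\<^sub>R a" "t *\<^sub>R b"] by (simp add: dist_norm add.assoc)
    also have "\<dots> \<le> h * norm a + h * norm b"
      using that by (intro add_mono mult_right_mono) auto
    finally show ?thesis using hd by (simp add: distrib_left)
  qed
  have nearS: "x + s *\<^sub>R a + t *\<^sub>R b \<in> S" if "0 \<le> s" "s \<le> h" "0 \<le> t" "t \<le> h" for s t
    using near[OF that] d3 by (simp add: d_def)
  then have nearS': "x + s *\<^sub>R b + t *\<^sub>R a \<in> S" if "0 \<le> s" "s \<le> h" "0 \<le> t" "t \<le> h" for s t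
    using that by (metis add.assoc add.commute)
  obtain s t where st: "0 \<le> s" "s \<le> h" "0 \<le> t" "t \<le> h"
    "f (x + h *\<^sub>R a + h *\<^sub>R b) - f (x + h *\<^sub>R a) - f (x + h *\<^sub>R b) + f x
      = h * h * P (x + s *\<^sub>R a + t *\<^sub>R b)"
    unfolding P_def by (rule second_difference[OF h nearS assms(3)])
  obtain s' t' where st': "0 \<le> s'" "s' \<le> h" "0 \<le> t'" "t' \<le> h"
    "f (x + h *\<^sub>R b + h *\<^sub>R a) - f (x + h *\<^sub>R b) - f (x + h *\<^sub>R a) + f x
      = h * h * Q (x + s' *\<^sub>R b + t' *\<^sub>R a)"
    unfolding Q_def by (rule second_difference[OF h nearS' assms(3)])
  have "h * h * P (x + s *\<^sub>R a + t *\<^sub>R b) = h * h * Q (x + s' *\<^sub>R b + t' *\<^sub>R a)"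
    using st(5) st'(5) by (simp add: algebra_simps)
  then have eq: "P (x + s *\<^sub>R a + t *\<^sub>R b) = Q (x + s' *\<^sub>R b + t' *\<^sub>R a)" using h by simp
  have 1: "dist (P (x + s *\<^sub>R a + t *\<^sub>R b)) (P x) < ?e"
    using d1 near[OF st(1-4)] by (simp add: d_def)
  have "dist (x + s' *\<^sub>R b + t' *\<^sub>R a) x < d"
    using near[OF st'(3,4,1,2)] by (simp add: algebra_simps)
  then have 2: "dist (Q (x + s' *\<^sub>R b + t' *\<^sub>R a)) (Q x) < ?e"
    using d2 by (simp add: d_def)
  have "\<bar>P x - Q x\<bar> \<le> dist z (P x) + dist z (Q x)" for z
    unfolding dist_real_def by linarith
  then show False using 1 2 eq by (smt (verit) field_sum_of_halves)
qed

lemma dd_commute: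
  fixes f :: "'x::real_normed_vector \<Rightarrow> 'y::euclidean_space"
  assumes "open S" "x \<in> S" "smooth_on S f"
  shows "dd (\<lambda>y. dd f y a) x b = dd (\<lambda>y. dd f y b) x a"
proof (rule euclidean_eqI)
  fix i :: 'y assume "i \<in> Basis"
  have bl: "bounded_linear (\<lambda>w. w \<bullet> i)" by (rule bounded_linear_inner_left)
  have 1: "dd (\<lambda>y. f y \<bullet> i) y v = dd f y v \<bullet> i" if "y \<in> S" for y v
    using bounded_linear.has_derivative[OF bl smooth_on_has_derivative[OF assms(3) that]] dd_eqI by metis
  have 2: "dd (\<lambda>y. dd (\<lambda>y. f y \<bullet> i) y v) x w = dd (\<lambda>y. dd f y v) x w \<bullet> i" for v w
  proof -
    have "dd (\<lambda>y. dd (\<lambda>y. f y \<bullet> i) y v) x w = dd (\<lambda>y. dd f y v \<bullet> i) x w"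
      by (rule fun_cong[OF dd_cong_open[OF assms(1,2)]]) (rule 1)
    also have "\<dots> = dd (\<lambda>y. dd f y v) x w \<bullet> i"
      using bounded_linear.has_derivative[OF bl smooth_on_has_derivative[OF smooth_on_dd[OF assms(3)] assms(2)]]
        dd_eqI by metis
    finally show ?thesis .
  qed
  show "dd (\<lambda>y. dd f y a) x b \<bullet> i = dd (\<lambda>y. dd f y b) x a \<bullet> i"
    using dd_commute_real[OF assms(1,2) smooth_on_bounded_linear[OF assms(1) bl assms(3)], of a b]
    by (simp add: 2)
qed


subsection \<open>Smooth families of multilinear maps\<close>

text \<open>Tensor fields in coordinates. Smoothness is asked for constant arguments; by expansion
  in a basis it extends to smooth arguments, see \<open>fam1_smooth\<close>.\<close>

definition fam1 :: "'x::real_normed_vector set \<Rightarrow> ('x \<Rightarrow> 'e::euclidean_space \<Rightarrow> 'b::real_normed_vector) \<Rightarrow> bool" where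
  "fam1 U F \<longleftrightarrow> (\<forall>x\<in>U. linear (F x)) \<and> (\<forall>a. smooth_on U (\<lambda>x. F x a))"

definition fam2 :: "'x::real_normed_vector set \<Rightarrow>
    ('x \<Rightarrow> 'e::euclidean_space \<Rightarrow> 'f::euclidean_space \<Rightarrow> 'b::real_normed_vector) \<Rightarrow> bool" where
  "fam2 U F \<longleftrightarrow> (\<forall>x\<in>U. bilinear (F x)) \<and> (\<forall>a b. smooth_on U (\<lambda>x. F x a b))"

lemma bilinear_iff: "bilinear B \<longleftrightarrow> (\<forall>a. linear (B a)) \<and> (\<forall>b. linear (\<lambda>a. B a b))"
  by (simp add: bilinear_def)

lemma bilinear_rules:
  assumes "bilinear B"
  shows "B (a + b) c = B a c + B b c" "B c (a + b) = B c a + B c b"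
    "B (a - b) c = B a c - B b c" "B c (a - b) = B c a - B c b"
    "B (- a) c = - B a c" "B c (- a) = - B c a"
    "B (r *\<^sub>R a) c = r *\<^sub>R B a c" "B c (r *\<^sub>R a) = r *\<^sub>R B c a"
    "B 0 c = 0" "B c 0 = 0"
  using bilinear_ladd[OF assms] bilinear_radd[OF assms] bilinear_lsub[OF assms] bilinear_rsub[OF assms]
    bilinear_lneg[OF assms] bilinear_rneg[OF assms] bilinear_lmul[OF assms] bilinear_rmul[OF assms]
    bilinear_lzero[OF assms] bilinear_rzero[OF assms] by auto

lemma fam2_left: "fam2 U F \<Longrightarrow> fam1 U (\<lambda>x a. F x a b)"
  by (simp add: fam1_def fam2_def bilinear_iff)

lemma fam2_right: "fam2 U F \<Longrightarrow> fam1 U (\<lambda>x. F x a)"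
  by (simp add: fam1_def fam2_def bilinear_iff)

lemma fam1_smooth:
  assumes "open U" "fam1 U F" "smooth_on U A"
  shows "smooth_on U (\<lambda>x. F x (A x))"
proof -
  have "smooth_on U (\<lambda>x. \<Sum>i\<in>Basis. (A x \<bullet> i) *\<^sub>R F x i)"
    using assms by (intro smooth_on_sum smooth_on_scaleR
        smooth_on_bounded_linear[OF _ bounded_linear_inner_left]) (auto simp: fam1_def)
  moreover have "(\<Sum>i\<in>Basis. (A x \<bullet> i) *\<^sub>R F x i) = F x (A x)" if "x \<in> U" for x
    using linear_basis_sum[of "F x" "A x"] assms(2) that unfolding fam1_def by simp
  ultimately show ?thesis
    by (rule smooth_on_cong[OF assms(1), THEN iffD1, rotated])
qed

lemma fam2_smooth:
  assumes "open U" "fam2 U F" "smooth_on U A" "smooth_on U B"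
  shows "smooth_on U (\<lambda>x. F x (A x) (B x))"
proof -
  have "fam1 U (\<lambda>x a. F x a (B x))"
    using fam1_smooth[OF assms(1) fam2_right[OF assms(2)] assms(4)] assms(2)
    by (auto simp: fam1_def fam2_def bilinear_iff)
  then show ?thesis by (rule fam1_smooth[OF assms(1) _ assms(3)])
qed

lemma fam2_compose:
  fixes \<Phi> :: "'x::real_normed_vector \<Rightarrow> 'z::euclidean_space"
  assumes "fam2 U F" "open S" "open U" "\<Phi> ` S \<subseteq> U" "smooth_on S \<Phi>"
  shows "fam2 S (\<lambda>y. F (\<Phi> y))"
  using assms(1,4) smooth_on_compose[OF assms(2,3,4,5), of "\<lambda>y. F y _ _"]
  by (auto simp: fam2_def)

lemma linear_dd_family:
  assumes "open U" "fam1 U F" "x \<in> U"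
  shows "linear (\<lambda>a. dd (\<lambda>y. F y a) x v)"
proof (rule linearI)
  have D: "((\<lambda>y. F y a) has_derivative (\<lambda>v. dd (\<lambda>y. F y a) x v)) (at x)" for a
    using assms(2,3) smooth_on_has_derivative unfolding fam1_def by blast
  show "dd (\<lambda>y. F y (a + b)) x v = dd (\<lambda>y. F y a) x v + dd (\<lambda>y. F y b) x v" for a b
  proof -
    have "dd (\<lambda>y. F y (a + b)) x v = dd (\<lambda>y. F y a + F y b) x v"
      using dd_cong_open[OF assms(1,3), of "\<lambda>y. F y (a + b)" "\<lambda>y. F y a + F y b"] assms(2)
      by (auto simp: fam1_def linear_add)
    also have "\<dots> = dd (\<lambda>y. F y a) x v + dd (\<lambda>y. F y b) x v"
      using has_derivative_add[OF D D] dd_eqI by fast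
    finally show ?thesis .
  qed
  show "dd (\<lambda>y. F y (r *\<^sub>R a)) x v = r *\<^sub>R dd (\<lambda>y. F y a) x v" for a r
  proof -
    have "dd (\<lambda>y. F y (r *\<^sub>R a)) x v = dd (\<lambda>y. r *\<^sub>R F y a) x v"
      using dd_cong_open[OF assms(1,3), of "\<lambda>y. F y (r *\<^sub>R a)" "\<lambda>y. r *\<^sub>R F y a"] assms(2)
      by (auto simp: fam1_def linear_scale)
    also have "\<dots> = r *\<^sub>R dd (\<lambda>y. F y a) x v"
      using has_derivative_scaleR_right[OF D] dd_eqI by fast
    finally show ?thesis .
  qed
qed

lemma fam2_dd: "open U \<Longrightarrow> fam2 U F \<Longrightarrow> fam2 U (\<lambda>x a b. dd (\<lambda>y. F y a b) x v)"
  using linear_dd_family[OF _ fam2_left[of U F]] linear_dd_family[OF _ fam2_right[of U F]]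
  by (auto simp: fam2_def bilinear_iff intro: smooth_on_dd)

lemma has_vector_derivative_cong_nhds:
  assumes "\<forall>\<^sub>F s in nhds t. f s = g s" "(f has_vector_derivative D) (at t)"
  shows "(g has_vector_derivative D) (at t)"
  using has_vector_derivative_cong_ev[of UNIV f g t D] assms eventually_nhds_x_imp_x[OF assms(1)]
  by simp

text \<open>The product rule for a moving argument when \<open>F\<close> can be differentiated for
  constant arguments. Nesting it handles bilinear and trilinear families.\<close>

lemma linear_family_vector_derivative:
  fixes F :: "real \<Rightarrow> 'e::euclidean_space \<Rightarrow> 'b::real_normed_vector"
  assumes lin: "\<forall>\<^sub>F s in nhds t. linear (F s)"
    and F': "\<And>a. ((\<lambda>s. F s a) has_vector_derivative F' a) (at t)"
    and A': "(A has_vector_derivative A') (at t)"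
  shows "((\<lambda>s. F s (A s)) has_vector_derivative F' (A t) + F t A') (at t)"
proof -
  have lt: "linear (F t)" using lin eventually_nhds_x_imp_x by fast
  have ev: "\<forall>\<^sub>F s in nhds t. (\<Sum>i\<in>Basis. (a s \<bullet> i) *\<^sub>R F s i) = F s (a s)" for a
    using lin by eventually_elim (metis linear_basis_sum)
  have D: "((\<lambda>s. \<Sum>i\<in>Basis. (a s \<bullet> i) *\<^sub>R F s i) has_vector_derivative
      (\<Sum>i\<in>Basis. (a t \<bullet> i) *\<^sub>R F' i + (a' \<bullet> i) *\<^sub>R F t i)) (at t)"
    if "(a has_vector_derivative a') (at t)" for a a'
  proof -
    have i: "((\<lambda>s. a s \<bullet> i) has_real_derivative (a' \<bullet> i)) (at t)" for i
      using bounded_linear.has_vector_derivative[OF bounded_linear_inner_left that, of i]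
      by (simp add: has_real_derivative_iff_has_vector_derivative)
    show ?thesis by (intro has_vector_derivative_sum has_vector_derivative_scaleR i F')
  qed
  have "((\<lambda>s. F s a) has_vector_derivative (\<Sum>i\<in>Basis. (a \<bullet> i) *\<^sub>R F' i)) (at t)" for a
    using has_vector_derivative_cong_nhds[OF ev[of "\<lambda>_. a"] D[of "\<lambda>_. a" 0]] by simp
  \<comment> \<open>\<open>F'\<close> inherits linearity from \<open>F\<close> through uniqueness of
    derivatives.\<close>
  then have l: "F' a = (\<Sum>i\<in>Basis. (a \<bullet> i) *\<^sub>R F' i)" for a
    using F' vector_derivative_unique_at by blast
  have "((\<lambda>s. F s (A s)) has_vector_derivative (\<Sum>i\<in>Basis. (A t \<bullet> i) *\<^sub>R F' i + (A' \<bullet> i) *\<^sub>R F t i)) (at t)"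
    by (rule has_vector_derivative_cong_nhds[OF ev[of A] D[OF A']])
  then show ?thesis
    using l[of "A t"] linear_basis_sum[OF lt, of A'] by (simp add: sum.distrib)
qed

lemma eventually_in_open:
  assumes "open U" "X t \<in> U" "(X has_vector_derivative X') (at t)"
  shows "\<forall>\<^sub>F s in nhds t. X s \<in> U"
proof -
  have "isCont X t" using assms(3) has_vector_derivative_continuous by blast
  then obtain N where "open N" "t \<in> N" "\<forall>s\<in>N. X s \<in> U"
    using assms(1,2) unfolding continuous_at_open by blast
  then show ?thesis unfolding eventually_nhds by blast
qed

lemma dd_vector_derivative:
  assumes "f differentiable (at (X t))" "(X has_vector_derivative X') (at t)"
  shows "((\<lambda>s. f (X s)) has_vector_derivative dd f (X t) X') (at t)"
proof -
  have "((\<lambda>s. f (X s)) has_derivative (\<lambda>h. dd f (X t) (h *\<^sub>R X'))) (at t)"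
    by (rule has_derivative_compose[OF assms(2)[unfolded has_vector_derivative_def]
        assms(1)[unfolded frechet_derivative_works]])
  then show ?thesis
    using linear_frechet_derivative[OF assms(1)] by (simp add: has_vector_derivative_def linear_scale)
qed

lemma fam1_vector_derivative:
  assumes "open U" "fam1 U F" "X t \<in> U"
    and X: "(X has_vector_derivative X') (at t)"
    and A: "(A has_vector_derivative A') (at t)"
  shows "((\<lambda>s. F (X s) (A s)) has_vector_derivative
    dd (\<lambda>y. F y (A t)) (X t) X' + F (X t) A') (at t)"
proof (rule linear_family_vector_derivative[OF _ _ A])
  show "\<forall>\<^sub>F s in nhds t. linear (F (X s))"
    using eventually_in_open[OF assms(1,3) X] by eventually_elim (use assms(2) fam1_def in blast)
  show "((\<lambda>s. F (X s) a) has_vector_derivative dd (\<lambda>y. F y a) (X t) X') (at t)" for a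
    using dd_vector_derivative[OF _ X, of "\<lambda>y. F y a"] assms(2,3) smooth_on_imp_differentiable
    unfolding fam1_def by blast
qed

lemma fam2_vector_derivative:
  assumes "open U" "fam2 U F" "X t \<in> U"
    and X: "(X has_vector_derivative X') (at t)"
    and A: "(A has_vector_derivative A') (at t)"
    and B: "(B has_vector_derivative B') (at t)"
  shows "((\<lambda>s. F (X s) (A s) (B s)) has_vector_derivative
    dd (\<lambda>y. F y (A t) (B t)) (X t) X' + F (X t) A' (B t) + F (X t) (A t) B') (at t)"
proof (rule linear_family_vector_derivative[OF _ _ B])
  show "\<forall>\<^sub>F s in nhds t. linear (F (X s) (A s))"
    using eventually_in_open[OF assms(1,3) X]
    by eventually_elim (use assms(2) fam2_def bilinear_iff in blast)
  show "((\<lambda>s. F (X s) (A s) b) has_vector_derivative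
      dd (\<lambda>y. F y (A t) b) (X t) X' + F (X t) A' b) (at t)" for b
    by (rule fam1_vector_derivative[OF assms(1) fam2_left[OF assms(2)] assms(3) X A])
qed


subsection \<open>Representing linear forms by a positive definite bilinear form\<close>

text \<open>\<open>T\<close> is the Gram matrix of \<open>B\<close> in the standard basis. A vector
  in its kernel is \<open>B\<close>-orthogonal to every basis vector, hence to itself, which
  positivity excludes unless it is 0.\<close>

lemma bilinear_form_matrix:
  fixes B :: "'e::euclidean_space \<Rightarrow> 'e \<Rightarrow> real"
  assumes "bilinear B" "\<forall>a. a \<noteq> 0 \<longrightarrow> B a a > 0"
  defines "T \<equiv> \<lambda>v. \<Sum>i\<in>Basis. B v i *\<^sub>R i"
  shows "linear T" "inj T" "surj T" "i \<in> Basis \<Longrightarrow> T v \<bullet> i = B v i"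
proof -
  show T: "T v \<bullet> i = B v i" if "i \<in> Basis" for v i using that by (simp add: T_def)
  show lin: "linear T"
    unfolding T_def
    by (auto intro!: linearI simp: bilinear_ladd[OF assms(1)] bilinear_lmul[OF assms(1)]
        scaleR_add_left sum.distrib scaleR_sum_right)
  have "v = 0" if "T v = 0" for v
  proof (rule ccontr)
    assume "v \<noteq> 0"
    have "B v v = (\<Sum>i\<in>Basis. (v \<bullet> i) *\<^sub>R B v i)"
      using linear_basis_sum[of "B v" v] assms(1) by (auto simp: bilinear_iff)
    also have "\<dots> = 0" using T[of _ v] that by (auto intro!: sum.neutral)
    finally show False using assms(2) \<open>v \<noteq> 0\<close> by auto
  qed
  then show inj: "inj T" using lin linear_injective_0 by blast
  then show "surj T" using lin linear_injective_imp_surjective by blast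
qed

text \<open>Existence and uniqueness behind the definite description in
  \<open>christoffel\<close>.\<close>

lemma riesz_bilinear:
  fixes B :: "'e::euclidean_space \<Rightarrow> 'e \<Rightarrow> real"
  assumes "bilinear B" "\<forall>a. a \<noteq> 0 \<longrightarrow> B a a > 0" "linear r"
  shows "\<exists>!u. \<forall>w. B u w = r w"
proof -
  let ?T = "\<lambda>v. \<Sum>i\<in>Basis. B v i *\<^sub>R i"
  note T = bilinear_form_matrix[OF assms(1,2)]
  obtain u where u: "(\<Sum>i\<in>Basis. r i *\<^sub>R i) = ?T u" using surjD[OF T(3)] by blast
  have "B u i = r i" if "i \<in> Basis" for i
    using T(4)[OF that, of u] that unfolding u[symmetric] by simp
  moreover have "linear (B u)" using assms(1) by (simp add: bilinear_iff)
  ultimately have "B u w = r w" for w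
    using linear_basis_sum[of "B u" w] linear_basis_sum[OF assms(3), of w] by simp
  then have u: "\<forall>w. B u w = r w" by blast
  show ?thesis
  proof (rule ex1I[of _ u])
    fix v assume "\<forall>w. B v w = r w"
    then have "?T v = ?T u" using u by simp
    then show "v = u" by (rule injD[OF T(2)])
  qed (rule u)
qed

text \<open>At a zero of \<open>g\<close> the product rule has only the term
  \<open>f x * g' h\<close>, and continuity of \<open>f\<close> suffices. It will be applied with
  \<open>f\<close> a coordinate of a solution whose differentiability is still to be shown.\<close>

lemma has_derivative_continuous_times_vanishing:
  fixes f :: "'x::real_normed_vector \<Rightarrow> real"
  assumes "isCont f x" "(g has_derivative g') (at x)" "g x = 0"
  shows "((\<lambda>y. f y * g y) has_derivative (\<lambda>h. f x * g' h)) (at x)"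
proof -
  obtain K where K: "\<And>h. norm (g' h) \<le> norm h * K" "K \<ge> 0"
    using bounded_linear.nonneg_bounded[OF has_derivative_bounded_linear[OF assms(2)]] by blast
  have g: "((\<lambda>y. norm (g y - g' (y - x)) / norm (y - x)) \<longlongrightarrow> 0) (at x)"
    using assms(2,3) by (simp add: has_derivative_iff_norm)
  have f: "((\<lambda>y. \<bar>f y - f x\<bar>) \<longlongrightarrow> 0) (at x)"
    using assms(1) by (simp add: isCont_def LIM_zero tendsto_rabs_zero)
  have "((\<lambda>y. \<bar>f y\<bar> * (norm (g y - g' (y - x)) / norm (y - x)) + \<bar>f y - f x\<bar> * K) \<longlongrightarrow> \<bar>f x\<bar> * 0 + 0 * K) (at x)"
    using assms(1) by (intro tendsto_intros g f) (simp add: isCont_def)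
  then have lim: "((\<lambda>y. \<bar>f y\<bar> * (norm (g y - g' (y - x)) / norm (y - x)) + \<bar>f y - f x\<bar> * K) \<longlongrightarrow> 0) (at x)"
    by simp
  have le: "norm (f y * g y - f x * g x - f x * g' (y - x)) / norm (y - x)
      \<le> \<bar>f y\<bar> * (norm (g y - g' (y - x)) / norm (y - x)) + \<bar>f y - f x\<bar> * K" for y
  proof (cases "y = x")
    case False
    have "norm (f y * g y - f x * g x - f x * g' (y - x))
        = norm (f y * (g y - g' (y - x)) + (f y - f x) * g' (y - x))"
      by (simp add: assms(3) algebra_simps)
    also have "\<dots> \<le> \<bar>f y\<bar> * norm (g y - g' (y - x)) + \<bar>f y - f x\<bar> * (norm (y - x) * K)"
      by (intro order_trans[OF norm_triangle_ineq] add_mono)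
        (auto simp: abs_mult intro!: mult_left_mono K[simplified])
    finally show ?thesis using False by (simp add: field_simps)
  qed (use K in auto)
  have "((\<lambda>y. norm (f y * g y - f x * g x - f x * g' (y - x)) / norm (y - x)) \<longlongrightarrow> 0) (at x)"
    by (rule tendsto_sandwich[OF _ always_eventually[OF allI[OF le]] tendsto_const lim]) simp
  then show ?thesis
    using bounded_linear_const_mult[OF has_derivative_bounded_linear[OF assms(2)]]
    by (simp add: has_derivative_iff_norm)
qed

context
  fixes U :: "'x::real_normed_vector set" and m :: "'x \<Rightarrow> 'e::euclidean_space \<Rightarrow> 'e \<Rightarrow> real"
  assumes U: "open U" and m: "fam2 U m" and pos: "\<forall>x\<in>U. \<forall>a. a \<noteq> 0 \<longrightarrow> m x a a > 0"
begin

text \<open>Solving \<open>m y (u y) = r y\<close> for \<open>u y\<close> by means of the inverse \<open>N\<close> of the matrix at the fixed point \<open>x\<close>.\<close>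
lemma solution_expansion:
  assumes "x \<in> U" and u: "\<forall>z\<in>U. \<forall>w. m z (u z) w = r z w"
  obtains N where "bounded_linear N"
    "\<forall>y\<in>U. u y = u x + N (\<Sum>i\<in>Basis. (r y i - r x i - (\<Sum>j\<in>Basis. (u y \<bullet> j) * (m y j i - m x j i))) *\<^sub>R i)"
proof -
  define T where "T = (\<lambda>v. \<Sum>i\<in>Basis. m x v i *\<^sub>R i)"
  have bil: "bilinear (m y)" if "y \<in> U" for y using m that by (simp add: fam2_def)
  note x = assms(1)
  note T = bilinear_form_matrix[OF bil[OF x] bspec[OF pos x], folded T_def]
  obtain N where N: "linear N" "N \<circ> T = id"
    using linear_injective_left_inverse[OF T(1,2)] by blast
  show thesis
  proof (rule that)
    show "bounded_linear N" using N(1) by (simp add: linear_conv_bounded_linear)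
    show "\<forall>y\<in>U. u y = u x + N (\<Sum>i\<in>Basis. (r y i - r x i - (\<Sum>j\<in>Basis. (u y \<bullet> j) * (m y j i - m x j i))) *\<^sub>R i)"
    proof
    fix y assume y: "y \<in> U"
    \<comment> \<open>The correction sum is \<open>m y (u y) i - m x (u y) i\<close>. Subtracting it
      from \<open>m y (u y) i - m x (u x) i\<close> leaves a value of the fixed form
      \<open>m x\<close>, which \<open>N\<close> can invert.\<close>
    have "r y i - r x i - (\<Sum>j\<in>Basis. (u y \<bullet> j) * (m y j i - m x j i)) = m x (u y - u x) i" for i
    proof -
      have "linear (\<lambda>a. m z a i)" if "z \<in> U" for z using bil[OF that] by (simp add: bilinear_iff)
      then have "m z a i = (\<Sum>j\<in>Basis. (a \<bullet> j) * m z j i)" if "z \<in> U" for z a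
        using linear_basis_sum[of "\<lambda>a. m z a i" a] that by simp
      then have "(\<Sum>j\<in>Basis. (u y \<bullet> j) * (m y j i - m x j i)) = m y (u y) i - m x (u y) i"
        using y x by (simp add: right_diff_distrib sum_subtractf)
      then show ?thesis using u y x bilinear_lsub[OF bil[OF x]] by simp
    qed
    then show "u y = u x + N (\<Sum>i\<in>Basis. (r y i - r x i - (\<Sum>j\<in>Basis. (u y \<bullet> j) * (m y j i - m x j i))) *\<^sub>R i)"
      using N(2) by (simp add: fun_eq_iff T_def)
    qed
  qed
qed

text \<open>The expansion has \<open>u y\<close> on both sides. It gives a bound of
  \<open>norm (u y - u x)\<close> by \<open>K * (\<rho> y + norm (u y) * \<mu> y)\<close>, where
  \<rho> and \<mu> tend to 0, and the unknown norm has to be absorbed.\<close>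

lemma solution_continuous:
  assumes u: "\<forall>z\<in>U. \<forall>w. m z (u z) w = r z w"
    and r: "\<And>w. continuous_on U (\<lambda>x. r x w)"
  shows "continuous_on U u"
proof -
  have "isCont u x" if x: "x \<in> U" for x
  proof -
    obtain N where N: "bounded_linear N" "\<forall>y\<in>U.
      u y = u x + N (\<Sum>i\<in>Basis. (r y i - r x i - (\<Sum>j\<in>Basis. (u y \<bullet> j) * (m y j i - m x j i))) *\<^sub>R i)"
      by (rule solution_expansion[OF x u])
    obtain K where K: "\<And>h. norm (N h) \<le> norm h * K" "K \<ge> 0"
      using bounded_linear.nonneg_bounded[OF N(1)] by blast
    define \<rho> where "\<rho> = (\<lambda>y. \<Sum>i\<in>Basis. \<bar>r y i - r x i\<bar>)"
    define \<mu> where "\<mu> = (\<lambda>y. \<Sum>i\<in>Basis. \<Sum>j\<in>Basis. \<bar>m y j i - m x j i\<bar>)"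
    have cm: "isCont (\<lambda>y. m y a b) x" for a b
      using m x U smooth_on_continuous unfolding fam2_def by (metis continuous_on_eq_continuous_at)
    have cr: "isCont (\<lambda>y. r y a) x" for a
      using r x U by (metis continuous_on_eq_continuous_at)
    have \<rho>: "(\<rho> \<longlongrightarrow> 0) (at x)"
      unfolding \<rho>_def using cr by (auto intro!: tendsto_null_sum tendsto_rabs_zero LIM_zero simp: isCont_def)
    have \<mu>: "(\<mu> \<longlongrightarrow> 0) (at x)"
      unfolding \<mu>_def using cm by (auto intro!: tendsto_null_sum tendsto_rabs_zero LIM_zero simp: isCont_def)
    have le: "norm (u y - u x) \<le> K * (\<rho> y + norm (u y) * \<mu> y)" if "y \<in> U" for y
    proof -
      have "norm (\<Sum>i\<in>Basis. (r y i - r x i - (\<Sum>j\<in>Basis. (u y \<bullet> j) * (m y j i - m x j i))) *\<^sub>R (i::'e))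
          \<le> (\<Sum>i\<in>(Basis::'e set). \<bar>r y i - r x i\<bar> + (\<Sum>j\<in>Basis. norm (u y) * \<bar>m y j i - m x j i\<bar>))"
      proof (rule sum_norm_le)
        fix i :: 'e assume "i \<in> Basis"
        have "\<bar>\<Sum>j\<in>Basis. (u y \<bullet> j) * (m y j i - m x j i)\<bar> \<le> (\<Sum>j\<in>Basis. norm (u y) * \<bar>m y j i - m x j i\<bar>)"
          by (rule order_trans[OF sum_abs sum_mono]) (auto simp: abs_mult intro!: mult_right_mono Basis_le_norm)
        then show "norm ((r y i - r x i - (\<Sum>j\<in>Basis. (u y \<bullet> j) * (m y j i - m x j i))) *\<^sub>R i)
          \<le> \<bar>r y i - r x i\<bar> + (\<Sum>j\<in>Basis. norm (u y) * \<bar>m y j i - m x j i\<bar>)"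
          using \<open>i \<in> Basis\<close> by simp
      qed
      also have "\<dots> = \<rho> y + norm (u y) * \<mu> y"
        by (simp add: \<rho>_def \<mu>_def sum.distrib sum_distrib_left)
      finally have "norm (\<Sum>i\<in>Basis. (r y i - r x i - (\<Sum>j\<in>Basis. (u y \<bullet> j) * (m y j i - m x j i))) *\<^sub>R (i::'e)) * K
        \<le> (\<rho> y + norm (u y) * \<mu> y) * K" using K(2) by (rule mult_right_mono)
      moreover have "u y - u x = N (\<Sum>i\<in>Basis. (r y i - r x i - (\<Sum>j\<in>Basis. (u y \<bullet> j) * (m y j i - m x j i))) *\<^sub>R i)"
        by (rule iffD2[OF diff_eq_eq], subst add.commute) (rule bspec[OF N(2) that])
      ultimately show ?thesis using K(1) by (smt (verit) mult.commute)
    qed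
    have "((\<lambda>y. K * \<mu> y) \<longlongrightarrow> K * 0) (at x)" by (intro tendsto_intros \<mu>)
    \<comment> \<open>Once \<open>K * \<mu> y\<close> is below 1/2, the share of
      \<open>norm (u y)\<close> that comes from \<open>norm (u y - u x)\<close> moves to the left.
      This accounts for the factor 2 in the bound below.\<close>
    then have small: "\<forall>\<^sub>F y in at x. K * \<mu> y < 1/2" by (rule order_tendstoD) simp
    have inU: "\<forall>\<^sub>F y in at x. y \<in> U" using x U by (simp add: eventually_at_in_open')
    have "((\<lambda>y. 2 * K * (\<rho> y + norm (u x) * \<mu> y)) \<longlongrightarrow> 2 * K * (0 + norm (u x) * 0)) (at x)"
      by (intro tendsto_intros \<mu> \<rho>)
    then have lim: "((\<lambda>y. 2 * K * (\<rho> y + norm (u x) * \<mu> y)) \<longlongrightarrow> 0) (at x)" by simp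
    have "\<forall>\<^sub>F y in at x. norm (u y - u x) \<le> 2 * K * (\<rho> y + norm (u x) * \<mu> y)"
      using small inU
    proof eventually_elim
      case (elim y)
      have mu0: "\<mu> y \<ge> 0" by (simp add: \<mu>_def sum_nonneg)
      have "norm (u y) \<le> norm (u x) + norm (u y - u x)" by (metis norm_triangle_sub)
      then have "K * (\<mu> y * norm (u y)) \<le> K * (\<mu> y * (norm (u x) + norm (u y - u x)))"
        using K(2) mu0 by (intro mult_left_mono) auto
      moreover have "K * \<mu> y * norm (u y - u x) \<le> 1/2 * norm (u y - u x)"
        using elim(1) by (intro mult_right_mono) auto
      ultimately show ?case using le[OF elim(2)] by (simp add: algebra_simps)
    qed
    then have "((\<lambda>y. norm (u y - u x)) \<longlongrightarrow> 0) (at x)"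
      by (rule tendsto_sandwich[OF _ _ tendsto_const lim, rotated]) simp
    then show ?thesis by (simp add: isCont_def LIM_zero_iff tendsto_norm_zero_iff)
  qed
  then show ?thesis by (simp add: continuous_at_imp_continuous_on)
qed

text \<open>In the expansion \<open>u y\<close> occurs only multiplied by
  \<open>m y j i - m x j i\<close>, which vanishes at \<open>x\<close>. So the continuity of
  \<open>u\<close> already gives the derivative of these products.\<close>

lemma solution_differentiable:
  assumes u: "\<forall>z\<in>U. \<forall>w. m z (u z) w = r z w"
    and r: "\<forall>z\<in>U. \<forall>w. (\<lambda>x. r x w) differentiable (at z)"
    and x: "x \<in> U"
  shows "u differentiable (at x)"
proof -
  obtain N where N: "bounded_linear N" "\<forall>y\<in>U.
    u y = u x + N (\<Sum>i\<in>Basis. (r y i - r x i - (\<Sum>j\<in>Basis. (u y \<bullet> j) * (m y j i - m x j i))) *\<^sub>R i)"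
    by (rule solution_expansion[OF x u])
  have "continuous_on U u"
    using r by (intro solution_continuous[OF u] continuous_at_imp_continuous_on)
      (auto intro: differentiable_imp_continuous_within)
  then have "isCont u x" using U x by (simp add: continuous_on_eq_continuous_at)
  then have c: "isCont (\<lambda>y. u y \<bullet> j) x" for j by simp
  have "((\<lambda>y. m y j i) has_derivative (\<lambda>h. dd (\<lambda>y. m y j i) x h)) (at x)" for i j
    using m x smooth_on_has_derivative unfolding fam2_def by blast
  then have "((\<lambda>y. m y j i - m x j i) has_derivative (\<lambda>h. dd (\<lambda>y. m y j i) x h)) (at x)" for i j
    by (auto intro!: derivative_eq_intros)
  note 1 = has_derivative_continuous_times_vanishing[OF c this]
  have 2: "((\<lambda>y. r y i) has_derivative (\<lambda>h. dd (\<lambda>y. r y i) x h)) (at x)" for i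
    using r x frechet_derivative_works by blast
  have "((\<lambda>y. u x + N (\<Sum>i\<in>Basis. (r y i - r x i - (\<Sum>j\<in>Basis. (u y \<bullet> j) * (m y j i - m x j i))) *\<^sub>R i))
    has_derivative (\<lambda>h. 0 + N (\<Sum>i\<in>Basis. (dd (\<lambda>y. r y i) x h - 0 - (\<Sum>j\<in>Basis. (u x \<bullet> j) * dd (\<lambda>y. m y j i) x h)) *\<^sub>R i))) (at x)"
    by (intro has_derivative_add has_derivative_const bounded_linear.has_derivative[OF N(1)]
        has_derivative_sum has_derivative_scaleR_left has_derivative_diff 1 2) simp
  then have "(\<lambda>y. u x + N (\<Sum>i\<in>Basis. (r y i - r x i - (\<Sum>j\<in>Basis. (u y \<bullet> j) * (m y j i - m x j i))) *\<^sub>R i))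
    differentiable (at x)" by (auto simp: differentiable_def)
  then show ?thesis by (rule differentiable_cong_open[OF U x, THEN iffD2, rotated]) (rule bspec[OF N(2)])
qed

lemma solution_Ck:
  assumes "\<forall>z\<in>U. \<forall>w. m z (u z) w = r z w" "\<And>w. Ck_on k U (\<lambda>x. r x w)"
  shows "Ck_on k U u"
  using assms
proof (induction k arbitrary: u r)
  case 0
  then show ?case using solution_continuous[OF 0(1)] by simp
next
  case (Suc k)
  have r: "\<forall>z\<in>U. \<forall>w. (\<lambda>x. r x w) differentiable (at z)" using Suc.prems(2) by simp
  note u = solution_differentiable[OF Suc.prems(1) r]
  have uk: "Ck_on k U u" using Suc.IH[of u r] Suc.prems Ck_on_SucD by blast
  have "Ck_on k U (\<lambda>x. dd u x v)" for v
  proof (rule Suc.IH)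
    \<comment> \<open>Differentiate \<open>m z (u z) w = r z w\<close> along \<open>v\<close> and
      solve for the term with \<open>dd u z v\<close>: the derivative of a solution solves a system
      with the same matrix, so the induction hypothesis applies to it.\<close>
    define r' where "r' = (\<lambda>x w. dd (\<lambda>y. r y w) x v - (\<Sum>j\<in>Basis. (u x \<bullet> j) *\<^sub>R dd (\<lambda>y. m y j w) x v))"
    have lin: "linear (\<lambda>a. m z a w)" if "z \<in> U" for z w
      using m that by (simp add: fam2_def bilinear_iff)
    show "\<forall>z\<in>U. \<forall>w. m z (dd u z v) w = r' z w"
    proof (intro ballI allI)
      fix z w assume z: "z \<in> U"
      have D: "((\<lambda>y. m y j w) has_derivative (\<lambda>h. dd (\<lambda>y. m y j w) z h)) (at z)" for j
        using m z smooth_on_has_derivative unfolding fam2_def by blast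
      have Du: "((\<lambda>y. u y \<bullet> j) has_derivative (\<lambda>h. dd u z h \<bullet> j)) (at z)" for j
        using u[OF z] frechet_derivative_works bounded_linear.has_derivative[OF bounded_linear_inner_left] by blast
      have "((\<lambda>y. \<Sum>j\<in>Basis. (u y \<bullet> j) *\<^sub>R m y j w) has_derivative
          (\<lambda>h. \<Sum>j\<in>Basis. (u z \<bullet> j) *\<^sub>R dd (\<lambda>y. m y j w) z h + (dd u z h \<bullet> j) *\<^sub>R m z j w)) (at z)"
        by (intro has_derivative_sum has_derivative_scaleR D Du)
      then have "dd (\<lambda>y. \<Sum>j\<in>Basis. (u y \<bullet> j) *\<^sub>R m y j w) z v =
          (\<Sum>j\<in>Basis. (u z \<bullet> j) *\<^sub>R dd (\<lambda>y. m y j w) z v) + m z (dd u z v) w"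
        using dd_eqI linear_basis_sum[OF lin[OF z], of "dd u z v" w] by (fastforce simp: sum.distrib)
      moreover have "dd (\<lambda>y. \<Sum>j\<in>Basis. (u y \<bullet> j) *\<^sub>R m y j w) z v = dd (\<lambda>y. r y w) z v"
      proof (rule fun_cong[OF dd_cong_open[OF U z]])
        fix y assume y: "y \<in> U"
        show "(\<Sum>j\<in>Basis. (u y \<bullet> j) *\<^sub>R m y j w) = r y w"
          using linear_basis_sum[OF lin[OF y], of "u y" w] Suc.prems(1) y by simp
      qed
      ultimately show "m z (dd u z v) w = r' z w" by (simp add: r'_def)
    qed
    have "Ck_on k U (\<lambda>x. dd (\<lambda>y. m y j w) x v)" for j w
      using m smooth_on_dd unfolding fam2_def smooth_on_def by blast
    then have S: "Ck_on k U (\<lambda>x. - (\<Sum>j\<in>Basis. (u x \<bullet> j) *\<^sub>R dd (\<lambda>y. m y j w) x v))" for w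
      by (intro Ck_on_bounded_linear[OF U bounded_linear_minus[OF bounded_linear_ident]] Ck_on_sum U
          Ck_on_bounded_bilinear[OF U bounded_bilinear_scaleR]
          Ck_on_bounded_linear[OF U bounded_linear_inner_left] uk)
    show "Ck_on k U (\<lambda>x. r' x w)" for w
      using Ck_on_add[OF U _ S, of "\<lambda>x. dd (\<lambda>y. r y w) x v" w] Suc.prems(2) by (simp add: r'_def)
  qed
  then show ?case using u by simp
qed

lemma solution_smooth:
  assumes "\<forall>z\<in>U. \<forall>w. m z (u z) w = r z w" "\<And>w. smooth_on U (\<lambda>x. r x w)"
  shows "smooth_on U u"
  using assms solution_Ck[of u r] by (simp add: smooth_on_def)

end


subsection \<open>Riemannian metrics on open sets\<close>

locale local_metric =
  fixes U :: "'e::euclidean_space set" and m :: "'e \<Rightarrow> 'e \<Rightarrow> 'e \<Rightarrow> real"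
  assumes U: "open U" and m: "fam2 U m"
    and m_sym: "x \<in> U \<Longrightarrow> m x a b = m x b a"
    and m_pos: "x \<in> U \<Longrightarrow> a \<noteq> 0 \<Longrightarrow> m x a a > 0"
begin

lemma m_bil: "x \<in> U \<Longrightarrow> bilinear (m x)"
  using m by (simp add: fam2_def)

lemmas m_simps = bilinear_rules[OF m_bil, unfolded real_scaleR_def]

lemma m_eqI:
  assumes "x \<in> U" "\<And>w. m x u w = m x v w"
  shows "u = v"
proof (rule ccontr)
  assume "u \<noteq> v"
  then have "m x (u - v) (u - v) > 0" using m_pos assms(1) by simp
  then show False using assms by (simp add: m_simps)
qed

abbreviation \<Gamma> where "\<Gamma> \<equiv> christoffel m"

lemma koszul:
  assumes "x \<in> U"
  shows "m x (\<Gamma> x a b) w =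
    (dd (\<lambda>y. m y b w) x a + dd (\<lambda>y. m y a w) x b - dd (\<lambda>y. m y a b) x w) / 2"
proof -
  let ?r = "\<lambda>w. (dd (\<lambda>y. m y b w) x a + dd (\<lambda>y. m y a w) x b - dd (\<lambda>y. m y a b) x w) / 2"
  have 1: "linear (\<lambda>w. dd (\<lambda>y. m y c w) x v)" for c v
    using fam2_dd[OF U m, of v] assms by (simp add: fam2_def bilinear_iff)
  have 2: "linear (\<lambda>w. dd (\<lambda>y. m y a b) x w)"
    using m assms dd_linear unfolding fam2_def by blast
  have "linear ?r"
    by (auto intro!: linearI simp: linear_add[OF 1] linear_add[OF 2] linear_scale[OF 1] linear_scale[OF 2] field_simps)
  from riesz_bilinear[OF m_bil[OF assms] _ this] m_pos[OF assms]
  have "\<exists>!u. \<forall>w. m x u w = ?r w" by blast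
  from theI'[OF this] show ?thesis unfolding christoffel_def by blast
qed

lemma \<Gamma>_sym: "x \<in> U \<Longrightarrow> \<Gamma> x a b = \<Gamma> x b a"
proof -
  assume x: "x \<in> U"
  have "dd (\<lambda>y. m y a b) x = dd (\<lambda>y. m y b a) x"
    by (rule dd_cong_open[OF U x]) (rule m_sym)
  then show ?thesis using x by (intro m_eqI[OF x]) (simp add: koszul)
qed

text \<open>This is \<nabla>m = 0 in coordinates: in the sum of two Koszul identities all
  derivatives but those in the direction \<open>v\<close> cancel.\<close>

lemma dd_m:
  assumes "x \<in> U"
  shows "dd (\<lambda>y. m y a b) x v = m x (\<Gamma> x v a) b + m x a (\<Gamma> x v b)"
proof -
  have "dd (\<lambda>y. m y c d) x = dd (\<lambda>y. m y d c) x" for c d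
    by (rule dd_cong_open[OF U assms]) (rule m_sym)
  then show ?thesis
    using koszul[OF assms, of v a b] koszul[OF assms, of v b a] m_sym[OF assms, of a] by simp
qed

text \<open>Everything is read off the Koszul identity: linearity from the nondegeneracy of
  \<open>m\<close>, smoothness because \<open>\<Gamma> x a b\<close> solves a linear system with
  smooth coefficients and right-hand side.\<close>

lemma \<Gamma>_fam: "fam2 U \<Gamma>"
proof -
  have ddm: "bilinear (\<lambda>a b. dd (\<lambda>y. m y a b) x v)" "linear (\<lambda>v. dd (\<lambda>y. m y a b) x v)" if "x \<in> U" for x v a b
    using fam2_dd[OF U m, of v] m that dd_linear unfolding fam2_def by blast+
  have lin: "linear (\<Gamma> x a)" if x: "x \<in> U" for x a
  proof (rule linearI)
    show "\<Gamma> x a (b + c) = \<Gamma> x a b + \<Gamma> x a c" for b c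
      by (rule m_eqI[OF x]) (simp add: koszul x m_simps linear_add[OF ddm(2)[OF x]]
         bilinear_ladd[OF ddm(1)[OF x]] bilinear_radd[OF ddm(1)[OF x]] field_simps)
    show "\<Gamma> x a (r *\<^sub>R b) = r *\<^sub>R \<Gamma> x a b" for r b
      by (rule m_eqI[OF x]) (simp add: koszul x m_simps linear_scale[OF ddm(2)[OF x]]
         bilinear_lmul[OF ddm(1)[OF x]] bilinear_rmul[OF ddm(1)[OF x]] field_simps)
  qed
  have "(\<lambda>a. \<Gamma> x a b) = \<Gamma> x b" if "x \<in> U" for x b using \<Gamma>_sym[OF that] by auto
  then have "bilinear (\<Gamma> x)" if "x \<in> U" for x using lin that by (simp add: bilinear_iff)
  moreover have "smooth_on U (\<lambda>x. \<Gamma> x a b)" for a b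
  proof (rule solution_smooth[OF U m])
    show "\<forall>z\<in>U. \<forall>w. m z (\<Gamma> z a b) w =
        (1/2) *\<^sub>R (dd (\<lambda>y. m y b w) z a + dd (\<lambda>y. m y a w) z b - dd (\<lambda>y. m y a b) z w)"
      by (simp add: koszul)
    show "\<forall>x\<in>U. \<forall>a. a \<noteq> 0 \<longrightarrow> m x a a > 0" using m_pos by blast
    show "smooth_on U (\<lambda>z. (1/2) *\<^sub>R (dd (\<lambda>y. m y b w) z a + dd (\<lambda>y. m y a w) z b - dd (\<lambda>y. m y a b) z w))" for w
      using m unfolding fam2_def
      by (intro smooth_on_scaleR smooth_on_add smooth_on_diff smooth_on_dd U smooth_on_const) auto
  qed
  ultimately show ?thesis by (simp add: fam2_def)
qed

lemma \<Gamma>_bil: "x \<in> U \<Longrightarrow> bilinear (\<Gamma> x)"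
  using \<Gamma>_fam by (simp add: fam2_def)

lemmas \<Gamma>_simps = bilinear_rules[OF \<Gamma>_bil]

text \<open>\<open>covd X X' A t N\<close>: the field \<open>A\<close> along the curve \<open>X\<close> with velocity \<open>X'\<close> at \<open>t\<close> has there the
  covariant derivative \<open>N\<close>.\<close>
definition covd :: "(real \<Rightarrow> 'e) \<Rightarrow> 'e \<Rightarrow> (real \<Rightarrow> 'e) \<Rightarrow> real \<Rightarrow> 'e \<Rightarrow> bool" where
  "covd X X' A t N \<longleftrightarrow> (A has_vector_derivative (N - \<Gamma> (X t) X' (A t))) (at t)"

lemma covdI:
  "(A has_vector_derivative A') (at t) \<Longrightarrow> N = A' + \<Gamma> (X t) X' (A t) \<Longrightarrow> covd X X' A t N"
  by (simp add: covd_def)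

lemma covd_unique: "covd X X' A t N \<Longrightarrow> covd X X' A t N' \<Longrightarrow> N = N'"
  unfolding covd_def using vector_derivative_unique_at by fastforce

lemma covd_const: "covd X X' (\<lambda>s. b) t (\<Gamma> (X t) X' b)"
  by (rule covdI[where A'=0]) auto

lemma covd_add:
  "X t \<in> U \<Longrightarrow> covd X X' A t N \<Longrightarrow> covd X X' B t M \<Longrightarrow> covd X X' (\<lambda>s. A s + B s) t (N + M)"
  unfolding covd_def using has_vector_derivative_add[of A _ "at t" B]
  by (fastforce simp: \<Gamma>_simps algebra_simps)

lemma covd_minus: "X t \<in> U \<Longrightarrow> covd X X' A t N \<Longrightarrow> covd X X' (\<lambda>s. - A s) t (- N)"
  unfolding covd_def using has_vector_derivative_minus[of A _ "at t"]
  by (fastforce simp: \<Gamma>_simps algebra_simps)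

lemma covd_scaleR:
  assumes "X t \<in> U" "(f has_real_derivative f') (at t)" "covd X X' A t N"
  shows "covd X X' (\<lambda>s. f s *\<^sub>R A s) t (f' *\<^sub>R A t + f t *\<^sub>R N)"
  using has_vector_derivative_scaleR[OF assms(2) assms(3)[unfolded covd_def]]
  by (rule covdI) (simp add: \<Gamma>_simps assms(1) algebra_simps)

lemma covd_scaleR_const:
  "X t \<in> U \<Longrightarrow> covd X X' A t N \<Longrightarrow> covd X X' (\<lambda>s. r *\<^sub>R A s) t (r *\<^sub>R N)"
  using covd_scaleR[of X t "\<lambda>_. r" 0] by simp

lemma covd_m:
  assumes "X t \<in> U" "(X has_vector_derivative X') (at t)" "covd X X' A t N" "covd X X' B t M"
  shows "((\<lambda>s. m (X s) (A s) (B s)) has_real_derivative m (X t) N (B t) + m (X t) (A t) M) (at t)"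
  using fam2_vector_derivative[OF U m assms(1,2) assms(3,4)[unfolded covd_def]]
  by (simp add: has_real_derivative_iff_has_vector_derivative dd_m assms(1) m_simps)

text \<open>\<Gamma> is not a tensor, so there is no Leibniz rule with covariant derivatives of
  \<open>A\<close> and \<open>B\<close>; their plain derivatives enter, and the last summand belongs
  to the vector field \<Gamma>(A, B) as a whole.\<close>

lemma covd_\<Gamma>:
  assumes "X t \<in> U" "(X has_vector_derivative X') (at t)"
    "(A has_vector_derivative A') (at t)" "(B has_vector_derivative B') (at t)"
  shows "covd X X' (\<lambda>s. \<Gamma> (X s) (A s) (B s)) t
    (dd (\<lambda>y. \<Gamma> y (A t) (B t)) (X t) X' + \<Gamma> (X t) A' (B t) + \<Gamma> (X t) (A t) B'
      + \<Gamma> (X t) X' (\<Gamma> (X t) (A t) (B t)))"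
  by (rule covdI[OF fam2_vector_derivative[OF U \<Gamma>_fam assms]]) simp

section \<open>The curvature tensor and its symmetries\<close>

text \<open>Sign convention: for constant coordinate fields, \<open>R x a b c\<close> is \<nabla>_a
  \<nabla>_b c - \<nabla>_b \<nabla>_a c.\<close>

definition R :: "'e \<Rightarrow> 'e \<Rightarrow> 'e \<Rightarrow> 'e \<Rightarrow> 'e" where
  "R x a b c = dd (\<lambda>y. \<Gamma> y b c) x a - dd (\<lambda>y. \<Gamma> y a c) x b + \<Gamma> x a (\<Gamma> x b c) - \<Gamma> x b (\<Gamma> x a c)"

lemma dd\<Gamma>_bil: "x \<in> U \<Longrightarrow> bilinear (\<lambda>a b. dd (\<lambda>y. \<Gamma> y a b) x v)"
  using fam2_dd[OF U \<Gamma>_fam] by (simp add: fam2_def)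

lemma dd\<Gamma>_linear: "x \<in> U \<Longrightarrow> linear (\<lambda>v. dd (\<lambda>y. \<Gamma> y a b) x v)"
  using \<Gamma>_fam dd_linear unfolding fam2_def by blast

lemma dd\<Gamma>_sym: "x \<in> U \<Longrightarrow> dd (\<lambda>y. \<Gamma> y a b) x v = dd (\<lambda>y. \<Gamma> y b a) x v"
  by (rule fun_cong[OF dd_cong_open[OF U]]) (auto intro: \<Gamma>_sym)

lemma dd\<Gamma>_simps:
  assumes "x \<in> U"
  shows "dd (\<lambda>y. \<Gamma> y (a + b) c) x v = dd (\<lambda>y. \<Gamma> y a c) x v + dd (\<lambda>y. \<Gamma> y b c) x v"
    "dd (\<lambda>y. \<Gamma> y c (a + b)) x v = dd (\<lambda>y. \<Gamma> y c a) x v + dd (\<lambda>y. \<Gamma> y c b) x v"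
    "dd (\<lambda>y. \<Gamma> y (r *\<^sub>R a) c) x v = r *\<^sub>R dd (\<lambda>y. \<Gamma> y a c) x v"
    "dd (\<lambda>y. \<Gamma> y c (r *\<^sub>R a)) x v = r *\<^sub>R dd (\<lambda>y. \<Gamma> y c a) x v"
    "dd (\<lambda>y. \<Gamma> y a c) x (v + w) = dd (\<lambda>y. \<Gamma> y a c) x v + dd (\<lambda>y. \<Gamma> y a c) x w"
    "dd (\<lambda>y. \<Gamma> y a c) x (r *\<^sub>R v) = r *\<^sub>R dd (\<lambda>y. \<Gamma> y a c) x v"
  by (simp_all add: bilinear_rules[OF dd\<Gamma>_bil[OF assms]]
      linear_add[OF dd\<Gamma>_linear[OF assms]] linear_scale[OF dd\<Gamma>_linear[OF assms]])

lemma R_fam: "fam2 U (\<lambda>x a b. R x a b c)"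
  unfolding fam2_def bilinear_iff
proof (intro conjI allI ballI)
  show "smooth_on U (\<lambda>x. R x a b c)" for a b
    unfolding R_def using \<Gamma>_fam
    by (intro smooth_on_diff smooth_on_add smooth_on_dd U fam1_smooth[OF U fam2_right[OF \<Gamma>_fam]])
      (auto simp: fam2_def)
qed (auto intro!: linearI simp: R_def dd\<Gamma>_simps \<Gamma>_simps scaleR_add_right scaleR_diff_right)

lemma R_linear: "x \<in> U \<Longrightarrow> linear (R x a b)"
  by (auto intro!: linearI simp: R_def dd\<Gamma>_simps \<Gamma>_simps algebra_simps)

lemma R_simps:
  assumes "x \<in> U"
  shows "R x (a + b) c d = R x a c d + R x b c d" "R x c (a + b) d = R x c a d + R x c b d"
    "R x c d (a + b) = R x c d a + R x c d b"
    "R x (a - b) c d = R x a c d - R x b c d" "R x c (a - b) d = R x c a d - R x c b d"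
    "R x c d (a - b) = R x c d a - R x c d b"
    "R x (- a) c d = - R x a c d" "R x c (- a) d = - R x c a d" "R x c d (- a) = - R x c d a"
    "R x (r *\<^sub>R a) c d = r *\<^sub>R R x a c d" "R x c (r *\<^sub>R a) d = r *\<^sub>R R x c a d"
    "R x c d (r *\<^sub>R a) = r *\<^sub>R R x c d a"
proof -
  have bil: "bilinear (\<lambda>a b. R x a b c)" for c using R_fam assms by (simp add: fam2_def)
  show "R x (a + b) c d = R x a c d + R x b c d" "R x c (a + b) d = R x c a d + R x c b d"
    "R x (a - b) c d = R x a c d - R x b c d" "R x c (a - b) d = R x c a d - R x c b d"
    "R x (- a) c d = - R x a c d" "R x c (- a) d = - R x c a d"
    "R x (r *\<^sub>R a) c d = r *\<^sub>R R x a c d" "R x c (r *\<^sub>R a) d = r *\<^sub>R R x c a d"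
    by (rule bilinear_rules[OF bil])+
  show "R x c d (a + b) = R x c d a + R x c d b" "R x c d (a - b) = R x c d a - R x c d b"
    "R x c d (- a) = - R x c d a" "R x c d (r *\<^sub>R a) = r *\<^sub>R R x c d a"
    using linear_add[OF R_linear[OF assms]] linear_diff[OF R_linear[OF assms]]
      linear_neg[OF R_linear[OF assms]] linear_scale[OF R_linear[OF assms]] by auto
qed

lemma R_antisym: "R x a b c = - R x b a c"
  by (simp add: R_def)

lemma R_bianchi: "x \<in> U \<Longrightarrow> R x a b c + R x b c a + R x c a b = 0"
  by (simp add: R_def dd\<Gamma>_sym[of x b a] dd\<Gamma>_sym[of x c a] dd\<Gamma>_sym[of x c b]
      \<Gamma>_sym[of x b a] \<Gamma>_sym[of x c a] \<Gamma>_sym[of x c b])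

lemma line_derivative: "((\<lambda>s. x + s *\<^sub>R v) has_vector_derivative v) (at t)"
  by (auto intro!: derivative_eq_intros simp: has_vector_derivative_def)

text \<open>Second derivatives of the function \<open>m z c d\<close> commute. Expanding them by
  metric compatibility, the products of two Christoffel terms are symmetric in the two directions
  and cancel, and the antisymmetric rest is m(R c, d) + m(c, R d).\<close>

lemma R_skew:
  assumes "x \<in> U"
  shows "m x (R x a b c) d = - m x c (R x a b d)"
proof -
  have *: "dd (\<lambda>y. dd (\<lambda>z. m z c d) y v) x w =
     m x (dd (\<lambda>y. \<Gamma> y v c) x w + \<Gamma> x w (\<Gamma> x v c)) d + m x (\<Gamma> x v c) (\<Gamma> x w d)
     + m x (\<Gamma> x w c) (\<Gamma> x v d) + m x c (dd (\<lambda>y. \<Gamma> y v d) x w + \<Gamma> x w (\<Gamma> x v d))" for v w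
  proof -
    let ?X = "\<lambda>s. x + s *\<^sub>R w"
    have X: "?X 0 \<in> U" using assms by simp
    have cov: "covd ?X w (\<lambda>s. \<Gamma> (?X s) v e) 0 (dd (\<lambda>y. \<Gamma> y v e) x w + \<Gamma> x w (\<Gamma> x v e))" for e
      using covd_\<Gamma>[of ?X, OF X line_derivative has_vector_derivative_const has_vector_derivative_const, of v e]
      by (simp add: \<Gamma>_simps assms)
    have cc: "covd ?X w (\<lambda>s. e) 0 (\<Gamma> x w e)" for e using covd_const[of ?X w e 0] by simp
    have "((\<lambda>s. m (?X s) (\<Gamma> (?X s) v c) d + m (?X s) c (\<Gamma> (?X s) v d)) has_vector_derivative
      m x (dd (\<lambda>y. \<Gamma> y v c) x w + \<Gamma> x w (\<Gamma> x v c)) d + m x (\<Gamma> x v c) (\<Gamma> x w d)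
       + (m x (\<Gamma> x w c) (\<Gamma> x v d) + m x c (dd (\<lambda>y. \<Gamma> y v d) x w + \<Gamma> x w (\<Gamma> x v d)))) (at 0)"
      using covd_m[OF X line_derivative cov cc] covd_m[OF X line_derivative cc cov]
      unfolding has_real_derivative_iff_has_vector_derivative by (intro has_vector_derivative_add) auto
    then have 1: "((\<lambda>s. dd (\<lambda>z. m z c d) (?X s) v) has_vector_derivative
      m x (dd (\<lambda>y. \<Gamma> y v c) x w + \<Gamma> x w (\<Gamma> x v c)) d + m x (\<Gamma> x v c) (\<Gamma> x w d)
       + (m x (\<Gamma> x w c) (\<Gamma> x v d) + m x c (dd (\<lambda>y. \<Gamma> y v d) x w + \<Gamma> x w (\<Gamma> x v d)))) (at 0)"
    proof (rule has_vector_derivative_cong_nhds[rotated])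
      show "\<forall>\<^sub>F s in nhds 0. m (?X s) (\<Gamma> (?X s) v c) d + m (?X s) c (\<Gamma> (?X s) v d) = dd (\<lambda>z. m z c d) (?X s) v"
        using eventually_in_open[of U ?X, OF U X line_derivative] by eventually_elim (simp add: dd_m)
    qed
    have "(\<lambda>y. dd (\<lambda>z. m z c d) y v) differentiable (at (?X 0))"
      using smooth_on_imp_differentiable[OF smooth_on_dd] m X unfolding fam2_def by blast
    from dd_vector_derivative[OF this line_derivative] 1
    show ?thesis using vector_derivative_unique_at by fastforce
  qed
  have "dd (\<lambda>y. dd (\<lambda>z. m z c d) y a) x b = dd (\<lambda>y. dd (\<lambda>z. m z c d) y b) x a"
    using dd_commute[OF U assms] m unfolding fam2_def by blast
  then show ?thesis unfolding * R_def using assms by (simp add: m_simps)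
qed

text \<open>The octahedron argument: the four Bianchi identities for the cyclic rotations of
  \<open>a\<close>, \<open>b\<close>, \<open>c\<close>, \<open>d\<close>, combined with the two
  antisymmetries, are left to linear arithmetic.\<close>

lemma R_pair:
  assumes "x \<in> U"
  shows "m x (R x a b c) d = m x (R x c d a) b"
proof -
  define r where "r = (\<lambda>a b c d. m x (R x a b c) d)"
  have 1: "r a b c d = - r b a c d" for a b c d
    unfolding r_def by (subst R_antisym) (simp add: m_simps assms)
  have 2: "r a b c d = - r a b d c" for a b c d
    unfolding r_def using R_skew[OF assms] m_sym[OF assms] by metis
  have 3: "r a b c d + r b c a d + r c a b d = 0" for a b c d
    using arg_cong[OF R_bianchi[OF assms, of a b c], of "\<lambda>v. m x v d"]
    unfolding r_def by (simp add: m_simps assms)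
  have "r a b c d = r c d a b"
    using 3[of a b c d] 3[of b c d a] 3[of c d a b] 3[of d a b c]
      1[of a b c d] 1[of b c a d] 1[of c a b d] 1[of c d b a] 1[of d b c a] 1[of a c d b] 1[of b d a c]
      2[of a b c d] 2[of b c a d] 2[of c a b d] 2[of c d b a] 2[of d b c a] 2[of a c d b] 2[of b d a c]
      1[of c d a b] 1[of d a c b] 1[of a b d c] 2[of c d a b] 2[of d a c b] 2[of a b d c] 1[of d a b c] 2[of d a b c]
    by linarith
  then show ?thesis by (simp add: r_def)
qed

end


subsection \<open>Pullbacks and isometries\<close>

lemma dd_line:
  "f differentiable (at x) \<Longrightarrow> ((\<lambda>s. f (x + s *\<^sub>R v)) has_vector_derivative dd f x v) (at 0)"
  using has_real_derivative_along[of f x 0 v] by simp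

lemma fam1_dd_map:
  "smooth_on W S \<Longrightarrow> fam1 W (\<lambda>x. frechet_derivative S (at x))" for S :: "'x::euclidean_space \<Rightarrow> 'z::real_normed_vector"
  by (auto simp: fam1_def dd_linear smooth_on_dd)

text \<open>Two kinds of maps are meant: the inclusion of the unit sphere bundle into a natural
  chart, where the dimensions differ, and, through \<open>local_isometry\<close>, coordinate changes
  and local symmetries.\<close>

locale pullback =
  fixes Z :: "'z::euclidean_space set" and G :: "'z \<Rightarrow> 'z \<Rightarrow> 'z \<Rightarrow> real"
    and Y :: "'y::euclidean_space set" and h :: "'y \<Rightarrow> 'y \<Rightarrow> 'y \<Rightarrow> real"
    and \<Phi> :: "'y \<Rightarrow> 'z"
  assumes Z: "open Z" and G: "fam2 Z G" and Y: "open Y"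
    and \<Phi>: "smooth_on Y \<Phi>" and \<Phi>_in: "y \<in> Y \<Longrightarrow> \<Phi> y \<in> Z"
    and h: "y \<in> Y \<Longrightarrow> h y a b = G (\<Phi> y) (dd \<Phi> y a) (dd \<Phi> y b)"
begin

abbreviation hess :: "'y \<Rightarrow> 'y \<Rightarrow> 'y \<Rightarrow> 'z" where
  "hess x a b \<equiv> dd (\<lambda>y. dd \<Phi> y b) x a"

lemma hess_sym: "y \<in> Y \<Longrightarrow> hess y a b = hess y b a"
  by (rule dd_commute[OF Y _ \<Phi>])

lemma \<Phi>_line: "y \<in> Y \<Longrightarrow> ((\<lambda>s. \<Phi> (y + s *\<^sub>R v)) has_vector_derivative dd \<Phi> y v) (at 0)"
  by (rule dd_line) (rule smooth_on_imp_differentiable[OF \<Phi>])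

lemma dd\<Phi>_line: "y \<in> Y \<Longrightarrow> ((\<lambda>s. dd \<Phi> (y + s *\<^sub>R v) a) has_vector_derivative hess y v a) (at 0)"
  by (rule dd_line) (rule smooth_on_imp_differentiable[OF smooth_on_dd[OF \<Phi>]])

lemma eventually_line: "y \<in> Y \<Longrightarrow> \<forall>\<^sub>F s in nhds 0. y + s *\<^sub>R v \<in> Y"
  using eventually_in_open[OF Y, of "\<lambda>s. y + s *\<^sub>R v" 0] has_vector_derivative_add[OF has_vector_derivative_const
     has_vector_derivative_scaleR[OF DERIV_ident has_vector_derivative_const], of y v 0 UNIV] by simp

lemma h_fam: "fam2 Y h"
proof -
  have "fam2 Y (\<lambda>y. G (\<Phi> y))"
    by (rule fam2_compose[OF G Y Z _ \<Phi>]) (use \<Phi>_in in auto)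
  from fam2_smooth[OF Y this smooth_on_dd[OF \<Phi>] smooth_on_dd[OF \<Phi>]]
  have "smooth_on Y (\<lambda>y. G (\<Phi> y) (dd \<Phi> y a) (dd \<Phi> y b))" for a b .
  then have "smooth_on Y (\<lambda>y. h y a b)" for a b
    by (rule smooth_on_cong[OF Y, THEN iffD1, rotated]) (simp add: h)
  moreover have "bilinear (h y)" if y: "y \<in> Y" for y
  proof -
    have bil: "bilinear (G (\<Phi> y))" using G \<Phi>_in[OF y] by (simp add: fam2_def)
    have lin: "linear (frechet_derivative \<Phi> (at y))" by (rule dd_linear[OF \<Phi> y])
    show ?thesis
      unfolding bilinear_iff
      by (auto intro!: linearI simp: h y linear_add[OF lin] linear_scale[OF lin]
          bilinear_ladd[OF bil] bilinear_radd[OF bil] bilinear_lmul[OF bil] bilinear_rmul[OF bil])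
  qed
  ultimately show ?thesis by (simp add: fam2_def)
qed

lemma dd_h:
  assumes y: "y \<in> Y"
  shows "dd (\<lambda>y. h y a b) y c = dd (\<lambda>z. G z (dd \<Phi> y a) (dd \<Phi> y b)) (\<Phi> y) (dd \<Phi> y c)
    + G (\<Phi> y) (hess y c a) (dd \<Phi> y b) + G (\<Phi> y) (dd \<Phi> y a) (hess y c b)"
proof -
  have "((\<lambda>s. h (y + s *\<^sub>R c) a b) has_vector_derivative dd (\<lambda>y. h y a b) y c) (at 0)"
    using h_fam y smooth_on_imp_differentiable unfolding fam2_def by (intro dd_line) blast
  moreover have "((\<lambda>s. G (\<Phi> (y + s *\<^sub>R c)) (dd \<Phi> (y + s *\<^sub>R c) a) (dd \<Phi> (y + s *\<^sub>R c) b)) has_vector_derivative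
    dd (\<lambda>z. G z (dd \<Phi> y a) (dd \<Phi> y b)) (\<Phi> y) (dd \<Phi> y c)
    + G (\<Phi> y) (hess y c a) (dd \<Phi> y b) + G (\<Phi> y) (dd \<Phi> y a) (hess y c b)) (at 0)"
    using fam2_vector_derivative[OF Z G _ \<Phi>_line[OF y] dd\<Phi>_line[OF y] dd\<Phi>_line[OF y], of c c a c b] \<Phi>_in[OF y] by simp
  then have "((\<lambda>s. h (y + s *\<^sub>R c) a b) has_vector_derivative
    dd (\<lambda>z. G z (dd \<Phi> y a) (dd \<Phi> y b)) (\<Phi> y) (dd \<Phi> y c)
    + G (\<Phi> y) (hess y c a) (dd \<Phi> y b) + G (\<Phi> y) (dd \<Phi> y a) (hess y c b)) (at 0)"
    by (rule has_vector_derivative_cong_nhds[rotated])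
      (use eventually_line[OF y, of c] in eventually_elim, simp add: h)
  ultimately show ?thesis by (rule vector_derivative_unique_at)
qed

lemma local_metric_h:
  assumes "local_metric Z G" "\<And>y. y \<in> Y \<Longrightarrow> inj (frechet_derivative \<Phi> (at y))"
  shows "local_metric Y h"
proof -
  interpret local_metric Z G by fact
  show ?thesis
  proof
    show "h y a b = h y b a" if "y \<in> Y" for y a b
      using m_sym[OF \<Phi>_in[OF that]] by (simp add: h that)
    show "h y a a > 0" if "y \<in> Y" "a \<noteq> 0" for y a
      using m_pos[OF \<Phi>_in[OF that(1)]] assms(2)[OF that(1)] dd_linear[OF \<Phi> that(1)] that
      by (auto simp: h linear_injective_0)
  qed (use Y h_fam in auto)
qed

text \<open>The geodesic equation of the pullback metric says that the first variation of the energy in \<open>Z\<close>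
  vanishes in all directions \<open>dd \<Phi> (y t) w\<close> tangent to the image of \<open>\<Phi>\<close>.\<close>
lemma geodesic_first_variation:
  assumes "local_metric Y h" and G_sym: "\<And>z a b. z \<in> Z \<Longrightarrow> G z a b = G z b a"
    and yt: "y t \<in> Y" and y: "(y has_vector_derivative y1 t) (at t)" and y1: "(y1 has_vector_derivative y2) (at t)"
    and geo: "y2 + christoffel h (y t) (y1 t) (y1 t) = 0"
    and D: "((\<lambda>s. G (\<Phi> (y s)) (dd \<Phi> (y s) (y1 s)) (dd \<Phi> (y t) w)) has_real_derivative D) (at t)"
    and E: "((\<lambda>\<epsilon>. G (\<Phi> (y t) + \<epsilon> *\<^sub>R dd \<Phi> (y t) w) (dd \<Phi> (y t) (y1 t)) (dd \<Phi> (y t) (y1 t))) has_real_derivative E) (at 0)"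
  shows "2 * D = E"
proof -
  interpret H: local_metric Y h by fact
  let ?z = "\<Phi> (y t)" and ?D = "frechet_derivative \<Phi> (at (y t))" and ?p = "y1 t"
  have z: "?z \<in> Z" by (rule \<Phi>_in[OF yt])
  have bil: "bilinear (G ?z)" using G z by (simp add: fam2_def)
  have z1: "((\<lambda>s. \<Phi> (y s)) has_vector_derivative ?D ?p) (at t)"
    by (rule dd_vector_derivative[OF smooth_on_imp_differentiable[OF \<Phi> yt] y])
  have z2: "((\<lambda>s. dd \<Phi> (y s) (y1 s)) has_vector_derivative hess (y t) ?p ?p + ?D y2) (at t)"
    by (rule fam1_vector_derivative[OF Y fam1_dd_map[OF \<Phi>] yt y y1])
  have "((\<lambda>s. G (\<Phi> (y s)) (dd \<Phi> (y s) (y1 s)) (?D w)) has_vector_derivative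
      dd (\<lambda>z. G z (?D ?p) (?D w)) ?z (?D ?p) + G ?z (hess (y t) ?p ?p + ?D y2) (?D w) + G ?z (?D ?p) 0) (at t)"
    by (rule fam2_vector_derivative[OF Z G z z1 z2 has_vector_derivative_const])
  then have 1: "D = dd (\<lambda>z. G z (?D ?p) (?D w)) ?z (?D ?p) + G ?z (hess (y t) ?p ?p) (?D w) + h (y t) y2 w"
    using D vector_derivative_unique_at unfolding has_real_derivative_iff_has_vector_derivative
    by (fastforce simp: bilinear_ladd[OF bil] bilinear_rzero[OF bil] h yt)
  have "(\<lambda>z. G z (?D ?p) (?D ?p)) differentiable (at ?z)"
    using G z smooth_on_imp_differentiable unfolding fam2_def by blast
  from dd_line[OF this] have 2: "E = dd (\<lambda>z. G z (?D ?p) (?D ?p)) ?z (?D w)"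
    using E vector_derivative_unique_at unfolding has_real_derivative_iff_has_vector_derivative by blast
  have "y2 = - christoffel h (y t) ?p ?p" using geo by (simp add: eq_neg_iff_add_eq_0)
  \<comment> \<open>The Koszul identity for two equal arguments replaces the Christoffel symbol by
    derivatives of \<open>h\<close>. Then \<open>dd_h\<close> moves these to \<open>Z\<close>, where
    the Hessians of \<Phi> cancel by symmetry of second derivatives.\<close>
  then have "2 * h (y t) y2 w = dd (\<lambda>x. h x ?p ?p) (y t) w - 2 * dd (\<lambda>x. h x ?p w) (y t) ?p"
    using H.koszul[OF yt, of ?p ?p w] by (simp add: H.m_simps yt)
  then show ?thesis
    using dd_h[OF yt, of ?p w ?p] dd_h[OF yt, of ?p ?p w] G_sym[OF z, of "?D ?p" "hess (y t) ?p w"]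
      arg_cong[OF hess_sym[OF yt, of w ?p], of "\<lambda>v. G ?z v (?D ?p)"]
      arg_cong[OF hess_sym[OF yt, of w ?p], of "\<lambda>v. G ?z (?D ?p) v"] unfolding 1 2
    by (simp add: algebra_simps)
qed

end

locale local_isometry =
  M: local_metric U m + M': local_metric U' m' + pullback U' m' W m S
  for U :: "'e::euclidean_space set" and m and U' :: "'e set" and m' and W S +
  assumes W_sub: "W \<subseteq> U"
begin

text \<open>An isometric differential is injective, hence surjective between spaces of equal
  dimension. So every test vector in the target is the image of one in the source.\<close>

lemma surj_dd: "x \<in> W \<Longrightarrow> surj (frechet_derivative S (at x))"
proof -
  assume x: "x \<in> W"
  have "a = 0" if "dd S x a = 0" for a
  proof (rule ccontr)
    assume "a \<noteq> 0"
    then have "m x a a > 0" using M.m_pos W_sub x by blast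
    then show False using h[OF x, of a a] that M'.m_simps(9)[OF \<Phi>_in[OF x]] by simp
  qed
  then show ?thesis
    using dd_linear[OF \<Phi> x] linear_injective_0 linear_injective_imp_surjective by blast
qed

text \<open>Tested against \<open>dd S x w\<close>, both sides become Koszul expressions. By
  \<open>dd_h\<close> the derivatives of \<open>m\<close> contain six Hessian terms; four cancel in
  pairs, and the remaining two are equal and give \<open>hess x a b\<close>.\<close>

lemma christoffel_transform:
  assumes x: "x \<in> W"
  shows "M'.\<Gamma> (S x) (dd S x a) (dd S x b) = dd S x (M.\<Gamma> x a b) - hess x a b"
proof (rule M'.m_eqI[OF \<Phi>_in[OF x]])
  fix w'
  obtain w where w: "w' = dd S x w" using surjD[OF surj_dd[OF x]] by blast
  have xU: "x \<in> U" using x W_sub by blast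
  have Sx: "S x \<in> U'" by (rule \<Phi>_in[OF x])
  note e = dd_h[OF x, of b w a] dd_h[OF x, of a w b] dd_h[OF x, of a b w]
    arg_cong[OF hess_sym[OF x, of b a], of "\<lambda>v. m' (S x) v (dd S x w)"]
    arg_cong[OF hess_sym[OF x, of w a], of "\<lambda>v. m' (S x) v (dd S x b)"]
    arg_cong[OF hess_sym[OF x, of w b], of "\<lambda>v. m' (S x) (dd S x a) v"]
  have "2 * m' (S x) (M'.\<Gamma> (S x) (dd S x a) (dd S x b)) (dd S x w)
    = 2 * m x (M.\<Gamma> x a b) w - 2 * m' (S x) (hess x a b) (dd S x w)"
    using e M'.m_sym[OF Sx, of "hess x a w" "dd S x b"] M.koszul[OF xU, of a b w]
      M'.koszul[OF Sx, of "dd S x a" "dd S x b" "dd S x w"] by (simp add: field_simps)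
  then show "m' (S x) (M'.\<Gamma> (S x) (dd S x a) (dd S x b)) w' = m' (S x) (dd S x (M.\<Gamma> x a b) - hess x a b) w'"
    by (simp add: w M'.m_simps[OF Sx] h[OF x])
qed

text \<open>Differentiating \<open>dd S (X s)\<close> produces a Hessian, which is exactly the
  defect in \<open>christoffel_transform\<close>. So covariant differentiation is natural under
  isometries.\<close>

lemma covd_transform:
  assumes "X t \<in> W" "(X has_vector_derivative X') (at t)" "M.covd X X' A t N"
  shows "M'.covd (\<lambda>s. S (X s)) (dd S (X t) X') (\<lambda>s. dd S (X s) (A s)) t (dd S (X t) N)"
proof (rule M'.covdI)
  show "((\<lambda>s. dd S (X s) (A s)) has_vector_derivative
    hess (X t) X' (A t) + dd S (X t) (N - M.\<Gamma> (X t) X' (A t))) (at t)"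
    by (rule fam1_vector_derivative[OF Y fam1_dd_map[OF \<Phi>] assms(1,2) assms(3)[unfolded M.covd_def]])
qed (simp add: christoffel_transform[OF assms(1)] linear_diff[OF dd_linear[OF \<Phi> assms(1)]])

text \<open>Comes from differentiating \<open>christoffel_transform\<close> in the direction
  \<open>a\<close>. Third derivatives of \<open>S\<close> appear, but by their symmetry they drop
  out of the antisymmetric combination that defines \<open>R\<close>.\<close>

lemma curvature_transform:
  assumes x: "x \<in> W"
  shows "M'.R (S x) (dd S x a) (dd S x b) (dd S x c) = dd S x (M.R x a b c)"
proof -
  have xU: "x \<in> U" using x W_sub by blast
  have Sx: "S x \<in> U'" by (rule \<Phi>_in[OF x])
  note lin = dd_linear[OF \<Phi> x]
  have *: "dd (\<lambda>y. M'.\<Gamma> y (dd S x b) (dd S x c)) (S x) (dd S x a)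
      + M'.\<Gamma> (S x) (hess x a b) (dd S x c) + M'.\<Gamma> (S x) (dd S x b) (hess x a c)
      = hess x a (M.\<Gamma> x b c) + dd S x (dd (\<lambda>y. M.\<Gamma> y b c) x a) - dd (\<lambda>y. hess y b c) x a" for a b
  proof -
    have l: "((\<lambda>s. M'.\<Gamma> (S (x + s *\<^sub>R a)) (dd S (x + s *\<^sub>R a) b) (dd S (x + s *\<^sub>R a) c)) has_vector_derivative
      dd (\<lambda>y. M'.\<Gamma> y (dd S x b) (dd S x c)) (S x) (dd S x a)
      + M'.\<Gamma> (S x) (hess x a b) (dd S x c) + M'.\<Gamma> (S x) (dd S x b) (hess x a c)) (at 0)"
      using fam2_vector_derivative[OF Z M'.\<Gamma>_fam _ \<Phi>_line[OF x] dd\<Phi>_line[OF x] dd\<Phi>_line[OF x], of a a b a c] Sx by simp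
    have "((\<lambda>s. M.\<Gamma> (x + s *\<^sub>R a) b c) has_vector_derivative dd (\<lambda>y. M.\<Gamma> y b c) x a) (at 0)"
      using M.\<Gamma>_fam xU smooth_on_imp_differentiable unfolding fam2_def by (intro dd_line) blast
    then have "((\<lambda>s. dd S (x + s *\<^sub>R a) (M.\<Gamma> (x + s *\<^sub>R a) b c)) has_vector_derivative
        hess x a (M.\<Gamma> x b c) + dd S x (dd (\<lambda>y. M.\<Gamma> y b c) x a)) (at 0)"
      using fam1_vector_derivative[OF Y fam1_dd_map[OF \<Phi>], of "\<lambda>s. x + s *\<^sub>R a" 0 a, OF _ M.line_derivative] x
      by fastforce
    moreover have "((\<lambda>s. hess (x + s *\<^sub>R a) b c) has_vector_derivative dd (\<lambda>y. hess y b c) x a) (at 0)"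
      by (rule dd_line) (rule smooth_on_imp_differentiable[OF smooth_on_dd[OF smooth_on_dd[OF \<Phi>]] x])
    ultimately have "((\<lambda>s. dd S (x + s *\<^sub>R a) (M.\<Gamma> (x + s *\<^sub>R a) b c) - hess (x + s *\<^sub>R a) b c) has_vector_derivative
        hess x a (M.\<Gamma> x b c) + dd S x (dd (\<lambda>y. M.\<Gamma> y b c) x a) - dd (\<lambda>y. hess y b c) x a) (at 0)"
      by (rule has_vector_derivative_diff)
    then have "((\<lambda>s. M'.\<Gamma> (S (x + s *\<^sub>R a)) (dd S (x + s *\<^sub>R a) b) (dd S (x + s *\<^sub>R a) c)) has_vector_derivative
        hess x a (M.\<Gamma> x b c) + dd S x (dd (\<lambda>y. M.\<Gamma> y b c) x a) - dd (\<lambda>y. hess y b c) x a) (at 0)"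
      by (rule has_vector_derivative_cong_nhds[rotated])
        (use eventually_line[OF x, of a] in eventually_elim, simp add: christoffel_transform)
    with l show ?thesis by (rule vector_derivative_unique_at)
  qed
  have third: "dd (\<lambda>y. hess y b c) x a = dd (\<lambda>y. hess y a c) x b"
    by (rule dd_commute[OF Y x smooth_on_dd[OF \<Phi>]])
  have dG: "dd (\<lambda>y. M'.\<Gamma> y (dd S x b) (dd S x c)) (S x) (dd S x a)
      = hess x a (M.\<Gamma> x b c) + dd S x (dd (\<lambda>y. M.\<Gamma> y b c) x a) - dd (\<lambda>y. hess y b c) x a
        - M'.\<Gamma> (S x) (hess x a b) (dd S x c) - M'.\<Gamma> (S x) (dd S x b) (hess x a c)" for a b
    using *[of b a] by (simp add: algebra_simps)
  show ?thesis
    unfolding M'.R_def M.R_def dG christoffel_transform[OF x] M'.\<Gamma>_simps[OF Sx]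
    using third hess_sym[OF x, of a b]
    by (simp add: christoffel_transform[OF x] linear_diff[OF lin] linear_add[OF lin])
qed

end


subsection \<open>Locally symmetric Hermitian metrics on open sets\<close>

context local_metric
begin

lemma R_vector_derivative:
  assumes "X t \<in> U" "(X has_vector_derivative X') (at t)" "(A has_vector_derivative A') (at t)"
    "(B has_vector_derivative B') (at t)" "(C has_vector_derivative C') (at t)"
  shows "((\<lambda>s. R (X s) (A s) (B s) (C s)) has_vector_derivative
    dd (\<lambda>y. R y (A t) (B t) (C t)) (X t) X' + R (X t) A' (B t) (C t) + R (X t) (A t) B' (C t)
      + R (X t) (A t) (B t) C') (at t)"
proof (rule linear_family_vector_derivative[OF _ _ assms(5)])
  show "\<forall>\<^sub>F s in nhds t. linear (R (X s) (A s) (B s))"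
    using eventually_in_open[OF U assms(1,2)] by eventually_elim (rule R_linear)
  show "((\<lambda>s. R (X s) (A s) (B s) c) has_vector_derivative
    dd (\<lambda>y. R y (A t) (B t) c) (X t) X' + R (X t) A' (B t) c + R (X t) (A t) B' c) (at t)" for c
    by (rule fam2_vector_derivative[OF U R_fam assms(1-4)])
qed

end

text \<open>The symmetry at \<open>x\<close> may leave the chart; therefore it has a domain
  \<open>W\<close> of its own, which \<open>S\<close> maps into \<open>U\<close>.\<close>

locale local_hermitian = local_metric U m for U :: "'e::euclidean_space set" and m +
  fixes J :: "'e \<Rightarrow> 'e \<Rightarrow> 'e"
  assumes J: "fam1 U J" and J_J: "x \<in> U \<Longrightarrow> J x (J x a) = - a"
    and J_m: "x \<in> U \<Longrightarrow> m x (J x a) (J x b) = m x a b"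
    and symm: "x \<in> U \<Longrightarrow> \<exists>W S. local_isometry U m U m W S \<and> x \<in> W \<and> S x = x \<and> (\<forall>a. dd S x a = - a) \<and>
      (\<forall>y\<in>W. \<forall>a. dd S y (J y a) = J (S y) (dd S y a))"
begin

lemma J_linear: "x \<in> U \<Longrightarrow> linear (J x)"
  using J by (simp add: fam1_def)

lemma J_simps:
  assumes "x \<in> U"
  shows "J x (a + b) = J x a + J x b" "J x (a - b) = J x a - J x b" "J x (- a) = - J x a"
    "J x (r *\<^sub>R a) = r *\<^sub>R J x a" "J x 0 = 0"
  using linear_add[OF J_linear[OF assms]] linear_diff[OF J_linear[OF assms]] linear_neg[OF J_linear[OF assms]]
    linear_scale[OF J_linear[OF assms]] linear_0[OF J_linear[OF assms]] by auto

lemma J_skew: "x \<in> U \<Longrightarrow> m x (J x a) b = - m x a (J x b)"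
  using J_m[of x a "J x b"] by (simp add: J_J m_simps)

text \<open>A tensor of odd order that is invariant under the local symmetry at \<open>x\<close> vanishes at \<open>x\<close>; this
  is applied to \<open>\<nabla>J\<close> and to \<open>\<nabla>R\<close>.\<close>
lemma dd_J:
  assumes x: "x \<in> U"
  shows "dd (\<lambda>y. J y a) x d = J x (\<Gamma> x d a) - \<Gamma> x d (J x a)"
proof -
  obtain W S where "local_isometry U m U m W S" and W: "x \<in> W" and S: "S x = x" "\<And>a. dd S x a = - a"
    and hol: "\<forall>y\<in>W. \<forall>a. dd S y (J y a) = J (S y) (dd S y a)" using symm[OF x] by blast
  then interpret I: local_isometry U m U m W S by simp
  \<comment> \<open>At a fixed point with differential - id the transformation law of the
    Christoffel symbols reads \<Gamma> = - \<Gamma> - hess.\<close>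
  have H: "I.hess x a b = - 2 *\<^sub>R \<Gamma> x a b" for a b
    using I.christoffel_transform[OF W, of a b] by (simp add: S \<Gamma>_simps x scaleR_2 algebra_simps)
  have lin: "linear (\<lambda>a. dd (\<lambda>y. J y a) x d)" "linear (\<lambda>v. dd (\<lambda>y. J y a) x v)" for a d
    using linear_dd_family[OF U J x] J x dd_linear unfolding fam1_def by blast+
  have dJ: "((\<lambda>s. J (x + s *\<^sub>R d) a) has_vector_derivative dd (\<lambda>y. J y a) x d) (at 0)"
    using J x smooth_on_imp_differentiable unfolding fam1_def by (intro dd_line) blast
  have "((\<lambda>s. dd S (x + s *\<^sub>R d) (J (x + s *\<^sub>R d) a)) has_vector_derivative
      I.hess x d (J x a) + dd S x (dd (\<lambda>y. J y a) x d)) (at 0)"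
    using fam1_vector_derivative[OF I.Y fam1_dd_map[OF I.\<Phi>], of "\<lambda>s. x + s *\<^sub>R d" 0 d,
        OF _ line_derivative dJ] W by simp
  then have "((\<lambda>s. J (S (x + s *\<^sub>R d)) (dd S (x + s *\<^sub>R d) a)) has_vector_derivative
      I.hess x d (J x a) + dd S x (dd (\<lambda>y. J y a) x d)) (at 0)"
    by (rule has_vector_derivative_cong_nhds[rotated])
      (use I.eventually_line[OF W, of d] in eventually_elim, simp add: hol)
  moreover have "((\<lambda>s. J (S (x + s *\<^sub>R d)) (dd S (x + s *\<^sub>R d) a)) has_vector_derivative
      dd (\<lambda>y. J y (dd S x a)) (S x) (dd S x d) + J (S x) (I.hess x d a)) (at 0)"
    using fam1_vector_derivative[OF U J _ I.\<Phi>_line[OF W] I.dd\<Phi>_line[OF W], of d d a] S x by simp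
  ultimately have "I.hess x d (J x a) + dd S x (dd (\<lambda>y. J y a) x d)
    = dd (\<lambda>y. J y (dd S x a)) (S x) (dd S x d) + J (S x) (I.hess x d a)"
    by (rule vector_derivative_unique_at)
  \<comment> \<open>The outer differential contributes one sign, argument and direction together
    contribute two. So the derivative of \<open>J\<close> stands with opposite signs on the two
    sides and doubles.\<close>
  then have "2 *\<^sub>R dd (\<lambda>y. J y a) x d = 2 *\<^sub>R (J x (\<Gamma> x d a) - \<Gamma> x d (J x a))"
    by (simp add: S H J_simps x linear_neg[OF lin(1)] linear_neg[OF lin(2)] scaleR_2 algebra_simps)
  then show ?thesis by simp
qed

lemma dd_R:
  assumes x: "x \<in> U"
  shows "dd (\<lambda>y. R y a b c) x d = R x (\<Gamma> x d a) b c + R x a (\<Gamma> x d b) c + R x a b (\<Gamma> x d c)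
    - \<Gamma> x d (R x a b c)"
proof -
  obtain W S where "local_isometry U m U m W S" and W: "x \<in> W" and S: "S x = x" "\<And>a. dd S x a = - a"
    using symm[OF x] by blast
  then interpret I: local_isometry U m U m W S by simp
  have H: "I.hess x a b = - 2 *\<^sub>R \<Gamma> x a b" for a b
    using I.christoffel_transform[OF W, of a b] by (simp add: S \<Gamma>_simps x scaleR_2 algebra_simps)
  have Rs: "smooth_on U (\<lambda>y. R y a b c)" using R_fam unfolding fam2_def by blast
  have dR: "((\<lambda>s. R (x + s *\<^sub>R d) a b c) has_vector_derivative dd (\<lambda>y. R y a b c) x d) (at 0)"
    by (rule dd_line) (rule smooth_on_imp_differentiable[OF Rs x])
  \<comment> \<open>Three arguments and the direction change sign, which is no sign in total, while
    the outer \<open>dd S x\<close> contributes one: the parity that makes \<nabla>R vanish.\<close>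
  have "dd (\<lambda>y. R y (- a) (- b) (- c)) x (- d) = dd (\<lambda>y. - R y a b c) x (- d)"
    by (rule fun_cong[OF dd_cong_open[OF U x]]) (simp add: R_simps)
  also have "\<dots> = - dd (\<lambda>y. R y a b c) x (- d)"
    using has_derivative_minus[OF smooth_on_has_derivative[OF Rs x]] by (rule dd_eqI)
  also have "\<dots> = dd (\<lambda>y. R y a b c) x d" using linear_neg[OF dd_linear[OF Rs x]] by simp
  finally have neg: "dd (\<lambda>y. R y (- a) (- b) (- c)) x (- d) = dd (\<lambda>y. R y a b c) x d" .
  have "((\<lambda>s. dd S (x + s *\<^sub>R d) (R (x + s *\<^sub>R d) a b c)) has_vector_derivative
      I.hess x d (R x a b c) + dd S x (dd (\<lambda>y. R y a b c) x d)) (at 0)"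
    using fam1_vector_derivative[OF I.Y fam1_dd_map[OF I.\<Phi>], of "\<lambda>s. x + s *\<^sub>R d" 0 d,
        OF _ line_derivative dR] W by simp
  then have "((\<lambda>s. R (S (x + s *\<^sub>R d)) (dd S (x + s *\<^sub>R d) a) (dd S (x + s *\<^sub>R d) b) (dd S (x + s *\<^sub>R d) c))
      has_vector_derivative I.hess x d (R x a b c) + dd S x (dd (\<lambda>y. R y a b c) x d)) (at 0)"
    by (rule has_vector_derivative_cong_nhds[rotated])
      (use I.eventually_line[OF W, of d] in eventually_elim, simp add: I.curvature_transform)
  moreover have "((\<lambda>s. R (S (x + s *\<^sub>R d)) (dd S (x + s *\<^sub>R d) a) (dd S (x + s *\<^sub>R d) b) (dd S (x + s *\<^sub>R d) c))
      has_vector_derivative dd (\<lambda>y. R y (- a) (- b) (- c)) x (- d) + R x (I.hess x d a) (- b) (- c)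
        + R x (- a) (I.hess x d b) (- c) + R x (- a) (- b) (I.hess x d c)) (at 0)"
    using R_vector_derivative[OF _ I.\<Phi>_line[OF W] I.dd\<Phi>_line[OF W] I.dd\<Phi>_line[OF W] I.dd\<Phi>_line[OF W], of d d a d b d c]
      S x by simp
  ultimately have "I.hess x d (R x a b c) + dd S x (dd (\<lambda>y. R y a b c) x d) =
     dd (\<lambda>y. R y (- a) (- b) (- c)) x (- d) + R x (I.hess x d a) (- b) (- c)
        + R x (- a) (I.hess x d b) (- c) + R x (- a) (- b) (I.hess x d c)"
    by (rule vector_derivative_unique_at)
  then have "2 *\<^sub>R dd (\<lambda>y. R y a b c) x d = 2 *\<^sub>R (R x (\<Gamma> x d a) b c + R x a (\<Gamma> x d b) c + R x a b (\<Gamma> x d c)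
    - \<Gamma> x d (R x a b c))"
    unfolding neg H S by (simp add: R_simps x scaleR_2 algebra_simps)
  then show ?thesis by simp
qed

lemma covd_J:
  assumes "X t \<in> U" "(X has_vector_derivative X') (at t)" "covd X X' A t N"
  shows "covd X X' (\<lambda>s. J (X s) (A s)) t (J (X t) N)"
  by (rule covdI[OF fam1_vector_derivative[OF U J assms(1,2) assms(3)[unfolded covd_def]]])
    (simp add: dd_J assms(1) J_simps)

lemma covd_R:
  assumes "X t \<in> U" "(X has_vector_derivative X') (at t)" "covd X X' A t A'" "covd X X' B t B'" "covd X X' C t C'"
  shows "covd X X' (\<lambda>s. R (X s) (A s) (B s) (C s)) t
    (R (X t) A' (B t) (C t) + R (X t) (A t) B' (C t) + R (X t) (A t) (B t) C')"
  by (rule covdI[OF R_vector_derivative[OF assms(1,2) assms(3-5)[unfolded covd_def]]])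
    (simp add: dd_R assms(1) R_simps)

text \<open>The Ricci identity for the parallel endomorphism \<open>J\<close>: the second
  derivatives of \<open>J z c\<close>, expanded twice by \<open>dd_J\<close>, commute, and their
  difference is the commutator of \<open>J\<close> with the curvature.\<close>

lemma R_J:
  assumes x: "x \<in> U"
  shows "R x a b (J x c) = J x (R x a b c)"
proof -
  have *: "dd (\<lambda>y. dd (\<lambda>z. J z c) y v) x w =
     J x (dd (\<lambda>y. \<Gamma> y v c) x w + \<Gamma> x w (\<Gamma> x v c)) - \<Gamma> x w (J x (\<Gamma> x v c))
     - (dd (\<lambda>y. \<Gamma> y v (J x c)) x w + \<Gamma> x v (J x (\<Gamma> x w c) - \<Gamma> x w (J x c)))" for v w
  proof -
    let ?X = "\<lambda>s. x + s *\<^sub>R w"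
    have X: "?X 0 \<in> U" using x by simp
    have cJ: "covd ?X w (\<lambda>s. J (?X s) c) 0 (J x (\<Gamma> x w c))"
      using covd_J[OF X line_derivative covd_const, of c] by simp
    have "covd ?X w (\<lambda>s. \<Gamma> (?X s) v c) 0 (dd (\<lambda>y. \<Gamma> y v c) x w + \<Gamma> x w (\<Gamma> x v c))"
      using covd_\<Gamma>[of ?X, OF X line_derivative has_vector_derivative_const has_vector_derivative_const, of v c]
      by (simp add: \<Gamma>_simps x)
    from covd_J[OF X line_derivative this]
    have 1: "((\<lambda>s. J (?X s) (\<Gamma> (?X s) v c)) has_vector_derivative
        J x (dd (\<lambda>y. \<Gamma> y v c) x w + \<Gamma> x w (\<Gamma> x v c)) - \<Gamma> x w (J x (\<Gamma> x v c))) (at 0)"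
      by (simp add: covd_def)
    have "((\<lambda>s. J (?X s) c) has_vector_derivative J x (\<Gamma> x w c) - \<Gamma> x w (J x c)) (at 0)"
      using cJ by (simp add: covd_def)
    from fam2_vector_derivative[of U \<Gamma> ?X, OF U \<Gamma>_fam X line_derivative has_vector_derivative_const this, of v]
    have 2: "((\<lambda>s. \<Gamma> (?X s) v (J (?X s) c)) has_vector_derivative
        dd (\<lambda>y. \<Gamma> y v (J x c)) x w + \<Gamma> x v (J x (\<Gamma> x w c) - \<Gamma> x w (J x c))) (at 0)"
      by (simp add: \<Gamma>_simps(9) x)
    have 3: "((\<lambda>s. dd (\<lambda>z. J z c) (?X s) v) has_vector_derivative
       J x (dd (\<lambda>y. \<Gamma> y v c) x w + \<Gamma> x w (\<Gamma> x v c)) - \<Gamma> x w (J x (\<Gamma> x v c))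
     - (dd (\<lambda>y. \<Gamma> y v (J x c)) x w + \<Gamma> x v (J x (\<Gamma> x w c) - \<Gamma> x w (J x c)))) (at 0)"
    proof (rule has_vector_derivative_cong_nhds[OF _ has_vector_derivative_diff[OF 1 2]])
      show "\<forall>\<^sub>F s in nhds 0. J (?X s) (\<Gamma> (?X s) v c) - \<Gamma> (?X s) v (J (?X s) c) = dd (\<lambda>z. J z c) (?X s) v"
        using eventually_in_open[of U ?X, OF U X line_derivative] by eventually_elim (simp add: dd_J)
    qed
    have "(\<lambda>y. dd (\<lambda>z. J z c) y v) differentiable (at x)"
      using smooth_on_imp_differentiable[OF smooth_on_dd] J x unfolding fam1_def by blast
    from dd_line[OF this] 3 show ?thesis by (rule vector_derivative_unique_at)
  qed
  have "dd (\<lambda>y. dd (\<lambda>z. J z c) y a) x b = dd (\<lambda>y. dd (\<lambda>z. J z c) y b) x a"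
    using dd_commute[OF U x] J unfolding fam1_def by blast
  then show ?thesis unfolding * R_def using x by (simp add: J_simps \<Gamma>_simps algebra_simps)
qed

text \<open>Pair symmetry moves \<open>J x a\<close> into the slot on which the curvature operator
  acts. There it commutes past the operator by \<open>R_J\<close>, and skewness of \<open>J\<close>
  transfers it to \<open>b\<close> with a sign.\<close>

lemma R_JJ:
  assumes x: "x \<in> U"
  shows "R x (J x a) b c = - R x a (J x b) c"
proof (rule m_eqI[OF x])
  fix d
  have "m x (R x (J x a) b c) d = m x (R x c d (J x a)) b" by (rule R_pair[OF x])
  also have "\<dots> = - m x (R x c d a) (J x b)" by (simp add: R_J x J_skew)
  also have "\<dots> = - m x (R x a (J x b) c) d" using R_pair[OF x, of a "J x b" c d] by simp
  finally show "m x (R x (J x a) b c) d = m x (- R x a (J x b) c) d" by (simp add: m_simps x)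
qed

lemma R_self: "R x a a c = 0"
  using R_antisym[of x a a c] by (simp add: eq_neg_iff_add_eq_0 flip: scaleR_2)

text \<open>\<open>Up\<close> is differentiated as a whole, so \<open>r\<close> is used only at
  \<open>t\<close>. The two unwanted terms add up to r (R(V, J \<xi>) - R(\<xi>, J V)), and by
  \<open>R_JJ\<close> and antisymmetry R(\<xi>, J V) = - R(J \<xi>, V) = R(V, J \<xi>).\<close>

lemma covd_curvature_operator:
  assumes Xt: "X t \<in> U" and X: "(X has_vector_derivative X') (at t)"
    and \<xi>: "covd X X' \<xi> t V" and Ut: "Up t = V + r *\<^sub>R J (X t) (\<xi> t)"
    and Up: "covd X X' Up t (l *\<^sub>R \<xi> t - r *\<^sub>R J (X t) V)"
    and A: "covd X X' A t N"
  shows "covd X X' (\<lambda>s. - R (X s) (\<xi> s) (Up s) (A s)) t (- R (X t) (\<xi> t) (Up t) N)"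
proof -
  have "R (X t) V (Up t) (A t) + R (X t) (\<xi> t) (l *\<^sub>R \<xi> t - r *\<^sub>R J (X t) V) (A t) = 0"
    using R_JJ[OF Xt, of "\<xi> t" V "A t"] R_antisym[of "X t" V "J (X t) (\<xi> t)" "A t"]
    by (simp add: Ut R_simps Xt R_self)
  then show ?thesis
    using covd_minus[OF Xt covd_R[OF Xt X \<xi> Up A]] by simp
qed

section \<open>The Berger metric and its Euler-Lagrange equations in natural coordinates\<close>

text \<open>The Berger metric in natural coordinates, \<open>vert z u\<close> being the vertical part of the tangent
  vector \<open>u\<close> at \<open>z = (x, \<xi>)\<close>.\<close>

definition vert :: "'e \<times> 'e \<Rightarrow> 'e \<times> 'e \<Rightarrow> 'e" where
  "vert z u = snd u + \<Gamma> (fst z) (snd z) (fst u)"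

definition berger :: "real \<Rightarrow> 'e \<times> 'e \<Rightarrow> 'e \<times> 'e \<Rightarrow> 'e \<times> 'e \<Rightarrow> real" where
  "berger \<delta> z u w = m (fst z) (fst u) (fst w) + m (fst z) (vert z u) (vert z w)
    + \<delta>\<^sup>2 * m (fst z) (vert z u) (J (fst z) (snd z)) * m (fst z) (vert z w) (J (fst z) (snd z))"

text \<open>\<open>EL\<close> is the geodesic equation tested against \<open>(b, \<beta>)\<close>.
  Its first premise says that the test vector is tangent to the unit sphere bundle: its vertical
  part \<eta> is orthogonal to \<xi>. Horizontal test vectors yield the equation of
  \<open>x\<close>, vertical ones that of \<open>Up\<close> up to a multiple of \<xi>, the Lagrange
  multiplier \<open>l\<close>.\<close>

lemma berger_euler_lagrange:
  fixes x \<xi> x1 \<xi>1 :: "real \<Rightarrow> 'e" and \<delta> :: real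
  defines "V \<equiv> \<lambda>s. vert (x s, \<xi> s) (x1 s, \<xi>1 s)"
  defines "\<mu> \<equiv> \<lambda>s. m (x s) (V s) (J (x s) (\<xi> s))"
  defines "Up \<equiv> \<lambda>s. V s + (\<delta>\<^sup>2 * \<mu> s) *\<^sub>R J (x s) (\<xi> s)"
  assumes xt: "x t \<in> U"
    and x: "(x has_vector_derivative x1 t) (at t)" and x1: "(x1 has_vector_derivative x2) (at t)"
    and \<xi>: "(\<xi> has_vector_derivative \<xi>1 t) (at t)" and \<xi>1: "(\<xi>1 has_vector_derivative \<xi>2) (at t)"
    and unit: "m (x t) (\<xi> t) (\<xi> t) = 1"
    and EL: "\<And>b \<beta> D E. m (x t) (vert (x t, \<xi> t) (b, \<beta>)) (\<xi> t) = 0 \<Longrightarrow>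
      ((\<lambda>s. berger \<delta> (x s, \<xi> s) (x1 s, \<xi>1 s) (b, \<beta>)) has_real_derivative D) (at t) \<Longrightarrow>
      ((\<lambda>\<epsilon>. berger \<delta> ((x t, \<xi> t) + \<epsilon> *\<^sub>R (b, \<beta>)) (x1 t, \<xi>1 t) (x1 t, \<xi>1 t)) has_real_derivative E) (at 0) \<Longrightarrow>
      2 * D = E"
  shows "covd x (x1 t) \<xi> t (V t)"
    and "covd x (x1 t) x1 t (- R (x t) (\<xi> t) (Up t) (x1 t))"
    and "\<exists>l. covd x (x1 t) Up t (l *\<^sub>R \<xi> t - (\<delta>\<^sup>2 * \<mu> t) *\<^sub>R J (x t) (V t))"
proof -
  let ?x = "x t" and ?\<xi> = "\<xi> t" and ?p = "x1 t" and ?q = "\<xi>1 t" and ?V = "V t" and ?J = "J (x t)" and ?\<mu> = "\<mu> t"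
  note [simp] = xt
  have Vt: "?V = ?q + \<Gamma> ?x ?\<xi> ?p" by (simp add: V_def vert_def)
  define P where "P = x2 + \<Gamma> ?x ?p ?p"
  have cx1: "covd x ?p x1 t P" by (rule covdI[OF x1]) (simp add: P_def)
  show c\<xi>: "covd x ?p \<xi> t ?V" by (rule covdI[OF \<xi>]) (simp add: Vt \<Gamma>_sym)
  define Vn where "Vn = \<xi>2 + dd (\<lambda>y. \<Gamma> y ?\<xi> ?p) ?x ?p + \<Gamma> ?x ?q ?p + \<Gamma> ?x ?\<xi> x2 + \<Gamma> ?x ?p ?V"
  have cV: "covd x ?p V t Vn"
    unfolding V_def vert_def fst_conv snd_conv
    by (rule covdI[OF has_vector_derivative_add[OF \<xi>1 fam2_vector_derivative[OF U \<Gamma>_fam xt x \<xi> x1]]])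
      (simp add: Vn_def Vt algebra_simps)
  have cJ\<xi>: "covd x ?p (\<lambda>s. J (x s) (\<xi> s)) t (?J ?V)" by (rule covd_J[OF xt x c\<xi>])
  define \<mu>' where "\<mu>' = m ?x Vn (?J ?\<xi>) + m ?x ?V (?J ?V)"
  have d\<mu>: "(\<mu> has_real_derivative \<mu>') (at t)"
    unfolding \<mu>_def \<mu>'_def by (rule covd_m[OF xt x cV cJ\<xi>])
  \<comment> \<open>Collects all that is paired with \<eta> in the first variation. Of the two
    copies of \<open>?\<mu>\<close> times \<open>?J ?V\<close>, one comes from differentiating J
    \<xi> in time and belongs to the derivative of \<open>Up\<close>; the other comes from varying
    \<xi> in J \<xi> and becomes the second term of the last claim.\<close>
  define Zt where "Zt = Vn + \<delta>\<^sup>2 *\<^sub>R (\<mu>' *\<^sub>R ?J ?\<xi> + (2 * ?\<mu>) *\<^sub>R ?J ?V)"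
  have key: "m ?x P b + m ?x (R ?x ?p b ?\<xi>) (Up t) + m ?x Zt \<eta> = 0"
    if \<eta>: "\<eta> = \<beta> + \<Gamma> ?x ?\<xi> b" "m ?x \<eta> ?\<xi> = 0" for b \<beta> \<eta>
  proof -
    define \<eta>n where "\<eta>n = dd (\<lambda>y. \<Gamma> y ?\<xi> b) ?x ?p + \<Gamma> ?x ?q b + \<Gamma> ?x ?p \<eta>"
    have c\<eta>: "covd x ?p (\<lambda>s. vert (x s, \<xi> s) (b, \<beta>)) t \<eta>n"
      unfolding vert_def fst_conv snd_conv
      by (rule covdI[OF has_vector_derivative_add[OF has_vector_derivative_const
            fam2_vector_derivative[OF U \<Gamma>_fam xt x \<xi> has_vector_derivative_const]]])
        (simp add: \<eta>n_def \<eta>(1) \<Gamma>_simps algebra_simps)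
    have \<eta>v: "vert (?x, ?\<xi>) (b, \<beta>) = \<eta>" by (simp add: vert_def \<eta>(1))
    define D where "D = (m ?x P b + m ?x ?p (\<Gamma> ?x ?p b)) + (m ?x Vn \<eta> + m ?x ?V \<eta>n)
      + ((\<delta>\<^sup>2 * \<mu>') * m ?x \<eta> (?J ?\<xi>) + (m ?x \<eta>n (?J ?\<xi>) + m ?x \<eta> (?J ?V)) * (\<delta>\<^sup>2 * ?\<mu>))"
    have "((\<lambda>s. m (x s) (x1 s) b + m (x s) (V s) (vert (x s, \<xi> s) (b, \<beta>))
        + (\<delta>\<^sup>2 * \<mu> s) * m (x s) (vert (x s, \<xi> s) (b, \<beta>)) (J (x s) (\<xi> s))) has_real_derivative D) (at t)"
      using DERIV_add[OF DERIV_add[OF covd_m[OF xt x cx1 covd_const[of x ?p b t]] covd_m[OF xt x cV c\<eta>]]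
          DERIV_mult[OF DERIV_cmult[OF d\<mu>, of "\<delta>\<^sup>2"] covd_m[OF xt x c\<eta> cJ\<xi>]]]
      by (simp only: D_def \<eta>v)
    then have D: "((\<lambda>s. berger \<delta> (x s, \<xi> s) (x1 s, \<xi>1 s) (b, \<beta>)) has_real_derivative D) (at t)"
      by (simp add: berger_def \<mu>_def V_def)
    \<comment> \<open>The variation freezes the velocity coordinates and moves the base point, so
      the vertical part \<open>?W\<close> changes although \<open>?p\<close> and \<open>?q\<close>
      do not.\<close>
    let ?X = "\<lambda>\<epsilon>. ?x + \<epsilon> *\<^sub>R b" and ?\<Xi> = "\<lambda>\<epsilon>. ?\<xi> + \<epsilon> *\<^sub>R \<beta>"
    let ?W = "\<lambda>\<epsilon>. vert (?X \<epsilon>, ?\<Xi> \<epsilon>) (?p, ?q)"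
    have X0: "?X 0 \<in> U" by simp
    define Ve where "Ve = dd (\<lambda>y. \<Gamma> y ?\<xi> ?p) ?x b + \<Gamma> ?x \<beta> ?p + \<Gamma> ?x b ?V"
    have cp: "covd ?X b (\<lambda>\<epsilon>. ?p) 0 (\<Gamma> ?x b ?p)" using covd_const[of ?X b ?p 0] by simp
    have c\<Xi>: "covd ?X b ?\<Xi> 0 \<eta>" by (rule covdI[OF line_derivative]) (simp add: \<eta>(1) \<Gamma>_sym)
    have cW: "covd ?X b ?W 0 Ve"
      unfolding vert_def fst_conv snd_conv
      by (rule covdI[OF has_vector_derivative_add[OF has_vector_derivative_const
            fam2_vector_derivative[OF U \<Gamma>_fam X0 line_derivative line_derivative has_vector_derivative_const]]])
        (simp add: Ve_def Vt \<Gamma>_simps algebra_simps)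
    have cJ\<Xi>: "covd ?X b (\<lambda>\<epsilon>. J (?X \<epsilon>) (?\<Xi> \<epsilon>)) 0 (?J \<eta>)"
      using covd_J[OF X0 line_derivative c\<Xi>] by simp
    have W0: "vert (?x, ?\<xi>) (?p, ?q) = ?V" by (simp add: V_def)
    define \<mu>e where "\<mu>e = m ?x Ve (?J ?\<xi>) + m ?x ?V (?J \<eta>)"
    define \<mu>\<epsilon> where "\<mu>\<epsilon> = (\<lambda>\<epsilon>. m (?X \<epsilon>) (?W \<epsilon>) (J (?X \<epsilon>) (?\<Xi> \<epsilon>)))"
    have \<mu>\<epsilon>0: "\<mu>\<epsilon> 0 = ?\<mu>" by (simp add: \<mu>\<epsilon>_def \<mu>_def V_def)
    have "(\<mu>\<epsilon> has_real_derivative m (?X 0) Ve (J (?X 0) (?\<Xi> 0)) + m (?X 0) (?W 0) (?J \<eta>)) (at 0)"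
      unfolding \<mu>\<epsilon>_def by (rule covd_m[OF X0 line_derivative cW cJ\<Xi>])
    then have \<mu>\<epsilon>: "(\<mu>\<epsilon> has_real_derivative \<mu>e) (at 0)" by (simp add: \<mu>e_def W0)
    define E where "E = (m ?x (\<Gamma> ?x b ?p) ?p + m ?x ?p (\<Gamma> ?x b ?p)) + (m ?x Ve ?V + m ?x ?V Ve)
      + ((\<delta>\<^sup>2 * \<mu>e) * ?\<mu> + \<mu>e * (\<delta>\<^sup>2 * ?\<mu>))"
    have "((\<lambda>\<epsilon>. m (?X \<epsilon>) ?p ?p + m (?X \<epsilon>) (?W \<epsilon>) (?W \<epsilon>) + (\<delta>\<^sup>2 * \<mu>\<epsilon> \<epsilon>) * \<mu>\<epsilon> \<epsilon>) has_real_derivative E) (at 0)"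
      using DERIV_add[OF DERIV_add[OF covd_m[OF X0 line_derivative cp cp] covd_m[OF X0 line_derivative cW cW]]
          DERIV_mult[OF DERIV_cmult[OF \<mu>\<epsilon>, of "\<delta>\<^sup>2"] \<mu>\<epsilon>]]
      by (simp add: E_def W0 \<mu>\<epsilon>0)
    then have E: "((\<lambda>\<epsilon>. berger \<delta> ((?x, ?\<xi>) + \<epsilon> *\<^sub>R (b, \<beta>)) (?p, ?q) (?p, ?q)) has_real_derivative E) (at 0)"
      by (simp add: berger_def \<mu>\<epsilon>_def)
    have DE: "2 * D = E" by (rule EL[OF _ D E]) (simp add: \<eta>v \<eta>(2))
    \<comment> \<open>Covariant derivatives of \<xi> in time and in the variation parameter commute
      up to curvature. This is where \<open>R\<close> enters the geodesic equation; the terms with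
      \<open>Ve\<close> then cancel between \<open>2 * D\<close> and \<open>E\<close>.\<close>
    have curv: "\<eta>n = Ve + R ?x ?p b ?\<xi>"
      unfolding \<eta>n_def Ve_def R_def \<eta>(1) Vt
      by (simp add: \<Gamma>_simps \<Gamma>_sym[of ?x ?\<xi>] dd\<Gamma>_sym[of ?x ?\<xi>] \<Gamma>_sym[of ?x \<beta> ?p] \<Gamma>_sym[of ?x ?q b])
    have "m ?x ?V (?J \<eta>) = - m ?x \<eta> (?J ?V)"
      using J_skew[OF xt, of ?V \<eta>] m_sym[OF xt, of "?J ?V" \<eta>] by simp
    moreover have "m ?x ?V (R ?x ?p b ?\<xi>) = m ?x (R ?x ?p b ?\<xi>) ?V" "m ?x ?V Ve = m ?x Ve ?V"
      "m ?x (\<Gamma> ?x b ?p) ?p = m ?x ?p (\<Gamma> ?x ?p b)"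
      "m ?x (?J ?\<xi>) \<eta> = m ?x \<eta> (?J ?\<xi>)" "m ?x (?J ?V) \<eta> = m ?x \<eta> (?J ?V)"
      "\<Gamma> ?x b ?p = \<Gamma> ?x ?p b"
      using m_sym[OF xt] \<Gamma>_sym[OF xt] by metis+
    ultimately show ?thesis
      using DE unfolding D_def E_def \<mu>e_def curv Zt_def Up_def
      by (simp add: m_simps algebra_simps)
  qed
  have "P = - R ?x ?\<xi> (Up t) ?p"
  proof (rule m_eqI[OF xt])
    fix b
    \<comment> \<open>The horizontal lift of \<open>b\<close> has vertical part 0, so it is
      admissible for every \<open>b\<close>.\<close>
    have "m ?x P b + m ?x (R ?x ?p b ?\<xi>) (Up t) + m ?x Zt 0 = 0"
      by (rule key[of _ "- \<Gamma> ?x ?\<xi> b"]) (simp_all add: m_simps)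
    then show "m ?x P b = m ?x (- R ?x ?\<xi> (Up t) ?p) b"
      using R_pair[OF xt, of ?p b ?\<xi> "Up t"] by (simp add: m_simps)
  qed
  then show "covd x ?p x1 t (- R ?x ?\<xi> (Up t) ?p)" using cx1 by simp
  \<comment> \<open>Vertical test vectors (\<open>b = 0\<close>) given by the projection of an
    arbitrary \<open>w\<close> orthogonal to the unit vector \<xi>: whatever is orthogonal to all of
    them is a multiple of \<xi>.\<close>
  have Zt: "Zt = m ?x Zt ?\<xi> *\<^sub>R ?\<xi>"
  proof (rule m_eqI[OF xt])
    fix w
    let ?\<eta> = "w - m ?x w ?\<xi> *\<^sub>R ?\<xi>"
    have "m ?x P 0 + m ?x (R ?x ?p 0 ?\<xi>) (Up t) + m ?x Zt ?\<eta> = 0"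
      by (rule key[of _ ?\<eta>]) (simp_all add: m_simps \<Gamma>_simps unit)
    moreover have "R ?x ?p 0 ?\<xi> = 0" using R_simps(11)[OF xt, of ?p 0 0] by simp
    ultimately show "m ?x Zt w = m ?x (m ?x Zt ?\<xi> *\<^sub>R ?\<xi>) w"
      using m_sym[OF xt, of w] by (simp add: m_simps)
  qed
  have "covd x ?p Up t (Vn + ((\<delta>\<^sup>2 * \<mu>') *\<^sub>R ?J ?\<xi> + (\<delta>\<^sup>2 * ?\<mu>) *\<^sub>R ?J ?V))"
    unfolding Up_def by (rule covd_add[OF xt cV covd_scaleR[OF xt DERIV_cmult[OF d\<mu>] cJ\<xi>]])
  also have "Vn + ((\<delta>\<^sup>2 * \<mu>') *\<^sub>R ?J ?\<xi> + (\<delta>\<^sup>2 * ?\<mu>) *\<^sub>R ?J ?V) = Zt - (\<delta>\<^sup>2 * ?\<mu>) *\<^sub>R ?J ?V"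
    by (simp add: Zt_def algebra_simps flip: scaleR_add_left)
  finally show "\<exists>l. covd x ?p Up t (l *\<^sub>R ?\<xi> - (\<delta>\<^sup>2 * ?\<mu>) *\<^sub>R ?J ?V)"
    using Zt by metis
qed

end


subsection \<open>Charts and tangent vectors\<close>

lemma cinv_cmap: "is_chart c \<Longrightarrow> q \<in> cdom c \<Longrightarrow> cinv c (cmap c q) = q"
  by (simp add: is_chart_def cinv_def)

lemma cinv_in: "x \<in> cimage c \<Longrightarrow> cinv c x \<in> cdom c"
  by (simp add: cimage_def cinv_def inv_into_into)

lemma cmap_cinv: "x \<in> cimage c \<Longrightarrow> cmap c (cinv c x) = x"
  by (simp add: cimage_def cinv_def f_inv_into_f)

lemma cmap_in: "q \<in> cdom c \<Longrightarrow> cmap c q \<in> cimage c"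
  by (simp add: cimage_def)

lemma chart_image_iff:
  assumes "is_chart c"
  shows "x \<in> cmap c ` (cdom c \<inter> D) \<longleftrightarrow> x \<in> cimage c \<and> cinv c x \<in> D"
  using cinv_cmap[OF assms] cmap_cinv[of x c] cinv_in[of x c] by (force simp: cimage_def)

text \<open>The factorisation is asked for on an open set only, because chart maps have arbitrary
  values outside their domains.\<close>

lemma dd_chain:
  assumes "open N" "x \<in> N" "\<And>y. y \<in> N \<Longrightarrow> h y = g (f y)"
    and "f differentiable (at x)" "g differentiable (at (f x))"
  shows "dd h x a = dd g (f x) (dd f x a)" "h differentiable (at x)"
proof -
  have "((\<lambda>y. g (f y)) has_derivative (\<lambda>a. dd g (f x) (dd f x a))) (at x)"
    by (rule has_derivative_compose[OF assms(4)[unfolded frechet_derivative_works]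
          assms(5)[unfolded frechet_derivative_works]])
  then have *: "(h has_derivative (\<lambda>a. dd g (f x) (dd f x a))) (at x)"
    by (rule has_derivative_transform_within_open[OF _ assms(1,2)]) (simp add: assms(3))
  show "dd h x a = dd g (f x) (dd f x a)" by (rule dd_eqI[OF *])
  show "h differentiable (at x)" using * unfolding differentiable_def by blast
qed

locale smooth_atlas =
  fixes A :: "('a, 'e::euclidean_space) chart set"
  assumes A: "smooth_manifold A"
begin

lemma chart: "c \<in> A \<Longrightarrow> is_chart c"
  using A unfolding smooth_manifold_def by blast

lemma open_cimage: "c \<in> A \<Longrightarrow> open (cimage c)"
  using chart by (simp add: is_chart_def)

lemma cinv_mcarrier: "c \<in> A \<Longrightarrow> x \<in> cimage c \<Longrightarrow> cinv c x \<in> mcarrier A"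
  using cinv_in by (fastforce simp: mcarrier_def)

abbreviation overlap :: "('a, 'e) chart \<Rightarrow> ('a, 'e) chart \<Rightarrow> 'e set" where
  "overlap c d \<equiv> cmap c ` (cdom c \<inter> cdom d)"

abbreviation trans :: "('a, 'e) chart \<Rightarrow> ('a, 'e) chart \<Rightarrow> 'e \<Rightarrow> 'e" where
  "trans c d \<equiv> cmap d \<circ> cinv c"

lemma transition: "c \<in> A \<Longrightarrow> d \<in> A \<Longrightarrow> smooth_transition c d"
  using A unfolding smooth_manifold_def compatible_def by blast

lemma overlap_open: "c \<in> A \<Longrightarrow> d \<in> A \<Longrightarrow> open (overlap c d)"
  using transition unfolding smooth_transition_def by blast

lemma trans_smooth: "c \<in> A \<Longrightarrow> d \<in> A \<Longrightarrow> smooth_on (overlap c d) (trans c d)"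
  using transition unfolding smooth_transition_def by blast

lemma overlap_subset: "overlap c d \<subseteq> cimage c"
  by (auto simp: cimage_def)

lemma trans_eq: "c \<in> A \<Longrightarrow> q \<in> cdom c \<Longrightarrow> trans c d (cmap c q) = cmap d q"
  by (simp add: cinv_cmap chart)

lemma trans_differentiable:
  "c \<in> A \<Longrightarrow> d \<in> A \<Longrightarrow> q \<in> cdom c \<Longrightarrow> q \<in> cdom d \<Longrightarrow> trans c d differentiable (at (cmap c q))"
  by (rule smooth_on_imp_differentiable[OF trans_smooth]) auto

lemma trans_linear:
  "c \<in> A \<Longrightarrow> d \<in> A \<Longrightarrow> q \<in> cdom c \<Longrightarrow> q \<in> cdom d \<Longrightarrow> linear (frechet_derivative (trans c d) (at (cmap c q)))"
  by (rule linear_frechet_derivative[OF trans_differentiable])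

lemma trans_chain:
  assumes "c \<in> A" "d \<in> A" "e \<in> A" "q \<in> cdom c" "q \<in> cdom d" "q \<in> cdom e"
  shows "dd (trans c e) (cmap c q) a = dd (trans d e) (cmap d q) (dd (trans c d) (cmap c q) a)"
proof -
  have "dd (trans c e) (cmap c q) a = dd (trans d e) (trans c d (cmap c q)) (dd (trans c d) (cmap c q) a)"
  proof (rule dd_chain(1))
    show "open (overlap c d \<inter> overlap c e)" using overlap_open assms by blast
    show "trans c e y = trans d e (trans c d y)" if "y \<in> overlap c d \<inter> overlap c e" for y
      using that chart_image_iff[OF chart[OF assms(1)], of y "cdom d"] cinv_cmap[OF chart[OF assms(2)], of "cinv c y"]
      by auto
  qed (use assms trans_differentiable trans_eq in \<open>auto simp del: o_apply\<close>)
  then show ?thesis using assms trans_eq by (simp del: o_apply)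
qed

lemma trans_self: "c \<in> A \<Longrightarrow> q \<in> cdom c \<Longrightarrow> dd (trans c c) (cmap c q) a = a"
proof -
  assume c: "c \<in> A" "q \<in> cdom c"
  have "frechet_derivative (trans c c) (at (cmap c q)) = frechet_derivative (\<lambda>x. x) (at (cmap c q))"
    by (rule dd_cong_open[OF open_cimage[OF c(1)] cmap_in[OF c(2)]]) (simp add: cmap_cinv)
  then show ?thesis by simp
qed

lemma tvec_self: "c \<in> A \<Longrightarrow> q \<in> cdom c \<Longrightarrow> tvec A c q a c = a"
  by (simp add: tvec_def trans_self)

lemma tangentI:
  assumes "\<And>c d. c \<in> A \<Longrightarrow> d \<in> A \<Longrightarrow> q \<in> cdom c \<Longrightarrow> q \<in> cdom d \<Longrightarrow> v d = dd (trans c d) (cmap c q) (v c)"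
    and "\<And>c. \<not> (c \<in> A \<and> q \<in> cdom c) \<Longrightarrow> v c = 0"
  shows "v \<in> tangent_space A q"
  using assms unfolding tangent_space_def by blast

lemma tvec_tangent: "c \<in> A \<Longrightarrow> q \<in> cdom c \<Longrightarrow> tvec A c q a \<in> tangent_space A q"
proof (rule tangentI)
  fix d e assume "c \<in> A" "q \<in> cdom c" "d \<in> A" "e \<in> A" "q \<in> cdom d" "q \<in> cdom e"
  then show "tvec A c q a e = dd (trans d e) (cmap d q) (tvec A c q a d)"
    using trans_chain[of c d e q a] by (simp add: tvec_def)
qed (auto simp: tvec_def)

lemma tangent_apply:
  "v \<in> tangent_space A q \<Longrightarrow> c \<in> A \<Longrightarrow> d \<in> A \<Longrightarrow> q \<in> cdom c \<Longrightarrow> q \<in> cdom d \<Longrightarrow>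
    v d = dd (trans c d) (cmap c q) (v c)"
  unfolding tangent_space_def by blast

lemma tangent_outside:
  "v \<in> tangent_space A q \<Longrightarrow> \<not> (c \<in> A \<and> q \<in> cdom c) \<Longrightarrow> v c = 0"
  unfolding tangent_space_def by blast

lemma tvec_tangent_eq:
  "v \<in> tangent_space A q \<Longrightarrow> c \<in> A \<Longrightarrow> q \<in> cdom c \<Longrightarrow> tvec A c q (v c) = v"
  unfolding tvec_def using tangent_apply[of v q c] tangent_outside[of v q] by (intro ext) (metis (full_types))

lemma tvec_change:
  "c \<in> A \<Longrightarrow> d \<in> A \<Longrightarrow> q \<in> cdom c \<Longrightarrow> q \<in> cdom d \<Longrightarrow>
    tvec A d q (dd (trans c d) (cmap c q) a) = tvec A c q a"
  using tvec_tangent_eq[OF tvec_tangent, of c q d a] by (simp add: tvec_def)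

lemma tangent_comb:
  assumes "v \<in> tangent_space A q" "w \<in> tangent_space A q"
  shows "(\<lambda>c. r *\<^sub>R v c + s *\<^sub>R w c) \<in> tangent_space A q"
proof (rule tangentI)
  fix c d assume cd: "c \<in> A" "d \<in> A" "q \<in> cdom c" "q \<in> cdom d"
  note lin = trans_linear[OF cd]
  show "r *\<^sub>R v d + s *\<^sub>R w d = dd (trans c d) (cmap c q) (r *\<^sub>R v c + s *\<^sub>R w c)"
    by (simp only: linear_add[OF lin] linear_scale[OF lin] tangent_apply[OF assms(1) cd] tangent_apply[OF assms(2) cd])
qed (simp add: tangent_outside[OF assms(1)] tangent_outside[OF assms(2)])

lemma velocity_tangent:
  assumes "\<gamma> t \<in> mcarrier A" and "\<And>c. c \<in> A \<Longrightarrow> \<gamma> t \<in> cdom c \<Longrightarrow> (cmap c \<circ> \<gamma>) differentiable (at t)"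
    and "\<And>c. c \<in> A \<Longrightarrow> \<gamma> t \<in> cdom c \<Longrightarrow> \<forall>\<^sub>F s in nhds t. \<gamma> s \<in> cdom c"
  shows "velocity A \<gamma> t \<in> tangent_space A (\<gamma> t)"
proof (rule tangentI)
  fix c d assume cd: "c \<in> A" "d \<in> A" "\<gamma> t \<in> cdom c" "\<gamma> t \<in> cdom d"
  have "((cmap c \<circ> \<gamma>) has_vector_derivative velocity A \<gamma> t c) (at t)"
    using assms(2) cd by (simp add: velocity_def vector_derivative_works)
  then have "((\<lambda>s. trans c d ((cmap c \<circ> \<gamma>) s)) has_vector_derivative dd (trans c d) (cmap c (\<gamma> t)) (velocity A \<gamma> t c)) (at t)"
    using dd_vector_derivative[of "trans c d" "cmap c \<circ> \<gamma>" t] trans_differentiable[OF cd] by simp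
  then have "((cmap d \<circ> \<gamma>) has_vector_derivative dd (trans c d) (cmap c (\<gamma> t)) (velocity A \<gamma> t c)) (at t)"
    by (rule has_vector_derivative_cong_nhds[rotated])
      (use assms(3)[OF cd(1,3)] in \<open>eventually_elim, simp add: cinv_cmap chart cd\<close>)
  then show "velocity A \<gamma> t d = dd (trans c d) (cmap c (\<gamma> t)) (velocity A \<gamma> t c)"
    using cd by (simp add: velocity_def vector_derivative_at)
qed (auto simp: velocity_def)

end

locale riemannian_atlas = smooth_atlas A for A :: "('a, 'e::euclidean_space) chart set" +
  fixes g :: "('a, 'e) metric_field"
  assumes g: "riemannian_metric A g"
begin

abbreviation "mloc \<equiv> metric_loc A g"

lemma local_metric_chart: "c \<in> A \<Longrightarrow> local_metric (cimage c) (mloc c)"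
  using g open_cimage by unfold_locales (auto simp: riemannian_metric_def fam2_def)

lemma metric_loc_eq:
  assumes "c \<in> A" "q \<in> cdom c" "v \<in> tangent_space A q" "w \<in> tangent_space A q"
  shows "mloc c (cmap c q) (v c) (w c) = g q v w"
  using assms by (simp add: metric_loc_def cinv_cmap chart tvec_tangent_eq)

text \<open>Both local metrics express the same \<open>g\<close>. It is used to compare covariant
  derivatives computed in two charts.\<close>

lemma trans_isometry:
  assumes "c \<in> A" "d \<in> A"
  shows "local_isometry (cimage c) (mloc c) (cimage d) (mloc d) (overlap c d) (trans c d)"
proof -
  interpret M: local_metric "cimage c" "mloc c" by (rule local_metric_chart[OF assms(1)])
  interpret M': local_metric "cimage d" "mloc d" by (rule local_metric_chart[OF assms(2)])
  show ?thesis
  proof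
    show "open (cimage d)" "fam2 (cimage d) (mloc d)" by (rule M'.U M'.m)+
    show "open (overlap c d)" "smooth_on (overlap c d) (trans c d)" "overlap c d \<subseteq> cimage c"
      using assms overlap_open trans_smooth overlap_subset by auto
    fix y assume y: "y \<in> overlap c d"
    then obtain q where q: "y = cmap c q" "q \<in> cdom c" "q \<in> cdom d" by auto
    show "trans c d y \<in> cimage d" using q assms trans_eq by (simp add: cmap_in)
    show "mloc c y a b = mloc d (trans c d y) (dd (trans c d) y a) (dd (trans c d) y b)" for a b
      using q assms by (simp add: metric_loc_def cinv_cmap chart tvec_change)
  qed
qed

end

lemma (in smooth_atlas) smooth_map_differentiable:
  assumes "smooth_map A A U s" "c \<in> A" "d \<in> A" "q \<in> U" "q \<in> cdom c" "s q \<in> cdom d"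
  shows "(cmap d \<circ> s \<circ> cinv c) differentiable (at (cmap c q))"
    and "open (cmap c ` (U \<inter> cdom c \<inter> s -` cdom d))"
proof -
  let ?W = "cmap c ` (U \<inter> cdom c \<inter> s -` cdom d)"
  have "open ?W" "smooth_on ?W (cmap d \<circ> s \<circ> cinv c)"
    using assms(1-3) by (auto simp: smooth_map_def Let_def)
  moreover have "cmap c q \<in> ?W" using assms by auto
  ultimately show "(cmap d \<circ> s \<circ> cinv c) differentiable (at (cmap c q))" "open ?W"
    by (blast intro: smooth_on_imp_differentiable)+
qed

text \<open>Eliminates the chart chosen by \<open>SOME\<close> in \<open>differential\<close>: the
  chain rule through \<open>c\<close> absorbs the change of components of \<open>v\<close>.\<close>

lemma (in smooth_atlas) differential_apply:
  assumes s: "smooth_map A A U s" and cd: "c \<in> A" "d \<in> A" and q: "q \<in> U" "q \<in> cdom c" "s q \<in> cdom d"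
    and v: "v \<in> tangent_space A q"
  shows "differential A A s q v d = dd (cmap d \<circ> s \<circ> cinv c) (cmap c q) (v c)"
proof -
  define c0 where "c0 = (SOME c. c \<in> A \<and> q \<in> cdom c)"
  have "c0 \<in> A \<and> q \<in> cdom c0" unfolding c0_def by (rule someI[of _ c]) (use cd q in simp)
  then have c0: "c0 \<in> A" "q \<in> cdom c0" by auto
  have "dd (cmap d \<circ> s \<circ> cinv c0) (cmap c0 q) (v c0)
      = dd (cmap d \<circ> s \<circ> cinv c) (trans c0 c (cmap c0 q)) (dd (trans c0 c) (cmap c0 q) (v c0))"
  proof (rule dd_chain(1))
    show "open (overlap c0 c)" by (rule overlap_open[OF c0(1) cd(1)])
    show "(cmap d \<circ> s \<circ> cinv c0) y = (cmap d \<circ> s \<circ> cinv c) (trans c0 c y)" if "y \<in> overlap c0 c" for y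
      using that chart_image_iff[OF chart[OF c0(1)], of y "cdom c"] cinv_cmap[OF chart[OF cd(1)], of "cinv c0 y"]
      by simp
  qed (use q c0 cd trans_differentiable trans_eq[OF c0] smooth_map_differentiable(1)[OF s cd q] in \<open>auto simp del: o_apply\<close>)
  then show ?thesis
    using cd q tangent_apply[OF v c0(1) cd(1) c0(2) q(2)] trans_eq[OF c0, of c]
    by (simp add: differential_def Let_def del: o_apply flip: c0_def)
qed

locale hermitian_atlas = riemannian_atlas A g for A :: "('a, 'e::euclidean_space) chart set" and g +
  fixes J :: "('a, 'e) endo_field"
  assumes J: "hermitian_locally_symmetric A g J"
begin

abbreviation "Jloc \<equiv> endo_loc A J"

lemma hermitian: "hermitian_manifold A g J"
  using J by (simp add: hermitian_locally_symmetric_def)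

lemma almost_complex: "almost_complex_structure A J"
  using hermitian by (simp add: hermitian_manifold_def complex_structure_def)

lemma J_tangent: "q \<in> mcarrier A \<Longrightarrow> v \<in> tangent_space A q \<Longrightarrow> J q v \<in> tangent_space A q"
  using almost_complex by (simp add: almost_complex_structure_def)

lemma endo_loc_eq:
  "c \<in> A \<Longrightarrow> q \<in> cdom c \<Longrightarrow> v \<in> tangent_space A q \<Longrightarrow> Jloc c (cmap c q) (v c) = J q v c"
  by (simp add: endo_loc_def cinv_cmap chart tvec_tangent_eq)

text \<open>Carries the symmetry of the manifold around \<open>cinv c x\<close> over to the single
  chart \<open>c\<close>, as \<open>local_hermitian\<close> requires.\<close>

lemma local_symmetry:
  assumes c: "c \<in> A" and x: "x \<in> cimage c"
  shows "\<exists>W S. local_isometry (cimage c) (mloc c) (cimage c) (mloc c) W S \<and> x \<in> W \<and> S x = x \<and>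
    (\<forall>a. dd S x a = - a) \<and> (\<forall>y\<in>W. \<forall>a. dd S y (Jloc c y a) = Jloc c (S y) (dd S y a))"
proof -
  interpret M: local_metric "cimage c" "mloc c" by (rule local_metric_chart[OF c])
  define p where "p = cinv c x"
  have p: "p \<in> cdom c" "p \<in> mcarrier A" "cmap c p = x"
    using cinv_in cinv_mcarrier cmap_cinv c x by (auto simp: p_def)
  obtain U s where Us: "p \<in> U" "smooth_map A A U s" "s p = p"
    and sym: "\<forall>v\<in>tangent_space A p. differential A A s p v = (\<lambda>c. - v c)"
    and inv: "\<forall>q\<in>U. \<forall>v\<in>tangent_space A q.
           differential A A s q (J q v) = J (s q) (differential A A s q v) \<and>
           (\<forall>w\<in>tangent_space A q. g (s q) (differential A A s q v) (differential A A s q w) = g q v w)"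
    using J p(2) unfolding hermitian_locally_symmetric_def by (smt (verit, ccfv_threshold))
  \<comment> \<open>Restricts to points that are in the chart together with their images, so that
    one chart serves as source and target.\<close>
  define W where "W = cmap c ` (U \<inter> cdom c \<inter> s -` cdom c)"
  define S where "S = cmap c \<circ> s \<circ> cinv c"
  have W: "open W" "smooth_on W S" using Us(2) c by (auto simp: smooth_map_def Let_def W_def S_def)
  have WD: "\<exists>q. y = cmap c q \<and> q \<in> U \<and> q \<in> cdom c \<and> s q \<in> cdom c \<and> S y = cmap c (s q)" if "y \<in> W" for y
    using that by (auto simp: W_def S_def cinv_cmap chart c)
  have D: "differential A A s q v c = dd S (cmap c q) (v c)"
    if "q \<in> U" "q \<in> cdom c" "s q \<in> cdom c" "v \<in> tangent_space A q" for q v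
    unfolding S_def by (rule differential_apply[OF Us(2) c c that])
  \<comment> \<open>\<open>metric_loc_eq\<close> and \<open>endo_loc_eq\<close> at
    \<open>s q\<close> ask for genuine tangent vectors, so the components of the differential in
    different charts must be matched by the chain rule.\<close>
  have T: "differential A A s q v \<in> tangent_space A (s q)"
    if q: "q \<in> U" "q \<in> cdom c" "s q \<in> cdom c" and v: "v \<in> tangent_space A q" for q v
  proof (rule tangentI)
    fix d e assume de: "d \<in> A" "e \<in> A" "s q \<in> cdom d" "s q \<in> cdom e"
    note diff = smooth_map_differentiable[OF Us(2) c _ q(1,2)]
    have sq: "(cmap d \<circ> s \<circ> cinv c) (cmap c q) = cmap d (s q)" for d using q by (simp add: cinv_cmap chart c)
    have "dd (cmap e \<circ> s \<circ> cinv c) (cmap c q) (v c)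
       = dd (trans d e) ((cmap d \<circ> s \<circ> cinv c) (cmap c q)) (dd (cmap d \<circ> s \<circ> cinv c) (cmap c q) (v c))"
    proof (rule dd_chain(1))
      show "open (cmap c ` (U \<inter> cdom c \<inter> s -` cdom d))" using diff(2) de by blast
      show "cmap c q \<in> cmap c ` (U \<inter> cdom c \<inter> s -` cdom d)" using q de by auto
      show "(cmap e \<circ> s \<circ> cinv c) y = trans d e ((cmap d \<circ> s \<circ> cinv c) y)"
        if "y \<in> cmap c ` (U \<inter> cdom c \<inter> s -` cdom d)" for y
        using that by (auto simp: cinv_cmap chart c de)
    qed (use diff(1) de trans_differentiable in \<open>auto simp: sq simp del: o_apply\<close>)
    then show "differential A A s q v e = dd (trans d e) (cmap d (s q)) (differential A A s q v d)"
      using differential_apply[OF Us(2) c _ q(1,2) _ v] de by (simp add: sq del: o_apply)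
  qed (auto simp: differential_def Let_def)
  have "local_isometry (cimage c) (mloc c) (cimage c) (mloc c) W S"
  proof
    show "open (cimage c)" "fam2 (cimage c) (mloc c)" by (rule M.U M.m)+
    show "open W" "smooth_on W S" by (rule W)+
    show "W \<subseteq> cimage c" by (auto simp: W_def cimage_def)
    fix y assume "y \<in> W"
    then obtain q where q: "y = cmap c q" "q \<in> U" "q \<in> cdom c" "s q \<in> cdom c" "S y = cmap c (s q)" using WD by blast
    show "S y \<in> cimage c" using q by (simp add: cmap_in)
    fix a b
    let ?v = "tvec A c q a" and ?w = "tvec A c q b"
    have vw: "?v \<in> tangent_space A q" "?w \<in> tangent_space A q" by (rule tvec_tangent[OF c q(3)])+
    have "mloc c y a b = g q ?v ?w" using metric_loc_eq[OF c q(3) vw] q c by (simp add: tvec_self)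
    also have "\<dots> = g (s q) (differential A A s q ?v) (differential A A s q ?w)" using inv q vw by simp
    also have "\<dots> = mloc c (S y) (differential A A s q ?v c) (differential A A s q ?w c)"
      using metric_loc_eq[OF c q(4) T T] q vw by simp
    finally show "mloc c y a b = mloc c (S y) (dd S y a) (dd S y b)"
      using D q vw c by (simp add: tvec_self)
  qed
  moreover have "x \<in> W" using p Us by (auto simp: W_def)
  moreover have "S x = x" using Us(3) by (simp add: S_def p(3) flip: p_def)
  moreover have "dd S x a = - a" for a
    using D[OF Us(1) p(1) _ tvec_tangent[OF c p(1)], of a] sym Us(3) p c tvec_tangent[OF c p(1), of a]
    by (simp add: tvec_self)
  moreover have "dd S y (Jloc c y a) = Jloc c (S y) (dd S y a)" if y: "y \<in> W" for y a
  proof -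
    obtain q where q: "y = cmap c q" "q \<in> U" "q \<in> cdom c" "s q \<in> cdom c" "S y = cmap c (s q)" using WD[OF y] by blast
    have qm: "q \<in> mcarrier A" using q c by (auto simp: mcarrier_def)
    let ?v = "tvec A c q a"
    have v: "?v \<in> tangent_space A q" by (rule tvec_tangent[OF c q(3)])
    have "Jloc c y a = J q ?v c" using endo_loc_eq[OF c q(3) v] q c by (simp add: tvec_self)
    then have "dd S y (Jloc c y a) = differential A A s q (J q ?v) c"
      using D[OF q(2,3,4) J_tangent[OF qm v]] q by simp
    also have "\<dots> = J (s q) (differential A A s q ?v) c" using inv q v by simp
    also have "\<dots> = Jloc c (S y) (differential A A s q ?v c)"
      using endo_loc_eq[OF c q(4) T] q v by simp
    finally show ?thesis using D q v c by (simp add: tvec_self)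
  qed
  ultimately show ?thesis by blast
qed

lemma local_hermitian_chart:
  assumes c: "c \<in> A"
  shows "local_hermitian (cimage c) (mloc c) (Jloc c)"
proof -
  interpret local_metric "cimage c" "mloc c" by (rule local_metric_chart[OF c])
  show ?thesis
  proof
    show "fam1 (cimage c) (Jloc c)"
      using almost_complex c by (simp add: almost_complex_structure_def fam1_def)
    fix x a b assume x: "x \<in> cimage c"
    define q where "q = cinv c x"
    have q: "q \<in> cdom c" "q \<in> mcarrier A" "x = cmap c q"
      unfolding q_def using cinv_in[OF x] cinv_mcarrier[OF c x] cmap_cinv[OF x] by auto
    have e: "Jloc c x a = J q (tvec A c q a) c" for a by (simp add: endo_loc_def q_def)
    have T: "tvec A c q a \<in> tangent_space A q" for a by (rule tvec_tangent[OF c q(1)])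
    have JT: "J q (tvec A c q a) \<in> tangent_space A q" for a by (rule J_tangent[OF q(2) T])
    have "Jloc c x (Jloc c x a) = J q (J q (tvec A c q a)) c"
      unfolding e by (simp add: tvec_tangent_eq[OF JT c q(1)])
    also have "\<dots> = - a"
      using almost_complex q T by (simp add: almost_complex_structure_def tvec_self c)
    finally show "Jloc c x (Jloc c x a) = - a" .
    have "mloc c x (Jloc c x a) (Jloc c x b) = g q (J q (tvec A c q a)) (J q (tvec A c q b))"
      unfolding e using metric_loc_eq[OF c q(1) JT JT] q(3) by simp
    also have "\<dots> = g q (tvec A c q a) (tvec A c q b)"
      using hermitian q T by (simp add: hermitian_manifold_def)
    finally show "mloc c x (Jloc c x a) (Jloc c x b) = mloc c x a b"
      by (simp add: metric_loc_def q_def)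
  qed (rule local_symmetry[OF c])
qed

end


subsection \<open>The tangent bundle\<close>

context smooth_atlas
begin

abbreviation nat_chart where "nat_chart c \<equiv> natural_chart A c"

lemma cdom_nat: "cdom (nat_chart c) = Sigma (cdom c) (tangent_space A)"
  by (simp add: natural_chart_def)

lemma cmap_nat: "cmap (nat_chart c) P = (cmap c (fst P), snd P c)"
  by (simp add: natural_chart_def split_beta)

lemma nat_atlas: "c \<in> A \<Longrightarrow> nat_chart c \<in> tangent_atlas A"
  by (simp add: tangent_atlas_def)

text \<open>A tangent vector is a function on all charts; membership in \<open>tangent_space\<close>
  makes its component in \<open>c\<close> determine it.\<close>

lemma inj_nat: "c \<in> A \<Longrightarrow> inj_on (cmap (nat_chart c)) (cdom (nat_chart c))"
proof (rule inj_onI)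
  fix P Q assume c: "c \<in> A" and PQ: "P \<in> cdom (nat_chart c)" "Q \<in> cdom (nat_chart c)"
    "cmap (nat_chart c) P = cmap (nat_chart c) Q"
  then have fst: "fst P = fst Q"
    using cinv_cmap[OF chart[OF c], of "fst P"] cinv_cmap[OF chart[OF c], of "fst Q"]
    by (auto simp: cdom_nat cmap_nat)
  have snd: "tvec A c (fst R) (snd R c) = snd R" if "R \<in> cdom (nat_chart c)" for R
    using that c by (intro tvec_tangent_eq) (auto simp: cdom_nat)
  have comp: "snd P c = snd Q c" using PQ(3) by (simp add: cmap_nat)
  have "snd P = tvec A c (fst P) (snd P c)" by (rule snd[OF PQ(1), symmetric])
  also have "\<dots> = tvec A c (fst Q) (snd Q c)" by (simp only: fst comp)
  also have "\<dots> = snd Q" by (rule snd[OF PQ(2)])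
  finally have "snd P = snd Q" .
  with fst show "P = Q" by (rule prod_eqI)
qed

lemma nat_cinv_cmap: "c \<in> A \<Longrightarrow> P \<in> cdom (nat_chart c) \<Longrightarrow> cinv (nat_chart c) (cmap (nat_chart c) P) = P"
  unfolding cinv_def by (rule inv_into_f_f[OF inj_nat])

lemma nat_point:
  assumes "c \<in> A" "x \<in> cimage c"
  shows "(cinv c x, tvec A c (cinv c x) \<alpha>) \<in> cdom (nat_chart c)"
    "cmap (nat_chart c) (cinv c x, tvec A c (cinv c x) \<alpha>) = (x, \<alpha>)"
  using assms cinv_in[OF assms(2)] cmap_cinv[OF assms(2)]
  by (simp_all add: cdom_nat cmap_nat tvec_tangent tvec_self)

lemma nat_cinv:
  "c \<in> A \<Longrightarrow> x \<in> cimage c \<Longrightarrow> cinv (nat_chart c) (x, \<alpha>) = (cinv c x, tvec A c (cinv c x) \<alpha>)"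
  using nat_cinv_cmap[OF _ nat_point(1)] nat_point(2) by metis

lemma cimage_nat: "c \<in> A \<Longrightarrow> cimage (nat_chart c) = cimage c \<times> UNIV"
proof
  assume c: "c \<in> A"
  show "cimage (nat_chart c) \<subseteq> cimage c \<times> UNIV"
    by (auto simp: cimage_def cdom_nat cmap_nat)
  show "cimage c \<times> UNIV \<subseteq> cimage (nat_chart c)"
  proof clarify
    fix x \<alpha> assume "x \<in> cimage c"
    from nat_point[OF c this, of \<alpha>] show "(x, \<alpha>) \<in> cimage (nat_chart c)"
      using cmap_in[of "(cinv c x, tvec A c (cinv c x) \<alpha>)" "nat_chart c"] by simp
  qed
qed

lemma open_cimage_nat: "c \<in> A \<Longrightarrow> open (cimage (nat_chart c))"
  by (simp add: cimage_nat open_cimage open_Times)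

lemma overlap_nat:
  assumes "c \<in> A" "d \<in> A"
  shows "cmap (nat_chart c) ` (cdom (nat_chart c) \<inter> cdom (nat_chart d)) = overlap c d \<times> UNIV"
proof
  show "cmap (nat_chart c) ` (cdom (nat_chart c) \<inter> cdom (nat_chart d)) \<subseteq> overlap c d \<times> UNIV"
    by (auto simp: cdom_nat cmap_nat)
  show "overlap c d \<times> UNIV \<subseteq> cmap (nat_chart c) ` (cdom (nat_chart c) \<inter> cdom (nat_chart d))"
  proof clarify
    fix q \<alpha> assume q: "q \<in> cdom c" "q \<in> cdom d"
    then show "(cmap c q, \<alpha>) \<in> cmap (nat_chart c) ` (cdom (nat_chart c) \<inter> cdom (nat_chart d))"
      using assms by (intro image_eqI[of _ _ "(q, tvec A c q \<alpha>)"])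
        (auto simp: cdom_nat cmap_nat tvec_self tvec_tangent)
  qed
qed

lemma nat_transition:
  assumes "c \<in> A" "d \<in> A" "z \<in> overlap c d \<times> UNIV"
  shows "(cmap (nat_chart d) \<circ> cinv (nat_chart c)) z = (trans c d (fst z), dd (trans c d) (fst z) (snd z))"
proof -
  obtain q \<alpha> where q: "z = (cmap c q, \<alpha>)" "q \<in> cdom c" "q \<in> cdom d" using assms(3) by auto
  then show ?thesis
    using assms(1,2) by (simp add: nat_cinv cmap_in cmap_nat cinv_cmap chart) (simp add: tvec_def)
qed

text \<open>The first component is smooth in the base point and the second is linear in the fibre
  with smooth coefficients. This makes it possible to change natural charts in
  \<open>differential_incl\<close>.\<close>

lemma nat_transition_differentiable:
  assumes cd: "c \<in> A" "d \<in> A" and z: "z \<in> overlap c d \<times> UNIV"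
  shows "(cmap (nat_chart d) \<circ> cinv (nat_chart c)) differentiable (at z)"
proof -
  let ?O = "overlap c d \<times> (UNIV :: 'e set)"
  have O: "open ?O" by (simp add: overlap_open cd open_Times)
  have fst: "smooth_on ?O fst" "fst ` ?O \<subseteq> overlap c d" and snd: "smooth_on ?O snd"
    using smooth_on_bounded_linear[OF O bounded_linear_fst smooth_on_ident[OF O]]
      smooth_on_bounded_linear[OF O bounded_linear_snd smooth_on_ident[OF O]] by auto
  note comp = smooth_on_compose[OF O overlap_open[OF cd] fst(2,1)]
  have "smooth_on ?O (\<lambda>z. trans c d (fst z))" by (rule comp[OF trans_smooth[OF cd]])
  moreover have "fam1 ?O (\<lambda>z. frechet_derivative (trans c d) (at (fst z)))"
    using comp[OF smooth_on_dd[OF trans_smooth[OF cd]]] dd_linear[OF trans_smooth[OF cd]]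
    by (auto simp: fam1_def)
  then have "smooth_on ?O (\<lambda>z. dd (trans c d) (fst z) (snd z))" by (rule fam1_smooth[OF O _ snd])
  ultimately have "(\<lambda>z. (trans c d (fst z), dd (trans c d) (fst z) (snd z))) differentiable (at z)"
    using z by (intro differentiable_Pair smooth_on_imp_differentiable)
  then show ?thesis
    by (rule differentiable_cong_open[OF O z, THEN iffD2, rotated]) (rule nat_transition[OF cd])
qed

end

locale berger_bundle = hermitian_atlas A g J
  for A :: "('a, 'e::euclidean_space) chart set" and g J +
  fixes \<delta> :: real and G :: "('a \<times> ('a, 'e) tangent, 'e \<times> 'e) metric_field"
  assumes G: "berger_metric A g J \<delta> G"
begin

abbreviation "T \<equiv> tangent_atlas A"

abbreviation "Gloc c \<equiv> metric_loc T G (nat_chart c)"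

lemma local_metric_nat: "c \<in> A \<Longrightarrow> local_metric (cimage (nat_chart c)) (Gloc c)"
  using G nat_atlas[of c] open_cimage_nat[of c] unfolding berger_metric_def riemannian_metric_def
  by unfold_locales (auto simp: fam2_def)

text \<open>\<open>berger_metric\<close> prescribes \<open>G\<close> on lifts only; bilinearity and
  symmetry determine the rest, since every vector is a sum of a horizontal and a vertical
  lift.\<close>

lemma metric_nat:
  assumes c: "c \<in> A" and z: "z \<in> cimage (nat_chart c)"
  shows "Gloc c z u w =
    local_hermitian.berger (mloc c) (Jloc c) \<delta> z u w"
proof -
  interpret local_hermitian "cimage c" "mloc c" "Jloc c" by (rule local_hermitian_chart[OF c])
  interpret N: local_metric "cimage (nat_chart c)" "Gloc c" by (rule local_metric_nat[OF c])
  obtain x \<alpha> where x: "z = (x, \<alpha>)" "x \<in> cimage c" using z cimage_nat[OF c] by auto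
  define q where "q = cinv c x"
  define \<xi> where "\<xi> = tvec A c q \<alpha>"
  have q: "q \<in> cdom c" "cmap c q = x" using cinv_in[OF x(2)] cmap_cinv[OF x(2)] by (auto simp: q_def)
  have Q: "cinv (nat_chart c) z = (q, \<xi>)" using nat_cinv[OF c x(2)] by (simp add: x q_def \<xi>_def)
  have \<xi>: "\<xi> \<in> tangent_space A q" "\<xi> c = \<alpha>" using tvec_tangent tvec_self c q by (auto simp: \<xi>_def)
  have X: "tvec A c q a \<in> tangent_space A q" "tvec A c q a c = a" for a using tvec_tangent tvec_self c q by auto
  have h: "tvec T (nat_chart c) (q, \<xi>) (a, - \<Gamma> x \<alpha> a) = hlift A g c (q, \<xi>) (tvec A c q a)" for a
    by (simp add: hlift_def X q \<xi>)
  have v: "tvec T (nat_chart c) (q, \<xi>) (0, a) = vlift A c (q, \<xi>) (tvec A c q a)" for a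
    by (simp add: vlift_def X)
  have B: "g q (tvec A c q a) (tvec A c q b) = mloc c x a b"
    "g q (tvec A c q a) (J q \<xi>) = mloc c x a (Jloc c x \<alpha>)" for a b
  proof -
    show "g q (tvec A c q a) (tvec A c q b) = mloc c x a b" by (simp add: metric_loc_def q_def)
    have "q \<in> mcarrier A" using q c by (auto simp: mcarrier_def)
    then show "g q (tvec A c q a) (J q \<xi>) = mloc c x a (Jloc c x \<alpha>)"
      using metric_loc_eq[OF c q(1) X(1) J_tangent[OF _ \<xi>(1)], of a] endo_loc_eq[OF c q(1) \<xi>(1)]
      by (simp add: X q \<xi>)
  qed
  have GG: "G (q, \<xi>) (hlift A g c (q, \<xi>) (tvec A c q a)) (hlift A g c (q, \<xi>) (tvec A c q b))
      = g q (tvec A c q a) (tvec A c q b)"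
    "G (q, \<xi>) (hlift A g c (q, \<xi>) (tvec A c q a)) (vlift A c (q, \<xi>) (tvec A c q b)) = 0"
    "G (q, \<xi>) (vlift A c (q, \<xi>) (tvec A c q a)) (vlift A c (q, \<xi>) (tvec A c q b)) = g q (tvec A c q a) (tvec A c q b)
      + \<delta>\<^sup>2 * g q (tvec A c q a) (J q \<xi>) * g q (tvec A c q b) (J q \<xi>)" for a b
    using G c q(1) \<xi>(1) X(1)[of a] X(1)[of b] unfolding berger_metric_def by blast+
  let ?M = "Gloc c z"
  have hh: "?M (a, - \<Gamma> x \<alpha> a) (b, - \<Gamma> x \<alpha> b) = mloc c x a b"
    and hv: "?M (a, - \<Gamma> x \<alpha> a) (0, b) = 0"
    and vv: "?M (0, a) (0, b) = mloc c x a b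
      + \<delta>\<^sup>2 * mloc c x a (Jloc c x \<alpha>) * mloc c x b (Jloc c x \<alpha>)" for a b
    unfolding metric_loc_def[of T G] Q h v GG B by (rule refl)+
  have vh: "?M (0, b) (a, - \<Gamma> x \<alpha> a) = 0" for a b using hv N.m_sym[OF z] by metis
  \<comment> \<open>The horizontal lift of \<open>fst u\<close> plus the vertical lift of
    \<open>vert z u\<close>.\<close>
  have split: "u = (fst u, - \<Gamma> x \<alpha> (fst u)) + (0, vert z u)" for u
    by (simp add: vert_def x prod_eq_iff)
  have "?M u w = ?M ((fst u, - \<Gamma> x \<alpha> (fst u)) + (0, vert z u)) ((fst w, - \<Gamma> x \<alpha> (fst w)) + (0, vert z w))"
    using split[of u] split[of w] by simp
  also have "\<dots> = berger \<delta> z u w"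
    unfolding N.m_simps[OF z] hh hv vh vv by (simp add: berger_def x)
  finally show ?thesis .
qed

end


subsection \<open>Submanifolds\<close>

text \<open>Takes the place of an inverse function theorem for immersions. A left inverse
  \<open>L\<close> of the differential of \<Phi> turns the derivative \<open>H\<close> of the
  composite into the candidate L H. The error of the expansion of \<Phi> at \<open>f x\<close>
  involves \<open>f y - f x\<close> itself; continuity of \<open>f\<close> makes it small enough to
  be absorbed.\<close>

lemma differentiable_lift:
  fixes f :: "'x::real_normed_vector \<Rightarrow> 'y::euclidean_space" and \<Phi> :: "'y \<Rightarrow> 'z::euclidean_space"
  assumes f: "isCont f x" and \<Phi>: "\<Phi> differentiable (at (f x))" and inj: "inj (frechet_derivative \<Phi> (at (f x)))"
    and comp: "(\<lambda>y. \<Phi> (f y)) differentiable (at x)"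
  shows "f differentiable (at x)"
proof -
  let ?D = "frechet_derivative \<Phi> (at (f x))"
  obtain H where H: "((\<lambda>y. \<Phi> (f y)) has_derivative H) (at x)" using comp by (auto simp: differentiable_def)
  have D: "(\<Phi> has_derivative ?D) (at (f x))" by (rule \<Phi>[unfolded frechet_derivative_works])
  obtain L where L: "linear L" "L \<circ> ?D = id"
    using linear_injective_left_inverse[OF linear_frechet_derivative[OF \<Phi>] inj] by blast
  have bL: "bounded_linear L" using L(1) by (simp add: linear_conv_bounded_linear)
  obtain K where K: "K > 0" "\<And>v. norm (L v) \<le> norm v * K" using bounded_linear.pos_bounded[OF bL] by blast
  have bLH: "bounded_linear (\<lambda>v. L (H v))"
    by (rule bounded_linear_compose[OF bL has_derivative_bounded_linear[OF H]])
  obtain M where M: "M > 0" "\<And>v. norm (L (H v)) \<le> norm v * M" using bounded_linear.pos_bounded[OF bLH] by blast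
  have "(f has_derivative (\<lambda>v. L (H v))) (at x)"
    unfolding has_derivative_at_alt
  proof (intro conjI bLH allI impI)
    fix e :: real assume e: "e > 0"
    \<comment> \<open>The first bound absorbs half of \<open>norm r\<close>, the second keeps
      \<open>K * \<epsilon> * M\<close> below \<open>e / 4\<close>. With the \<open>e / 4\<close>
      from \<open>d1\<close>, half of \<open>norm r\<close> is at most \<open>e / 2\<close> times
      \<open>norm (y - x)\<close>.\<close>
    define \<epsilon> where "\<epsilon> = min (1 / (2 * K)) (e / (4 * K * M))"
    have \<epsilon>: "\<epsilon> > 0" "K * \<epsilon> \<le> 1/2" "2 * (K * \<epsilon> * M) \<le> e / 2"
    proof -
      show "\<epsilon> > 0" using K(1) M(1) e by (simp add: \<epsilon>_def)
      have "K * \<epsilon> \<le> K * (1 / (2 * K))" using K(1) by (intro mult_left_mono) (auto simp: \<epsilon>_def)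
      then show "K * \<epsilon> \<le> 1/2" using K(1) by simp
      have "K * M * \<epsilon> \<le> K * M * (e / (4 * K * M))" using K(1) M(1) by (intro mult_left_mono) (auto simp: \<epsilon>_def)
      also have "\<dots> = e / 4" using K(1) M(1) by simp
      finally show "2 * (K * \<epsilon> * M) \<le> e / 2" by (simp add: mult_ac)
    qed
    have e4: "e / (4 * K) > 0" using e K(1) by simp
    obtain d1 where d1: "d1 > 0" "\<And>y. norm (y - x) < d1 \<Longrightarrow> norm (\<Phi> (f y) - \<Phi> (f x) - H (y - x)) \<le> e / (4 * K) * norm (y - x)"
      using H e4 unfolding has_derivative_at_alt by blast
    obtain d2 where d2: "d2 > 0" "\<And>w. norm (w - f x) < d2 \<Longrightarrow> norm (\<Phi> w - \<Phi> (f x) - ?D (w - f x)) \<le> \<epsilon> * norm (w - f x)"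
      using D \<epsilon>(1) unfolding has_derivative_at_alt by blast
    obtain d3 where d3: "d3 > 0" "\<And>y. dist y x < d3 \<Longrightarrow> dist (f y) (f x) < d2"
      using f d2(1) unfolding continuous_at_eps_delta by blast
    show "\<exists>d>0. \<forall>y. norm (y - x) < d \<longrightarrow> norm (f y - f x - L (H (y - x))) \<le> e * norm (y - x)"
    proof (intro exI[of _ "min d1 d3"] conjI allI impI)
      show "min d1 d3 > 0" using d1 d3 by simp
      fix y assume y: "norm (y - x) < min d1 d3"
      define r where "r = f y - f x - L (H (y - x))"
      define r1 where "r1 = \<Phi> (f y) - \<Phi> (f x) - H (y - x)"
      define r2 where "r2 = \<Phi> (f y) - \<Phi> (f x) - ?D (f y - f x)"
      have "L r1 - L r2 = L (?D (f y - f x)) - L (H (y - x))"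
        unfolding r1_def r2_def linear_diff[OF L(1)] by simp
      then have r: "r = L r1 - L r2" using L(2) by (simp add: r_def fun_eq_iff)
      have n1: "norm r1 \<le> e / (4 * K) * norm (y - x)" unfolding r1_def using d1(2) y by simp
      have "norm (f y - f x) < d2" using d3(2)[of y] y by (simp add: dist_norm)
      then have "norm r2 \<le> \<epsilon> * norm (f y - f x)" unfolding r2_def by (rule d2(2))
      also have "norm (f y - f x) \<le> norm r + norm (y - x) * M"
        using norm_triangle_ineq[of r "L (H (y - x))"] M(2)[of "y - x"] by (simp add: r_def)
      finally have n2: "norm r2 \<le> \<epsilon> * (norm r + norm (y - x) * M)" using \<epsilon>(1) by simp
      have "norm r \<le> norm r1 * K + norm r2 * K"
        using norm_triangle_ineq4[of "L r1" "L r2"] K(2)[of r1] K(2)[of r2] unfolding r by linarith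
      also have "\<dots> \<le> e / (4 * K) * norm (y - x) * K + \<epsilon> * (norm r + norm (y - x) * M) * K"
        using n1 n2 K(1) by (intro add_mono mult_right_mono) auto
      also have "\<dots> = e / 4 * norm (y - x) + (K * \<epsilon>) * norm r + (K * \<epsilon> * M) * norm (y - x)"
        using K(1) by (simp add: field_simps)
      also have "\<dots> \<le> e / 4 * norm (y - x) + 1/2 * norm r + e / 4 * norm (y - x)"
        using \<epsilon>(2,3) by (intro add_mono mult_right_mono) auto
      finally show "norm (f y - f x - L (H (y - x))) \<le> e * norm (y - x)" by (simp add: r_def)
    qed
  qed
  then show ?thesis by (auto simp: differentiable_def)
qed

section \<open>Charts of a submanifold given by immersions\<close>

context
  fixes T :: "('b, 'z::euclidean_space) chart set" and N :: "'b set"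
    and B :: "('b, 'f::euclidean_space) chart set"
  assumes B: "B = submanifold_atlas T N" and N: "N \<subseteq> mcarrier T"
    and inj_T: "\<forall>d\<in>T. inj_on (cmap d) (cdom d)"
begin

lemma submanifold_chart:
  assumes "c \<in> B"
  shows "is_chart c" "cdom c \<subseteq> N"
    "\<And>d. d \<in> T \<Longrightarrow> open (cmap c ` (cdom c \<inter> cdom d))"
    "\<And>d. d \<in> T \<Longrightarrow> smooth_on (cmap c ` (cdom c \<inter> cdom d)) (cmap d \<circ> cinv c)"
    "\<And>d x. d \<in> T \<Longrightarrow> x \<in> cmap c ` (cdom c \<inter> cdom d) \<Longrightarrow> inj (frechet_derivative (cmap d \<circ> cinv c) (at x))"
    "\<And>W. open W \<Longrightarrow> W \<subseteq> cimage c \<Longrightarrow> openin (subtopology (mtop T) N) (cinv c ` W)"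
  using assms unfolding B submanifold_atlas_def Let_def by blast+

text \<open>Continuity of \<open>cinv c\<close> into the ambient topology, by induction on how an
  open set is generated; for a generator it is the continuity of the coordinate expression of
  \<open>cinv c\<close>.\<close>

lemma submanifold_preimage_open:
  assumes c: "c \<in> B" and O: "openin (mtop T) O'"
  shows "open {x \<in> cimage c. cinv c x \<in> O'}"
proof -
  let ?S = "{cdom c \<inter> cmap c -` W | c W. c \<in> T \<and> open W}"
  have "generate_topology_on ?S O'" using O unfolding mtop_def by (rule openin_topology_generated_by)
  then show ?thesis
  proof induction
    case (Int a b)
    have "{x \<in> cimage c. cinv c x \<in> a \<inter> b} = {x \<in> cimage c. cinv c x \<in> a} \<inter> {x \<in> cimage c. cinv c x \<in> b}" by auto
    then show ?case using Int by (simp add: open_Int)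
  next
    case (UN K)
    have "{x \<in> cimage c. cinv c x \<in> \<Union>K} = (\<Union>k\<in>K. {x \<in> cimage c. cinv c x \<in> k})" by auto
    then show ?case using UN by auto
  next
    case (Basis s)
    then obtain d W where d: "s = cdom d \<inter> cmap d -` W" "d \<in> T" "open W" by blast
    let ?O = "cmap c ` (cdom c \<inter> cdom d)"
    have "open {x \<in> ?O. (cmap d \<circ> cinv c) x \<in> W}"
      using continuous_on_open_vimage[OF submanifold_chart(3)[OF c d(2)], of "cmap d \<circ> cinv c"]
        smooth_on_continuous[OF submanifold_chart(4)[OF c d(2)]] d(3)
      by (simp add: vimage_def Int_def conj_commute)
    also have "{x \<in> ?O. (cmap d \<circ> cinv c) x \<in> W} = {x \<in> cimage c. cinv c x \<in> s}"
      by (auto simp: chart_image_iff[OF submanifold_chart(1)[OF c]] d(1))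
    finally show ?case .
  qed simp
qed

text \<open>The openness clause of \<open>submanifold_atlas\<close>, applied to the whole image,
  makes \<open>cdom c0\<close> relatively open in \<open>N\<close>, and \<open>cinv c\<close> pulls
  it back to an open set.\<close>

lemma submanifold_overlap_open:
  assumes "c \<in> B" "c0 \<in> B"
  shows "open (cmap c ` (cdom c \<inter> cdom c0))"
proof -
  have "openin (subtopology (mtop T) N) (cinv c0 ` cimage c0)"
    using submanifold_chart(6)[OF assms(2), of "cimage c0"] submanifold_chart(1)[OF assms(2)] by (simp add: is_chart_def)
  also have "cinv c0 ` cimage c0 = cdom c0"
    using cinv_cmap[OF submanifold_chart(1)[OF assms(2)]] by (force simp: cimage_def)
  finally obtain O' where O: "openin (mtop T) O'" "cdom c0 = O' \<inter> N" by (auto simp: openin_subtopology)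
  have "cmap c ` (cdom c \<inter> cdom c0) = {x \<in> cimage c. cinv c x \<in> O'}"
    using submanifold_chart(2)[OF assms(1)] cinv_in[of _ c]
    by (auto simp: chart_image_iff[OF submanifold_chart(1)[OF assms(1)]] O(2) set_eq_iff)
  then show ?thesis using submanifold_preimage_open[OF assms(1) O(1)] by simp
qed

text \<open>Membership in \<open>submanifold_atlas\<close> is a condition on each chart alone, so
  compatibility has to be proved. The transition is continuous because \<open>cinv c0\<close> is
  open onto its image in \<open>N\<close> and \<open>cinv c\<close> is continuous;
  \<open>differentiable_lift\<close> for the immersion \<open>cmap d \<circ> cinv c0\<close> then
  makes it differentiable.\<close>

lemma submanifold_transition_differentiable:
  assumes c: "c \<in> B" and c0: "c0 \<in> B" and P: "P \<in> cdom c" "P \<in> cdom c0"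
  shows "(cmap c0 \<circ> cinv c) differentiable (at (cmap c P))"
proof -
  note ch = submanifold_chart(1)[OF c] and ch0 = submanifold_chart(1)[OF c0]
  let ?f = "cmap c0 \<circ> cinv c" and ?x = "cmap c P"
  have fx: "?f ?x = cmap c0 P" using cinv_cmap[OF ch P(1)] by simp
  have "\<exists>S. open S \<and> ?x \<in> S \<and> (\<forall>y\<in>S. ?f y \<in> V)" if V: "open V" "?f ?x \<in> V" for V
  proof -
    let ?V = "V \<inter> cimage c0"
    have "open ?V" using V(1) ch0 by (auto simp: is_chart_def)
    then have "openin (subtopology (mtop T) N) (cinv c0 ` ?V)" by (intro submanifold_chart(6)[OF c0]) auto
    then obtain O' where O: "openin (mtop T) O'" "cinv c0 ` ?V = O' \<inter> N" by (auto simp: openin_subtopology)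
    have "cmap c0 P \<in> ?V" using V(2) P(2) unfolding fx by (simp add: cmap_in)
    then have "cinv c0 (cmap c0 P) \<in> cinv c0 ` ?V" by blast
    then have "P \<in> O'" using cinv_cmap[OF ch0 P(2)] O(2) by auto
    then have "?x \<in> {x \<in> cimage c. cinv c x \<in> O'}" using P(1) cinv_cmap[OF ch P(1)] by (simp add: cmap_in)
    moreover have "?f y \<in> V" if "y \<in> {x \<in> cimage c. cinv c x \<in> O'}" for y
    proof -
      have "cinv c y \<in> O' \<inter> N" using that cinv_in[of y c] submanifold_chart(2)[OF c] by auto
      then obtain v where "v \<in> ?V" "cinv c y = cinv c0 v" unfolding O(2)[symmetric] by blast
      then show ?thesis using cmap_cinv[of v c0] by simp
    qed
    ultimately show ?thesis using submanifold_preimage_open[OF c O(1)] by blast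
  qed
  then have cont: "isCont ?f ?x" unfolding continuous_at_open by blast
  obtain d where d: "d \<in> T" "P \<in> cdom d"
    using P(1) submanifold_chart(2)[OF c] N by (auto simp: mcarrier_def)
  have D0: "cmap d \<circ> cinv c0 differentiable (at (?f ?x))" "inj (frechet_derivative (cmap d \<circ> cinv c0) (at (?f ?x)))"
    unfolding fx using smooth_on_imp_differentiable[OF submanifold_chart(4)[OF c0 d(1)]] submanifold_chart(5)[OF c0 d(1)] P d
    by auto
  have "cmap d \<circ> cinv c differentiable (at ?x)"
    by (rule smooth_on_imp_differentiable[OF submanifold_chart(4)[OF c d(1)]]) (use P d in auto)
  then have "(\<lambda>y. (cmap d \<circ> cinv c0) (?f y)) differentiable (at ?x)"
  proof (rule differentiable_cong_open[THEN iffD1, rotated 3])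
    show "open (cmap c ` (cdom c \<inter> cdom c0))" by (rule submanifold_overlap_open[OF c c0])
    show "?x \<in> cmap c ` (cdom c \<inter> cdom c0)" using P by auto
    show "(cmap d \<circ> cinv c) y = (cmap d \<circ> cinv c0) (?f y)" if "y \<in> cmap c ` (cdom c \<inter> cdom c0)" for y
      using that by (auto simp: cinv_cmap[OF ch] cinv_cmap[OF ch0])
  qed
  then show ?thesis by (rule differentiable_lift[OF cont D0])
qed

end

lemma smooth_on_vector_derivative:
  fixes f :: "real \<Rightarrow> 'x::real_normed_vector"
  assumes "open S" "smooth_on S f"
  shows "t \<in> S \<Longrightarrow> (f has_vector_derivative vector_derivative f (at t)) (at t)"
    and "smooth_on S (\<lambda>t. vector_derivative f (at t))"
proof -
  have *: "(f has_vector_derivative dd f t 1) (at t)" if "t \<in> S" for t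
    using dd_vector_derivative[OF smooth_on_imp_differentiable[OF assms(2) that] has_vector_derivative_id] by simp
  then show "t \<in> S \<Longrightarrow> (f has_vector_derivative vector_derivative f (at t)) (at t)"
    using vector_derivative_at by metis
  show "smooth_on S (\<lambda>t. vector_derivative f (at t))"
    by (rule smooth_on_cong[OF assms(1), THEN iffD1, OF _ smooth_on_dd[OF assms(2), of 1]])
      (rule vector_derivative_at[OF *, symmetric])
qed

section \<open>The geodesic of the sphere bundle in natural coordinates\<close>

text \<open>The geodesic is called \<Theta> here because \<Gamma> denotes Christoffel
  symbols.\<close>

locale berger_geodesic = berger_bundle A g J \<delta> G
  for A :: "('a, 'e::euclidean_space) chart set" and g J \<delta>
    and G :: "('a \<times> ('a, 'e) tangent, 'e \<times> 'e) metric_field" +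
  fixes B :: "('a \<times> ('a, 'e) tangent, 'f::euclidean_space) chart set"
    and \<Theta> :: "real \<Rightarrow> 'a \<times> ('a, 'e) tangent"
    and \<gamma> :: "real \<Rightarrow> 'a" and I :: "real set" and n :: nat
  assumes dimE: "DIM('e) = 2 * n" and dimF: "DIM('f) = 4 * n - 1"
    and B: "B = submanifold_atlas (tangent_atlas A) (unit_tangent_bundle A g)"
    and I: "open I" "is_interval I"
    and geo: "geodesic B (induced_metric B (tangent_atlas A) G) I \<Theta>"
    and \<gamma>: "\<gamma> = fst \<circ> \<Theta>"
begin

lemma unit_subset: "unit_tangent_bundle A g \<subseteq> mcarrier T"
proof clarify
  fix q \<xi> assume "(q, \<xi>) \<in> unit_tangent_bundle A g"
  then have "q \<in> mcarrier A" "\<xi> \<in> tangent_space A q" by (auto simp: unit_tangent_bundle_def tangent_bundle_def)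
  then obtain c where "c \<in> A" "(q, \<xi>) \<in> cdom (nat_chart c)" by (auto simp: mcarrier_def cdom_nat)
  then show "(q, \<xi>) \<in> mcarrier T" using nat_atlas unfolding mcarrier_def by blast
qed

lemma inj_T: "\<forall>d\<in>T. inj_on (cmap d) (cdom d)"
  using inj_nat by (auto simp: tangent_atlas_def)

lemmas sub_chart = submanifold_chart[OF B unit_subset inj_T]
lemmas sub_overlap_open = submanifold_overlap_open[OF B unit_subset inj_T]
lemmas sub_transition = submanifold_transition_differentiable[OF B unit_subset inj_T]

lemma unit_bundle_point:
  assumes "cB \<in> B" "P \<in> cdom cB"
  shows "snd P \<in> tangent_space A (fst P)" "fst P \<in> mcarrier A" "g (fst P) (snd P) (snd P) = 1"
proof -
  have "P \<in> unit_tangent_bundle A g" using sub_chart(2)[OF assms(1)] assms(2) by blast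
  then show "snd P \<in> tangent_space A (fst P)" "fst P \<in> mcarrier A" "g (fst P) (snd P) (snd P) = 1"
    by (auto simp: unit_tangent_bundle_def tangent_bundle_def metric_norm_def)
qed

abbreviation incl :: "('a \<times> ('a, 'e) tangent, 'f) chart \<Rightarrow> ('a, 'e) chart \<Rightarrow> 'f \<Rightarrow> 'e \<times> 'e" where
  "incl cB c \<equiv> cmap (nat_chart c) \<circ> cinv cB"

abbreviation incl_dom :: "('a \<times> ('a, 'e) tangent, 'f) chart \<Rightarrow> ('a, 'e) chart \<Rightarrow> 'f set" where
  "incl_dom cB c \<equiv> cmap cB ` (cdom cB \<inter> cdom (nat_chart c))"

abbreviation "ind \<equiv> induced_metric B T G"

lemma incl_smooth:
  assumes "cB \<in> B" "c \<in> A"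
  shows "open (incl_dom cB c)" "smooth_on (incl_dom cB c) (incl cB c)"
    "y \<in> incl_dom cB c \<Longrightarrow> inj (frechet_derivative (incl cB c) (at y))"
  using sub_chart(3-5)[OF assms(1) nat_atlas[OF assms(2)]] by blast+

lemma incl_eq: "cB \<in> B \<Longrightarrow> P \<in> cdom cB \<Longrightarrow> incl cB c (cmap cB P) = cmap (nat_chart c) P"
  by (simp add: cinv_cmap[OF sub_chart(1)])

text \<open>Two chain rules: one through the chart \<open>c0\<close> of the submanifold that
  \<open>differential\<close> happens to choose, one through the natural chart \<open>c\<close> that
  \<open>tvec\<close> starts from.\<close>

lemma differential_incl:
  assumes cB: "cB \<in> B" and c: "c \<in> A" and P: "P \<in> cdom cB" "P \<in> cdom (nat_chart c)"
  shows "differential B T (\<lambda>P. P) P (tvec B cB P a) = tvec T (nat_chart c) P (dd (incl cB c) (cmap cB P) a)"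
proof
  fix d'
  define c0 where "c0 = (SOME c. c \<in> B \<and> P \<in> cdom c)"
  have "c0 \<in> B \<and> P \<in> cdom c0" unfolding c0_def by (rule someI[of _ cB]) (use cB P in simp)
  then have c0: "c0 \<in> B" "P \<in> cdom c0" by auto
  note ch = sub_chart(1)[OF cB] and ch0 = sub_chart(1)[OF c0(1)]
  show "differential B T (\<lambda>P. P) P (tvec B cB P a) d' = tvec T (nat_chart c) P (dd (incl cB c) (cmap cB P) a) d'"
  proof (cases "d' \<in> T \<and> P \<in> cdom d'")
    case True
    then obtain e where e: "d' = nat_chart e" "e \<in> A" "P \<in> cdom (nat_chart e)" by (auto simp: tangent_atlas_def)
    have 0: "cmap d' \<circ> (\<lambda>P. P) \<circ> cinv c0 = incl c0 e" by (auto simp: e)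
    have x0: "(cmap c0 \<circ> cinv cB) (cmap cB P) = cmap c0 P" using cinv_cmap[OF ch P(1)] by simp
    have "differential B T (\<lambda>P. P) P (tvec B cB P a) d' = dd (incl c0 e) (cmap c0 P) (dd (cmap c0 \<circ> cinv cB) (cmap cB P) a)"
      using True c0 unfolding differential_def Let_def c0_def[symmetric] 0 by (simp add: tvec_def)
    also have "\<dots> = dd (incl cB e) (cmap cB P) a"
    proof (rule dd_chain(1)[symmetric, where f="cmap c0 \<circ> cinv cB" and x="cmap cB P", unfolded x0])
      show "open (cmap cB ` (cdom cB \<inter> cdom c0))" by (rule sub_overlap_open[OF cB c0(1)])
      show "cmap cB P \<in> cmap cB ` (cdom cB \<inter> cdom c0)" using P c0 by blast
      show "incl cB e y = incl c0 e ((cmap c0 \<circ> cinv cB) y)" if "y \<in> cmap cB ` (cdom cB \<inter> cdom c0)" for y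
        using that by (auto simp: cinv_cmap[OF ch] cinv_cmap[OF ch0])
      show "cmap c0 \<circ> cinv cB differentiable (at (cmap cB P))" by (rule sub_transition[OF cB c0(1) P(1) c0(2)])
      show "incl c0 e differentiable (at (cmap c0 P))"
        by (rule smooth_on_imp_differentiable[OF incl_smooth(2)[OF c0(1) e(2)]]) (use c0 e in blast)
    qed
    also have "\<dots> = dd (cmap (nat_chart e) \<circ> cinv (nat_chart c)) (cmap (nat_chart c) P) (dd (incl cB c) (cmap cB P) a)"
    proof (rule dd_chain(1)[where f="incl cB c" and x="cmap cB P", unfolded incl_eq[OF cB P(1)]])
      show "open (incl_dom cB c \<inter> incl_dom cB e)" using incl_smooth(1)[OF cB] c e by blast
      show "cmap cB P \<in> incl_dom cB c \<inter> incl_dom cB e" using P e by blast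
      show "incl cB e y = (cmap (nat_chart e) \<circ> cinv (nat_chart c)) (incl cB c y)" if "y \<in> incl_dom cB c \<inter> incl_dom cB e" for y
        using that chart_image_iff[OF ch, of y "cdom (nat_chart c)"] by (simp add: nat_cinv_cmap[OF c])
      show "incl cB c differentiable (at (cmap cB P))"
        by (rule smooth_on_imp_differentiable[OF incl_smooth(2)[OF cB c]]) (use P in blast)
      show "cmap (nat_chart e) \<circ> cinv (nat_chart c) differentiable (at (cmap (nat_chart c) P))"
        by (rule nat_transition_differentiable[OF c e(2)])
          (use P e overlap_nat[OF c e(2)] in blast)
    qed
    finally show ?thesis using True by (simp add: tvec_def e(1))
  qed (auto simp: differential_def tvec_def Let_def)
qed

lemma incl_pullback:
  assumes cB: "cB \<in> B" and c: "c \<in> A"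
  shows "pullback (cimage (nat_chart c)) (Gloc c) (incl_dom cB c) (metric_loc B ind cB) (incl cB c)"
proof
  show "open (cimage (nat_chart c))" by (rule open_cimage_nat[OF c])
  show "fam2 (cimage (nat_chart c)) (Gloc c)" by (rule local_metric.m[OF local_metric_nat[OF c]])
  show "open (incl_dom cB c)" "smooth_on (incl_dom cB c) (incl cB c)" by (rule incl_smooth[OF cB c])+
  fix y assume "y \<in> incl_dom cB c"
  then obtain P where P: "y = cmap cB P" "P \<in> cdom cB" "P \<in> cdom (nat_chart c)" by auto
  show "incl cB c y \<in> cimage (nat_chart c)" unfolding P(1) incl_eq[OF cB P(2)] by (rule cmap_in[OF P(3)])
  show "metric_loc B ind cB y a b =
    Gloc c (incl cB c y) (dd (incl cB c) y a) (dd (incl cB c) y b)" for a b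
    unfolding metric_loc_def induced_metric_def P(1) cinv_cmap[OF sub_chart(1)[OF cB] P(2)]
      differential_incl[OF cB c P(2,3)] incl_eq[OF cB P(2)] nat_cinv_cmap[OF c P(3)] by (rule refl)
qed

text \<open>Differentiating the constant squared norm of \<xi> shows one inclusion. The other is a
  dimension count: an injective image of dimension \<open>4 * n - 1\<close> inside the kernel of a
  nonzero linear form.\<close>

lemma range_incl:
  assumes cB: "cB \<in> B" and c: "c \<in> A" and y: "y \<in> incl_dom cB c"
  shows "range (frechet_derivative (incl cB c) (at y)) =
    {W. mloc c (fst (incl cB c y)) (local_hermitian.vert (mloc c) (incl cB c y) W) (snd (incl cB c y)) = 0}"
proof -
  interpret local_hermitian "cimage c" "mloc c" "Jloc c" by (rule local_hermitian_chart[OF c])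
  interpret P: pullback "cimage (nat_chart c)" "Gloc c" "incl_dom cB c" "metric_loc B ind cB" "incl cB c"
    by (rule incl_pullback[OF cB c])
  let ?\<Phi> = "incl cB c" and ?m = "mloc c"
  let ?D = "frechet_derivative ?\<Phi> (at y)"
  define z where "z = ?\<Phi> y"
  define k where "k = (\<lambda>W. ?m (fst z) (vert z W) (snd z))"
  have lin: "linear ?D" by (rule dd_linear[OF P.\<Phi> y])
  have in_c: "fst (?\<Phi> y') \<in> cimage c" if "y' \<in> incl_dom cB c" for y'
    using P.\<Phi>_in[OF that] cimage_nat[OF c] by (metis mem_Times_iff)
  have z: "fst z \<in> cimage c" unfolding z_def by (rule in_c[OF y])
  have unit: "?m (fst (?\<Phi> y')) (snd (?\<Phi> y')) (snd (?\<Phi> y')) = 1" if y': "y' \<in> incl_dom cB c" for y'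
  proof -
    obtain P where P: "y' = cmap cB P" "P \<in> cdom cB" "P \<in> cdom (nat_chart c)" using y' by auto
    note u = unit_bundle_point[OF cB P(2)]
    have q: "fst P \<in> cdom c" using P(3) by (auto simp: cdom_nat)
    show ?thesis unfolding P(1) incl_eq[OF cB P(2)] cmap_nat fst_conv snd_conv
      using metric_loc_eq[OF c q u(1) u(1)] u(3) by simp
  qed
  have klin: "linear k"
    unfolding k_def vert_def by (rule linearI) (simp_all add: m_simps \<Gamma>_simps z algebra_simps)
  have sub: "range ?D \<subseteq> {W. k W = 0}"
  proof (rule image_subsetI)
    fix w
    let ?X = "\<lambda>s. fst (?\<Phi> (y + s *\<^sub>R w))" and ?\<xi> = "\<lambda>s. snd (?\<Phi> (y + s *\<^sub>R w))"
    have X0: "?X 0 \<in> cimage c" using z by (simp add: z_def del: o_apply)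
    have X: "(?X has_vector_derivative fst (?D w)) (at 0)" and \<xi>: "(?\<xi> has_vector_derivative snd (?D w)) (at 0)"
      by (rule bounded_linear.has_vector_derivative[OF bounded_linear_fst P.\<Phi>_line[OF y]]
          bounded_linear.has_vector_derivative[OF bounded_linear_snd P.\<Phi>_line[OF y]])+
    have cov: "covd ?X (fst (?D w)) ?\<xi> 0 (vert z (?D w))"
      by (rule covdI[OF \<xi>]) (simp add: vert_def z_def \<Gamma>_sym[OF z[unfolded z_def]] del: o_apply)
    have "((\<lambda>s. ?m (?X s) (?\<xi> s) (?\<xi> s)) has_vector_derivative k (?D w) + k (?D w)) (at 0)"
      using covd_m[OF X0 X cov cov] m_sym[OF z, of "snd z" "vert z (?D w)"]
      by (simp add: k_def z_def has_real_derivative_iff_has_vector_derivative del: o_apply)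
    moreover have "((\<lambda>s. ?m (?X s) (?\<xi> s) (?\<xi> s)) has_vector_derivative 0) (at 0)"
      by (rule has_vector_derivative_cong_nhds[OF _ has_vector_derivative_const[of 1]])
        (use P.eventually_line[OF y, of w] in \<open>eventually_elim, simp add: unit del: o_apply\<close>)
    ultimately have "k (?D w) + k (?D w) = 0" by (rule vector_derivative_unique_at)
    then show "?D w \<in> {W. k W = 0}" by simp
  qed
  \<comment> \<open>Keeps the natural number subtraction in \<open>4 * n - 1\<close> from
    truncating, so a kernel of dimension below \<open>4 * n\<close> is no larger than the
    range.\<close>
  have n: "n \<ge> 1" using dimE DIM_positive[where 'a='e] by linarith
  have dimD: "dim (range ?D) = 4 * n - 1"
    using dim_image_eq[OF lin, of UNIV] incl_smooth(3)[OF cB c y] dimF by (simp add: inj_on_def inj_def dim_UNIV)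
  \<comment> \<open>The form takes the value 1 on the vertical lift of the unit vector \<xi>, hence
    is nonzero.\<close>
  have "k (0, snd z) = 1" using unit[OF y] by (simp add: k_def vert_def \<Gamma>_simps z z_def[symmetric] del: o_apply)
  then have "{W. k W = 0} \<noteq> UNIV" by (metis UNIV_I mem_Collect_eq zero_neq_one)
  moreover have subK: "subspace {W. k W = 0}" by (rule linear_subspace_kernel[OF klin])
  ultimately have "dim {W. k W = 0} < dim (UNIV :: ('e \<times> 'e) set)"
    using subspace_dim_equal[OF subK subspace_UNIV] by (metis not_less subset_UNIV)
  then have "dim {W. k W = 0} \<le> dim (range ?D)" using dimD dimE n by (simp add: dim_UNIV)
  then have "range ?D = {W. k W = 0}"
    by (intro subspace_dim_equal[OF _ subK sub]) (auto intro: linear_subspace_image[OF lin subspace_UNIV])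
  then show ?thesis by (simp only: k_def z_def)
qed

definition zc :: "('a, 'e) chart \<Rightarrow> real \<Rightarrow> 'e \<times> 'e" where
  "zc c s = cmap (nat_chart c) (\<Theta> s)"

definition z1 :: "('a, 'e) chart \<Rightarrow> real \<Rightarrow> 'e \<times> 'e" where
  "z1 c s = vector_derivative (zc c) (at s)"

definition Jc :: "('a, 'e) chart \<Rightarrow> real set" where
  "Jc c = I \<inter> \<gamma> -` cdom c"

lemma fst_zc: "fst (zc c s) = cmap c (\<gamma> s)" and snd_zc: "snd (zc c s) = snd (\<Theta> s) c"
  by (simp_all add: zc_def cmap_nat \<gamma>)

lemma sub_curve:
  assumes "cB \<in> B"
  shows "open (I \<inter> \<Theta> -` cdom cB)" "smooth_on (I \<inter> \<Theta> -` cdom cB) (cmap cB \<circ> \<Theta>)"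
  using geo assms unfolding geodesic_def smooth_curve_def Let_def by blast+

lemma sub_point: "s \<in> I \<Longrightarrow> \<exists>cB\<in>B. \<Theta> s \<in> cdom cB"
  using geo unfolding geodesic_def smooth_curve_def mcarrier_def by blast

lemma \<Theta>_point:
  assumes "s \<in> I"
  shows "snd (\<Theta> s) \<in> tangent_space A (\<gamma> s)" "\<gamma> s \<in> mcarrier A" "g (\<gamma> s) (snd (\<Theta> s)) (snd (\<Theta> s)) = 1"
  using sub_point[OF assms] unit_bundle_point[of _ "\<Theta> s"] by (auto simp: \<gamma>)

lemma \<Theta>_nat: "s \<in> I \<Longrightarrow> \<Theta> s \<in> cdom (nat_chart c) \<longleftrightarrow> \<gamma> s \<in> cdom c"
  using \<Theta>_point[of s] by (cases "\<Theta> s") (auto simp: cdom_nat \<gamma>)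

lemma curve_incl_dom:
  assumes "cB \<in> B" "s \<in> I" "\<Theta> s \<in> cdom cB"
  shows "cmap cB (\<Theta> s) \<in> incl_dom cB c \<longleftrightarrow> \<gamma> s \<in> cdom c"
  using chart_image_iff[OF sub_chart(1)[OF assms(1)], of "cmap cB (\<Theta> s)"]
    cinv_cmap[OF sub_chart(1)[OF assms(1)] assms(3)] cmap_in[OF assms(3)] \<Theta>_nat[OF assms(2)] by simp

lemma common_domain:
  assumes "cB \<in> B" "c \<in> A"
  shows "open (I \<inter> \<Theta> -` cdom cB \<inter> \<gamma> -` cdom c)"
proof -
  have "open ((I \<inter> \<Theta> -` cdom cB) \<inter> (cmap cB \<circ> \<Theta>) -` incl_dom cB c)"
    by (rule continuous_open_preimage[OF smooth_on_continuous[OF sub_curve(2)[OF assms(1)]]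
        sub_curve(1)[OF assms(1)] incl_smooth(1)[OF assms]])
  also have "(I \<inter> \<Theta> -` cdom cB) \<inter> (cmap cB \<circ> \<Theta>) -` incl_dom cB c = I \<inter> \<Theta> -` cdom cB \<inter> \<gamma> -` cdom c"
    using curve_incl_dom[OF assms(1), of _ c] by (intro set_eqI) (simp, blast)
  finally show ?thesis .
qed

text \<open>Smoothness of the geodesic is given in charts of the submanifold. Locally
  \<open>zc c\<close> is such a coordinate curve followed by the smooth inclusion, and the pieces
  are glued.\<close>

lemma zc_smooth:
  assumes c: "c \<in> A"
  shows "open (Jc c)" "smooth_on (Jc c) (zc c)"
proof -
  have *: "\<exists>N. open N \<and> s \<in> N \<and> N \<subseteq> Jc c \<and> smooth_on N (zc c)" if s: "s \<in> Jc c" for s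
  proof -
    obtain cB where cB: "cB \<in> B" "\<Theta> s \<in> cdom cB" using sub_point s by (auto simp: Jc_def)
    let ?N = "I \<inter> \<Theta> -` cdom cB \<inter> \<gamma> -` cdom c"
    have N: "open ?N" by (rule common_domain[OF cB(1) c])
    have "smooth_on ?N (\<lambda>s. incl cB c ((cmap cB \<circ> \<Theta>) s))"
    proof (rule smooth_on_compose[OF N incl_smooth(1)[OF cB(1) c] _ _ incl_smooth(2)[OF cB(1) c]])
      show "smooth_on ?N (cmap cB \<circ> \<Theta>)" by (rule smooth_on_subset[OF sub_curve(2)[OF cB(1)]]) auto
      show "(cmap cB \<circ> \<Theta>) ` ?N \<subseteq> incl_dom cB c" by (rule image_subsetI) (simp add: curve_incl_dom cB(1))
    qed
    then have "smooth_on ?N (zc c)"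
      by (rule smooth_on_cong[OF N, THEN iffD1, rotated]) (simp add: zc_def cinv_cmap[OF sub_chart(1)[OF cB(1)]])
    then show ?thesis using N s cB by (intro exI[of _ ?N]) (auto simp: Jc_def)
  qed
  show "open (Jc c)" using * by (subst open_subopen) blast
  show "smooth_on (Jc c) (zc c)" by (rule smooth_on_local) (use * in blast)
qed

lemma zc_derivative: "c \<in> A \<Longrightarrow> s \<in> Jc c \<Longrightarrow> (zc c has_vector_derivative z1 c s) (at s)"
  unfolding z1_def by (rule smooth_on_vector_derivative(1)[OF zc_smooth])

lemma z1_smooth: "c \<in> A \<Longrightarrow> smooth_on (Jc c) (z1 c)"
  using smooth_on_vector_derivative(2)[OF zc_smooth] by (simp add: z1_def[abs_def])

lemma Jc_nhds: "c \<in> A \<Longrightarrow> s \<in> Jc c \<Longrightarrow> \<forall>\<^sub>F u in nhds s. u \<in> Jc c"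
  by (rule eventually_nhds_in_open[OF zc_smooth(1)])

lemma position_derivative:
  "c \<in> A \<Longrightarrow> s \<in> Jc c \<Longrightarrow> ((\<lambda>s. cmap c (\<gamma> s)) has_vector_derivative fst (z1 c s)) (at s)"
  using bounded_linear.has_vector_derivative[OF bounded_linear_fst zc_derivative] by (simp add: fst_zc)

lemma fst_z1: "c \<in> A \<Longrightarrow> s \<in> Jc c \<Longrightarrow> velocity A \<gamma> s c = fst (z1 c s)"
  using vector_derivative_at[OF position_derivative] by (auto simp: velocity_def Jc_def comp_def)

text \<open>The geodesic equation freed from the charts of the sphere bundle:
  \<open>range_incl\<close> writes \<open>W\<close> as the image of some \<open>w\<close>,
  \<open>geodesic_first_variation\<close> applies to the inclusion, and \<open>metric_nat\<close>
  replaces \<open>Gloc\<close> by \<open>berger\<close>.\<close>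

lemma geodesic_first_variation_nat:
  assumes c: "c \<in> A" and t: "t \<in> Jc c"
    and W: "mloc c (fst (zc c t)) (local_hermitian.vert (mloc c) (zc c t) W) (snd (zc c t)) = 0"
    and D: "((\<lambda>s. local_hermitian.berger (mloc c) (Jloc c) \<delta> (zc c s) (z1 c s) W) has_real_derivative D) (at t)"
    and E: "((\<lambda>\<epsilon>. local_hermitian.berger (mloc c) (Jloc c) \<delta> (zc c t + \<epsilon> *\<^sub>R W) (z1 c t) (z1 c t))
      has_real_derivative E) (at 0)"
  shows "2 * D = E"
proof -
  obtain cB where cB: "cB \<in> B" "\<Theta> t \<in> cdom cB" using sub_point t by (auto simp: Jc_def)
  interpret P: pullback "cimage (nat_chart c)" "Gloc c" "incl_dom cB c" "metric_loc B ind cB" "incl cB c"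
    by (rule incl_pullback[OF cB(1) c])
  note LM = local_metric_nat[OF c]
  let ?N = "I \<inter> \<Theta> -` cdom cB \<inter> \<gamma> -` cdom c" and ?JB = "I \<inter> \<Theta> -` cdom cB"
  define y where "y = (\<lambda>s. cmap cB (\<Theta> s))"
  define y1 where "y1 = (\<lambda>s. velocity B \<Theta> s cB)"
  have N: "open ?N" "t \<in> ?N" using common_domain[OF cB(1) c] t cB by (auto simp: Jc_def)
  have N_nhds: "\<forall>\<^sub>F s in nhds t. s \<in> ?N" by (rule eventually_nhds_in_open[OF N])
  have ydom: "y s \<in> incl_dom cB c" if "s \<in> ?N" for s using that curve_incl_dom[OF cB(1), of s c] by (simp add: y_def)
  have y_smooth: "smooth_on ?JB y" using sub_curve(2)[OF cB(1)] by (simp add: y_def comp_def)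
  have y1_eq: "y1 s = vector_derivative y (at s)" if "s \<in> ?JB" for s
    using that cB by (simp add: y1_def velocity_def y_def comp_def)
  have y: "(y has_vector_derivative y1 s) (at s)" if "s \<in> ?JB" for s
    unfolding y1_eq[OF that] by (rule smooth_on_vector_derivative(1)[OF sub_curve(1)[OF cB(1)] y_smooth that])
  have "smooth_on ?JB y1"
    by (rule smooth_on_cong[OF sub_curve(1)[OF cB(1)], THEN iffD1, OF _ smooth_on_vector_derivative(2)[OF sub_curve(1)[OF cB(1)] y_smooth]])
      (rule y1_eq[symmetric])
  then have y1: "(y1 has_vector_derivative vector_derivative y1 (at t)) (at t)"
    using N(2) by (intro smooth_on_vector_derivative(1)[OF sub_curve(1)[OF cB(1)]]) auto
  have "cov_deriv B ind \<Theta> (velocity B \<Theta>) t cB = 0" using geo N(2) by (auto simp: geodesic_def)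
  then have eq: "vector_derivative y1 (at t) + christoffel (metric_loc B ind cB) (y t) (y1 t) (y1 t) = 0"
    using cB by (simp add: cov_deriv_def y1_def y_def)
  have z: "incl cB c (y s) = zc c s" if "s \<in> ?N" for s
    using that incl_eq[OF cB(1), of "\<Theta> s" c] by (simp add: y_def zc_def del: o_apply)
  have z1: "dd (incl cB c) (y s) (y1 s) = z1 c s" if s: "s \<in> ?N" for s
  proof -
    have "((\<lambda>s. incl cB c (y s)) has_vector_derivative dd (incl cB c) (y s) (y1 s)) (at s)"
      by (rule dd_vector_derivative[OF smooth_on_imp_differentiable[OF P.\<Phi> ydom[OF s]] y]) (use s in auto)
    then have "(zc c has_vector_derivative dd (incl cB c) (y s) (y1 s)) (at s)"
      by (rule has_vector_derivative_cong_nhds[rotated])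
        (use eventually_nhds_in_open[OF N(1) s] in \<open>eventually_elim, simp add: z del: o_apply\<close>)
    then show ?thesis unfolding z1_def by (rule vector_derivative_at[symmetric])
  qed
  have "W \<in> range (frechet_derivative (incl cB c) (at (y t)))"
    unfolding range_incl[OF cB(1) c ydom[OF N(2)]] z[OF N(2)] using W by simp
  then obtain w where w: "W = dd (incl cB c) (y t) w" by blast
  have zin: "zc c s \<in> cimage (nat_chart c)" if "s \<in> ?N" for s
    using P.\<Phi>_in[OF ydom[OF that]] z[OF that] by simp
  show ?thesis
  proof (rule P.geodesic_first_variation[OF P.local_metric_h[OF LM] _ ydom[OF N(2)] y y1 eq, of w])
    show "inj (frechet_derivative (incl cB c) (at y))" if "y \<in> incl_dom cB c" for y
      by (rule incl_smooth(3)[OF cB(1) c that])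
    show "Gloc c z a b = Gloc c z b a" if "z \<in> cimage (nat_chart c)" for z a b
      by (rule local_metric.m_sym[OF LM that])
    show "t \<in> ?JB" using N by auto
    show "((\<lambda>s. Gloc c (incl cB c (y s)) (dd (incl cB c) (y s) (y1 s)) (dd (incl cB c) (y t) w))
        has_real_derivative D) (at t)"
      unfolding has_real_derivative_iff_has_vector_derivative
      by (rule has_vector_derivative_cong_nhds[OF _ D[unfolded has_real_derivative_iff_has_vector_derivative]])
        (use N_nhds in \<open>eventually_elim, simp only: z z1 metric_nat[OF c zin] w\<close>)
    have lin: "((\<lambda>\<epsilon>. zc c t + \<epsilon> *\<^sub>R W) has_vector_derivative W) (at 0)"
      using has_vector_derivative_add[OF has_vector_derivative_const
        has_vector_derivative_scaleR[OF DERIV_ident has_vector_derivative_const], of "zc c t" W 0 UNIV] by simp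
    have ev: "\<forall>\<^sub>F \<epsilon> in nhds 0. zc c t + \<epsilon> *\<^sub>R W \<in> cimage (nat_chart c)"
      using eventually_in_open[OF open_cimage_nat[OF c] _ lin] zin[OF N(2)] by simp
    show "((\<lambda>\<epsilon>. Gloc c (incl cB c (y t) + \<epsilon> *\<^sub>R dd (incl cB c) (y t) w)
        (dd (incl cB c) (y t) (y1 t)) (dd (incl cB c) (y t) (y1 t))) has_real_derivative E) (at 0)"
      unfolding has_real_derivative_iff_has_vector_derivative w[symmetric] z[OF N(2)] z1[OF N(2)]
      by (rule has_vector_derivative_cong_nhds[OF _ E[unfolded has_real_derivative_iff_has_vector_derivative]])
        (use ev in \<open>eventually_elim, simp only: metric_nat[OF c]\<close>)
  qed
qed

end


subsection \<open>The parallel skew operator along the projected geodesic\<close>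

context berger_geodesic
begin

text \<open>\<open>Vc\<close>, \<open>rc\<close> and \<open>Uc\<close> are V, delta^2 mu and U of
  the overview, in the chart \<open>c\<close>.\<close>

definition Vc :: "('a, 'e) chart \<Rightarrow> real \<Rightarrow> 'e" where
  "Vc c s = local_hermitian.vert (mloc c) (zc c s) (z1 c s)"

definition rc :: "('a, 'e) chart \<Rightarrow> real \<Rightarrow> real" where
  "rc c s = \<delta>\<^sup>2 * mloc c (fst (zc c s)) (Vc c s) (Jloc c (fst (zc c s)) (snd (zc c s)))"

definition Uc :: "('a, 'e) chart \<Rightarrow> real \<Rightarrow> 'e" where
  "Uc c s = Vc c s + rc c s *\<^sub>R Jloc c (fst (zc c s)) (snd (zc c s))"

text \<open>With this sign the first Euler-Lagrange equation says that the covariant derivative of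
  the velocity is \<open>curv\<close> applied to the velocity.\<close>

definition curv :: "('a, 'e) chart \<Rightarrow> real \<Rightarrow> 'e \<Rightarrow> 'e" where
  "curv c s v = - local_metric.R (mloc c) (fst (zc c s)) (snd (zc c s)) (Uc c s) v"

abbreviation covc :: "('a, 'e) chart \<Rightarrow> (real \<Rightarrow> 'e) \<Rightarrow> real \<Rightarrow> 'e \<Rightarrow> bool" where
  "covc c V t N \<equiv> local_metric.covd (mloc c) (\<lambda>s. fst (zc c s)) (fst (z1 c t)) V t N"

lemma fst_zc_in: "c \<in> A \<Longrightarrow> t \<in> Jc c \<Longrightarrow> fst (zc c t) \<in> cimage c"
  by (simp add: fst_zc cmap_in Jc_def)

lemma fst_zc_derivative:
  "c \<in> A \<Longrightarrow> t \<in> Jc c \<Longrightarrow> ((\<lambda>s. fst (zc c s)) has_vector_derivative fst (z1 c t)) (at t)"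
  by (rule bounded_linear.has_vector_derivative[OF bounded_linear_fst zc_derivative])

lemma euler_lagrange:
  assumes c: "c \<in> A" and t: "t \<in> Jc c"
  shows "covc c (\<lambda>s. snd (zc c s)) t (Vc c t)"
    and "covc c (\<lambda>s. fst (z1 c s)) t (curv c t (fst (z1 c t)))"
    and "\<exists>l. covc c (Uc c) t (l *\<^sub>R snd (zc c t) - rc c t *\<^sub>R Jloc c (fst (zc c t)) (Vc c t))"
proof -
  interpret local_hermitian "cimage c" "mloc c" "Jloc c" by (rule local_hermitian_chart[OF c])
  have z1: "(z1 c has_vector_derivative vector_derivative (z1 c) (at t)) (at t)"
    by (rule smooth_on_vector_derivative(1)[OF zc_smooth(1)[OF c] z1_smooth[OF c] t])
  have tI: "t \<in> I" "\<gamma> t \<in> cdom c" using t by (auto simp: Jc_def)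
  have unit: "mloc c (fst (zc c t)) (snd (zc c t)) (snd (zc c t)) = 1"
    unfolding fst_zc snd_zc using metric_loc_eq[OF c tI(2) \<Theta>_point(1) \<Theta>_point(1)] \<Theta>_point(3) tI by simp
  note EL = berger_euler_lagrange[of "\<lambda>s. fst (zc c s)" t "\<lambda>s. fst (z1 c s)" _ "\<lambda>s. snd (zc c s)" "\<lambda>s. snd (z1 c s)" _ \<delta>,
      OF fst_zc_in[OF c t] fst_zc_derivative[OF c t] bounded_linear.has_vector_derivative[OF bounded_linear_fst z1]
        bounded_linear.has_vector_derivative[OF bounded_linear_snd zc_derivative[OF c t]]
        bounded_linear.has_vector_derivative[OF bounded_linear_snd z1] unit,
      unfolded prod.collapse, OF geodesic_first_variation_nat[OF c t]]
  show "covc c (\<lambda>s. snd (zc c s)) t (Vc c t)"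
    and "covc c (\<lambda>s. fst (z1 c s)) t (curv c t (fst (z1 c t)))"
    and "\<exists>l. covc c (Uc c) t (l *\<^sub>R snd (zc c t) - rc c t *\<^sub>R Jloc c (fst (zc c t)) (Vc c t))"
    unfolding curv_def Uc_def[abs_def] rc_def Vc_def by (rule EL; assumption)+
qed

lemma curv_covc:
  assumes c: "c \<in> A" and t: "t \<in> Jc c" and V: "covc c V t N"
  shows "covc c (\<lambda>s. curv c s (V s)) t (curv c t N)"
proof -
  interpret local_hermitian "cimage c" "mloc c" "Jloc c" by (rule local_hermitian_chart[OF c])
  obtain l where "covc c (Uc c) t (l *\<^sub>R snd (zc c t) - rc c t *\<^sub>R Jloc c (fst (zc c t)) (Vc c t))"
    using euler_lagrange(3)[OF c t] by blast
  from covd_curvature_operator[OF fst_zc_in[OF c t] fst_zc_derivative[OF c t] euler_lagrange(1)[OF c t] Uc_def this V]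
  show ?thesis by (simp add: curv_def)
qed

text \<open>The fields \<open>V\<close> along \<open>\<gamma>\<close> with \<open>\<nabla>V/dt = \<R> V\<close> for the skew-symmetric operator \<open>\<R> = curv\<close>,
  which is parallel along \<open>\<gamma>\<close>: they contain the velocity and all its covariant derivatives, and the
  inner product of any two of them is constant.\<close>
definition fld :: "(real \<Rightarrow> ('a, 'e) tangent) \<Rightarrow> bool" where
  "fld V \<longleftrightarrow> (\<forall>t\<in>I. V t \<in> tangent_space A (\<gamma> t) \<and>
    (\<forall>c\<in>A. \<gamma> t \<in> cdom c \<longrightarrow> covc c (\<lambda>s. V s c) t (curv c t (V t c))))"

lemma covc_cong:
  assumes c: "c \<in> A" and t: "t \<in> Jc c" and "covc c V t N" and eq: "\<And>s. s \<in> Jc c \<Longrightarrow> V s = W s"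
  shows "covc c W t N"
proof -
  interpret local_metric "cimage c" "mloc c" by (rule local_metric_chart[OF c])
  have "(V has_vector_derivative N - \<Gamma> (fst (zc c t)) (fst (z1 c t)) (V t)) (at t)"
    using assms(3) by (simp add: covd_def)
  then have "(W has_vector_derivative N - \<Gamma> (fst (zc c t)) (fst (z1 c t)) (V t)) (at t)"
    by (rule has_vector_derivative_cong_nhds[rotated]) (use Jc_nhds[OF c t] in \<open>eventually_elim, simp add: eq\<close>)
  then show ?thesis using eq[OF t] by (simp add: covd_def)
qed

text \<open>Speed and curvatures are constant on \<open>I\<close> only, so the Frenet fields agree
  with combinations with constant coefficients only there.\<close>

lemma fld_cong:
  assumes "fld V" "\<And>t. t \<in> I \<Longrightarrow> V t = W t"
  shows "fld W"
  unfolding fld_def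
proof (intro ballI conjI impI)
  fix t assume t: "t \<in> I"
  show "W t \<in> tangent_space A (\<gamma> t)" using assms t by (auto simp: fld_def)
  fix c assume c: "c \<in> A" "\<gamma> t \<in> cdom c"
  have cV: "covc c (\<lambda>s. V s c) t (curv c t (V t c))" using assms(1) t c by (simp add: fld_def)
  have J: "t \<in> Jc c" using t c by (simp add: Jc_def)
  have "covc c (\<lambda>s. W s c) t (curv c t (V t c))"
    by (rule covc_cong[OF c(1) J cV]) (simp add: assms(2) Jc_def)
  then show "covc c (\<lambda>s. W s c) t (curv c t (W t c))" by (simp only: assms(2)[OF t])
qed

lemma fld_comb:
  assumes "fld V" "fld W"
  shows "fld (\<lambda>t c. r *\<^sub>R V t c + s *\<^sub>R W t c)"
  unfolding fld_def
proof (intro ballI conjI impI)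
  fix t assume t: "t \<in> I"
  show "(\<lambda>c. r *\<^sub>R V t c + s *\<^sub>R W t c) \<in> tangent_space A (\<gamma> t)"
    using assms t by (intro tangent_comb) (auto simp: fld_def)
  fix c assume c: "c \<in> A" "\<gamma> t \<in> cdom c"
  interpret local_metric "cimage c" "mloc c" by (rule local_metric_chart[OF c(1)])
  have J: "t \<in> Jc c" using t c by (simp add: Jc_def)
  note x = fst_zc_in[OF c(1) J]
  have "covc c (\<lambda>s. V s c) t (curv c t (V t c))" "covc c (\<lambda>s. W s c) t (curv c t (W t c))"
    using assms t c by (simp_all add: fld_def)
  then have "covc c (\<lambda>u. r *\<^sub>R V u c + s *\<^sub>R W u c) t (r *\<^sub>R curv c t (V t c) + s *\<^sub>R curv c t (W t c))"
    by (intro covd_add covd_scaleR_const x)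
  then show "covc c (\<lambda>u. r *\<^sub>R V u c + s *\<^sub>R W u c) t (curv c t (r *\<^sub>R V t c + s *\<^sub>R W t c))"
    by (simp add: curv_def R_simps[OF x])
qed

lemma velocity_in_tangent: "t \<in> I \<Longrightarrow> velocity A \<gamma> t \<in> tangent_space A (\<gamma> t)"
proof (rule velocity_tangent)
  fix c assume t: "t \<in> I" and c: "c \<in> A" "\<gamma> t \<in> cdom c"
  then have J: "t \<in> Jc c" by (simp add: Jc_def)
  show "(cmap c \<circ> \<gamma>) differentiable (at t)"
    using differentiableI_vector[OF position_derivative[OF c(1) J]] by (simp add: comp_def)
  show "\<forall>\<^sub>F s in nhds t. \<gamma> s \<in> cdom c"
    using Jc_nhds[OF c(1) J] by eventually_elim (simp add: Jc_def)
qed (rule \<Theta>_point(2))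

lemma fld_velocity: "fld (velocity A \<gamma>)"
  unfolding fld_def
proof (intro ballI conjI impI velocity_in_tangent)
  fix t c assume "t \<in> I" and c: "c \<in> A" "\<gamma> t \<in> cdom c"
  then have J: "t \<in> Jc c" by (simp add: Jc_def)
  show "covc c (\<lambda>s. velocity A \<gamma> s c) t (curv c t (velocity A \<gamma> t c))"
    using covc_cong[OF c(1) J euler_lagrange(2)[OF c(1) J], of "\<lambda>s. velocity A \<gamma> s c"]
    by (simp add: fst_z1[OF c(1)] J)
qed

lemma fld_zero: "fld (\<lambda>t c. 0)"
  using fld_comb[OF fld_velocity fld_velocity, of 0 0] by simp

lemma cov_deriv_fld:
  assumes "fld V" "c \<in> A" "t \<in> Jc c"
  shows "cov_deriv A g \<gamma> V t c = curv c t (V t c)"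
proof -
  interpret local_metric "cimage c" "mloc c" by (rule local_metric_chart[OF assms(2)])
  have tI: "t \<in> I" "\<gamma> t \<in> cdom c" using assms(3) by (auto simp: Jc_def)
  have "covc c (\<lambda>s. V s c) t (curv c t (V t c))" using assms(1,2) tI by (simp add: fld_def)
  then have "vector_derivative (\<lambda>s. V s c) (at t) = curv c t (V t c) - \<Gamma> (fst (zc c t)) (fst (z1 c t)) (V t c)"
    unfolding covd_def by (rule vector_derivative_at)
  then show ?thesis
    using tI assms(2) fst_z1[OF assms(2,3)] by (simp add: cov_deriv_def fst_zc)
qed

text \<open>The components match between charts because \<open>covd_transform\<close> and uniqueness
  of covariant derivatives force them to; this avoids separate transformation laws for
  \<open>Vc\<close>, \<open>Uc\<close> and \<open>curv\<close>. Since \<open>curv\<close> is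
  parallel, it commutes with covariant differentiation, so the derivative of \<open>V\<close>
  satisfies the same equation as \<open>V\<close>.\<close>

lemma fld_cov_deriv:
  assumes V: "fld V"
  shows "fld (cov_deriv A g \<gamma> V)"
  unfolding fld_def
proof (intro ballI conjI impI)
  fix t assume t: "t \<in> I"
  show "cov_deriv A g \<gamma> V t \<in> tangent_space A (\<gamma> t)"
  proof (rule tangentI)
    fix c d assume cd: "c \<in> A" "d \<in> A" "\<gamma> t \<in> cdom c" "\<gamma> t \<in> cdom d"
    interpret I: local_isometry "cimage c" "mloc c" "cimage d" "mloc d" "overlap c d" "trans c d"
      by (rule trans_isometry[OF cd(1,2)])
    have J: "t \<in> Jc c" "t \<in> Jc d" using t cd by (auto simp: Jc_def)
    have Vt: "V s d = dd (trans c d) (fst (zc c s)) (V s c)" if "s \<in> Jc c" "s \<in> Jc d" for s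
      unfolding fst_zc using V that cd by (intro tangent_apply) (auto simp: fld_def Jc_def)
    have "fst (z1 c t) = velocity A \<gamma> t c" "fst (z1 d t) = velocity A \<gamma> t d" using fst_z1 cd J by auto
    then have v: "fst (z1 d t) = dd (trans c d) (fst (zc c t)) (fst (z1 c t))"
      unfolding fst_zc using tangent_apply[OF velocity_in_tangent[OF t] cd] by simp
    have x: "fst (zc c t) \<in> overlap c d" using cd by (simp add: fst_zc)
    have xd: "trans c d (fst (zc c t)) = fst (zc d t)" using trans_eq cd by (simp add: fst_zc del: o_apply)
    have "covc c (\<lambda>s. V s c) t (curv c t (V t c))" using V t cd by (simp add: fld_def)
    note I.covd_transform[OF x fst_zc_derivative[OF cd(1) J(1)] this]
    then have "((\<lambda>s. dd (trans c d) (fst (zc c s)) (V s c)) has_vector_derivative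
        dd (trans c d) (fst (zc c t)) (curv c t (V t c)) - I.M'.\<Gamma> (fst (zc d t)) (fst (z1 d t)) (V t d)) (at t)"
      unfolding I.M'.covd_def v[symmetric] Vt[OF J, symmetric] xd .
    then have "((\<lambda>s. V s d) has_vector_derivative
        dd (trans c d) (fst (zc c t)) (curv c t (V t c)) - I.M'.\<Gamma> (fst (zc d t)) (fst (z1 d t)) (V t d)) (at t)"
      by (rule has_vector_derivative_cong_nhds[rotated])
        (use Jc_nhds[OF cd(1) J(1)] Jc_nhds[OF cd(2) J(2)] in \<open>eventually_elim, simp only: Vt\<close>)
    then have "covc d (\<lambda>s. V s d) t (dd (trans c d) (fst (zc c t)) (curv c t (V t c)))"
      by (simp only: I.M'.covd_def)
    moreover have "covc d (\<lambda>s. V s d) t (curv d t (V t d))" using V t cd by (simp add: fld_def)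
    ultimately have "dd (trans c d) (fst (zc c t)) (curv c t (V t c)) = curv d t (V t d)"
      by (rule I.M'.covd_unique)
    then show "cov_deriv A g \<gamma> V t d = dd (trans c d) (cmap c (\<gamma> t)) (cov_deriv A g \<gamma> V t c)"
      unfolding cov_deriv_fld[OF V cd(1) J(1)] cov_deriv_fld[OF V cd(2) J(2)] fst_zc by simp
  qed (auto simp: cov_deriv_def)
  fix c assume c: "c \<in> A" "\<gamma> t \<in> cdom c"
  then have J: "t \<in> Jc c" using t by (simp add: Jc_def)
  have "covc c (\<lambda>s. V s c) t (curv c t (V t c))" using V t c by (simp add: fld_def)
  then have "covc c (\<lambda>s. curv c s (V s c)) t (curv c t (curv c t (V t c)))" by (rule curv_covc[OF c(1) J])
  then have "covc c (\<lambda>s. cov_deriv A g \<gamma> V s c) t (curv c t (curv c t (V t c)))"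
    by (rule covc_cong[OF c(1) J]) (rule cov_deriv_fld[OF V c(1), symmetric])
  then show "covc c (\<lambda>s. cov_deriv A g \<gamma> V s c) t (curv c t (cov_deriv A g \<gamma> V t c))"
    by (simp only: cov_deriv_fld[OF V c(1) J])
qed

lemma fld_norm_constant:
  assumes V: "fld V"
  shows "(\<lambda>t. metric_norm g (\<gamma> t) (V t)) constant_on I"
proof -
  have "(\<lambda>t. g (\<gamma> t) (V t) (V t)) constant_on I"
  proof (rule has_field_derivative_0_imp_constant_on)
    show "connected I" "open I" using I by (auto simp: is_interval_connected)
    fix t assume t: "t \<in> I"
    obtain c where c: "c \<in> A" "\<gamma> t \<in> cdom c" using \<Theta>_point(2)[OF t] by (auto simp: mcarrier_def)
    then have J: "t \<in> Jc c" using t by (simp add: Jc_def)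
    interpret local_metric "cimage c" "mloc c" by (rule local_metric_chart[OF c(1)])
    note x = fst_zc_in[OF c(1) J]
    have cV: "covc c (\<lambda>s. V s c) t (curv c t (V t c))" using V t c by (simp add: fld_def)
    \<comment> \<open>A skew operator sends \<open>V t c\<close> to a vector orthogonal to it, so
      the squared norm has derivative 0.\<close>
    have "mloc c (fst (zc c t)) (curv c t (V t c)) (V t c) = 0"
      using R_skew[OF x, of "snd (zc c t)" "Uc c t" "V t c" "V t c"]
        m_sym[OF x, of "R (fst (zc c t)) (snd (zc c t)) (Uc c t) (V t c)" "V t c"] by (simp add: curv_def m_simps x)
    then have "((\<lambda>s. mloc c (fst (zc c s)) (V s c) (V s c)) has_real_derivative 0) (at t)"
      using covd_m[OF x fst_zc_derivative[OF c(1) J] cV cV] m_sym[OF x, of "V t c"] by simp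
    then have "((\<lambda>s. mloc c (fst (zc c s)) (V s c) (V s c)) has_vector_derivative 0) (at t)"
      by (simp only: has_real_derivative_iff_has_vector_derivative)
    then have "((\<lambda>t. g (\<gamma> t) (V t) (V t)) has_vector_derivative 0) (at t)"
    proof (rule has_vector_derivative_cong_nhds[rotated])
      show "\<forall>\<^sub>F s in nhds t. mloc c (fst (zc c s)) (V s c) (V s c) = g (\<gamma> s) (V s) (V s)"
        using Jc_nhds[OF c(1) J]
      proof eventually_elim
        case (elim s)
        then have "s \<in> I" "\<gamma> s \<in> cdom c" by (auto simp: Jc_def)
        then show ?case unfolding fst_zc using V by (intro metric_loc_eq[OF c(1)]) (auto simp: fld_def)
      qed
    qed
    then show "((\<lambda>t. g (\<gamma> t) (V t) (V t)) has_field_derivative 0) (at t)"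
      by (simp only: has_real_derivative_iff_has_vector_derivative)
  qed
  then show ?thesis by (auto simp: constant_on_def metric_norm_def)
qed

section \<open>The Frenet recursion inside the space of such fields\<close>

text \<open>Since fields in \<open>fld\<close> have constant norm, normalising them and weighting
  them by the previous curvature uses constant coefficients, so no step of the recursion leaves
  \<open>fld\<close>.\<close>

lemma frenet_fld:
  "fld (fst (frenet A g \<gamma> i)) \<and> fld (fst (snd (frenet A g \<gamma> i))) \<and> snd (snd (frenet A g \<gamma> i)) constant_on I"
proof -
  obtain \<kappa> where \<kappa>: "metric_norm g (\<gamma> t) (velocity A \<gamma> t) = \<kappa>" if "t \<in> I" for t
    using fld_norm_constant[OF fld_velocity] by (auto simp: constant_on_def)
  show ?thesis
  proof (induction i)
    case 0
    have "fld (unit_velocity A g \<gamma>)"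
      by (rule fld_cong[OF fld_comb[OF fld_velocity fld_zero, of "inverse \<kappa>" 0]]) (simp add: unit_velocity_def \<kappa>)
    then show ?case by (simp add: fld_zero constant_on_def)
  next
    case (Suc i)
    obtain \<nu> \<nu>' k where f: "frenet A g \<gamma> i = (\<nu>, \<nu>', k)" by (metis prod_cases3)
    have IH: "fld \<nu>" "fld \<nu>'" using Suc f by auto
    obtain k0 where k0: "k t = k0" if "t \<in> I" for t using Suc f by (auto simp: constant_on_def)
    define w where "w = (\<lambda>t c. arc_cov_deriv A g \<gamma> \<nu>' t c + k t *\<^sub>R \<nu> t c)"
    have w: "fld w"
      by (rule fld_cong[OF fld_comb[OF fld_cov_deriv[OF IH(2)] IH(1), of "inverse \<kappa>" k0]])
        (simp add: w_def arc_cov_deriv_def \<kappa> k0)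
    obtain k1 where k1: "metric_norm g (\<gamma> t) (w t) = k1" if "t \<in> I" for t
      using fld_norm_constant[OF w] by (auto simp: constant_on_def)
    \<comment> \<open>If \<open>k1 = 0\<close>, the coefficient \<open>inverse k1\<close> is 0 and
      the result is the zero field, as the convention in \<open>frenet\<close> demands.\<close>
    have "fld (\<lambda>t c. w t c /\<^sub>R metric_norm g (\<gamma> t) (w t))"
      by (rule fld_cong[OF fld_comb[OF w fld_zero, of "inverse k1" 0]]) (simp add: k1)
    moreover have "frenet A g \<gamma> (Suc i) = (\<nu>', (\<lambda>t c. w t c /\<^sub>R metric_norm g (\<gamma> t) (w t)), (\<lambda>t. metric_norm g (\<gamma> t) (w t)))"
      by (simp add: f Let_def w_def)
    ultimately show ?case using IH(2) fld_norm_constant[OF w] by (simp del: frenet.simps)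
  qed
qed

section \<open>Regularity of the projected curve\<close>

lemma smooth_curve_\<gamma>: "smooth_curve A I \<gamma>"
proof -
  have "smooth_on (Jc c) (cmap c \<circ> \<gamma>)" if "c \<in> A" for c
    using smooth_on_bounded_linear[OF zc_smooth(1)[OF that] bounded_linear_fst zc_smooth(2)[OF that]]
    by (simp add: fst_zc comp_def)
  then show ?thesis
    using zc_smooth(1) \<Theta>_point(2) by (auto simp: smooth_curve_def Let_def Jc_def)
qed

text \<open>The speed is constant, so vanishing once it vanishes on all of \<open>I\<close>. Then
  the curve is locally constant in charts, hence constant on the connected set
  \<open>I\<close>.\<close>

lemma velocity_nonzero:
  assumes "\<not> \<gamma> constant_on I" "t \<in> I"
  shows "velocity A \<gamma> t \<noteq> (\<lambda>c. 0)"
proof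
  assume v0: "velocity A \<gamma> t = (\<lambda>c. 0)"
  obtain \<kappa> where \<kappa>: "metric_norm g (\<gamma> s) (velocity A \<gamma> s) = \<kappa>" if "s \<in> I" for s
    using fld_norm_constant[OF fld_velocity] by (auto simp: constant_on_def)
  have norm: "metric_norm g (\<gamma> s) (velocity A \<gamma> s) = sqrt (mloc c (fst (zc c s)) (velocity A \<gamma> s c) (velocity A \<gamma> s c))"
    if "c \<in> A" "s \<in> Jc c" for c s
    unfolding fst_zc metric_norm_def using that velocity_in_tangent by (subst metric_loc_eq) (auto simp: Jc_def)
  obtain c where c: "c \<in> A" "t \<in> Jc c" using \<Theta>_point(2)[OF assms(2)] assms(2) by (auto simp: mcarrier_def Jc_def)
  interpret M: local_metric "cimage c" "mloc c" by (rule local_metric_chart[OF c(1)])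
  have "\<kappa> = 0" using \<kappa>[OF assms(2)] norm[OF c] v0 M.m_simps(9)[OF fst_zc_in[OF c]] by simp
  have zero: "fst (z1 c s) = 0" if c: "c \<in> A" "s \<in> Jc c" for c s
  proof (rule ccontr)
    assume "fst (z1 c s) \<noteq> 0"
    then have "mloc c (fst (zc c s)) (velocity A \<gamma> s c) (velocity A \<gamma> s c) > 0"
      using local_metric.m_pos[OF local_metric_chart[OF c(1)] fst_zc_in[OF c]] fst_z1[OF c] by simp
    then show False using norm[OF c] \<kappa>[of s] \<open>\<kappa> = 0\<close> c(2) by (auto simp: Jc_def)
  qed
  have "\<gamma> a = \<gamma> b" if "a \<in> I" "b \<in> I" for a b
  proof (rule connected_local_const[of I, OF _ that])
    show "connected I" using I by (simp add: is_interval_connected)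
    show "\<forall>a\<in>I. \<forall>\<^sub>F b in at a within I. \<gamma> a = \<gamma> b"
    proof
      fix a assume a: "a \<in> I"
      obtain c where c: "c \<in> A" "a \<in> Jc c" using \<Theta>_point(2)[OF a] a by (auto simp: mcarrier_def Jc_def)
      \<comment> \<open>A ball inside \<open>Jc c\<close> is convex and stays in one chart, so the
        zero derivative there makes the coordinates constant.\<close>
      obtain e where e: "e > 0" "ball a e \<subseteq> Jc c" using zc_smooth(1)[OF c(1)] c(2) open_contains_ball by blast
      have "\<exists>p. \<forall>s\<in>ball a e. cmap c (\<gamma> s) = p"
      proof (rule has_vector_derivative_zero_constant)
        show "convex (ball a e)" by (rule convex_ball)
        show "((\<lambda>s. cmap c (\<gamma> s)) has_vector_derivative 0) (at s within ball a e)" if "s \<in> ball a e" for s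
        proof -
          have "s \<in> Jc c" using that e(2) by blast
          then show ?thesis
            using position_derivative[OF c(1), of s] zero[OF c(1), of s]
            by (simp add: has_vector_derivative_at_within)
        qed
      qed blast
      then have "cmap c (\<gamma> s) = cmap c (\<gamma> a)" if "s \<in> ball a e" for s
        using that e(1) by (metis centre_in_ball)
      note cmap_const = this
      have "\<gamma> a = \<gamma> s" if "s \<in> ball a e" for s
      proof -
        have s: "\<gamma> s \<in> cdom c" and a: "\<gamma> a \<in> cdom c" using that e(2) c(2) by (auto simp: Jc_def)
        show ?thesis
          by (rule trans[OF cinv_cmap[OF chart[OF c(1)] a, symmetric]
              cinv_cmap[OF chart[OF c(1)] s, unfolded cmap_const[OF that]]])
      qed
      then show "\<forall>\<^sub>F b in at a within I. \<gamma> a = \<gamma> b"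
        unfolding eventually_at_topological using open_ball[of a e] centre_in_ball[of a e] e(1) by blast
    qed
  qed
  then show False using assms unfolding constant_on_def by blast
qed

end

theorem theorem2p1:
  fixes A :: "('a, 'e::euclidean_space) chart set"
    and g :: "('a, 'e) metric_field"
    and J :: "('a, 'e) endo_field"
    and \<delta> :: real
    and G :: "('a \<times> ('a, 'e) tangent, 'e \<times> 'e) metric_field"
    and B :: "('a \<times> ('a, 'e) tangent, 'f::euclidean_space) chart set"
    and \<Gamma> :: "real \<Rightarrow> 'a \<times> ('a, 'e) tangent"
    and \<gamma> :: "real \<Rightarrow> 'a"
    and I :: "real set"
    and n :: nat
  assumes "DIM('e) = 2 * n"
    and "hermitian_locally_symmetric A g J"
    and "berger_metric A g J \<delta> G"
    and "DIM('f) = 4 * n - 1"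
    and "B = submanifold_atlas (tangent_atlas A) (unit_tangent_bundle A g)"
    and "open I" and "is_interval I"
    and "geodesic B (induced_metric B (tangent_atlas A) G) I \<Gamma>"
    and "\<gamma> = fst \<circ> \<Gamma>"
    and "\<not> \<gamma> constant_on I"
  shows "regular_curve A I \<gamma> \<and>
    (\<forall>i\<in>{1..2 * n - 1}. geodesic_curvature A g \<gamma> i constant_on I)"
proof -
  have "smooth_manifold A" "riemannian_metric A g"
    using assms(2) unfolding hermitian_locally_symmetric_def hermitian_manifold_def by blast+
  then interpret berger_geodesic A g J \<delta> G B \<Gamma> \<gamma> I n
    using assms by unfold_locales
  show ?thesis
    using smooth_curve_\<gamma> velocity_nonzero[OF assms(10)] frenet_fld
    by (simp add: regular_curve_def geodesic_curvature_def)
qed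

end
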